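(* The tableau system $\mathsf{TC}_{\mathsf{SCI}}$ is a complexity-optimal decision procedure for the satisfiability problem of $\mathsf{SCI}$ (given an $\mathsf{SCI}$-formula $\varphi$, decide whether $\varphi$ is satisfiable): it decides this problem in nondeterministic polynomial time with respect to the size of $\varphi$, matching the $\mathsf{NP}$-completeness of $\mathsf{SCI}$-satisfiability.
   Context: Logic SCI. Fix a countably infinite set $\mathsf{AF}$ of atomic formulas. The set $\mathsf{FOR}$ of SCI-formulas is given by $\varphi ::= p \mid \neg\varphi \mid \varphi\to\varphi \mid \varphi\equiv\varphi$ with $p\in\mathsf{AF}$. An SCI-model is a structure $\mathcal{M}=\langle U,D,\tilde\neg,\tilde\to,\tilde\equiv\rangle$ where $U\neq\emptyset$, $D\subseteq U$, $\tilde\neg:U\to U$, $\tilde\to,\tilde\equiv:U\times U\to U$, such that for all $a,b\in U$: $\tilde\neg a\in D$ iff $a\notin D$; $a\tilde\to b\in D$ iff $a\notin D$ or $b\in D$; $a\tilde\equiv b\in D$ iff $a=b$. A valuation in $\mathcal{M}$ is a map $V:\mathsf{FOR}\to U$ with $V(\neg\varphi)=\tilde\neg V(\varphi)$, $V(\varphi\to\psi)=V(\varphi)\tilde\to V(\psi)$, $V(\varphi\equiv\psi)=V(\varphi)\tilde\equiv V(\psi)$. $\varphi$ is satisfiable if $V(\varphi)\in D$ for some SCI-model and valuation. It is known that SCI-satisfiability is $\mathsf{NP}$-complete. The size $|\varphi|$ is the number of occurrences of subformulas of $\varphi$. Tableau system $\mathsf{TC}_{\mathsf{SCI}}$. Let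 $\mathsf{L}^+,\mathsf{L}^-$ be disjoint countably infinite sets of labels, $\mathsf{L}=\mathsf{L}^+\cup\mathsf{L}^-$; a label written $w^+$ lies in $\mathsf{L}^+$, $w^-$ in $\mathsf{L}^-$, an unsuperscripted label is arbitrary. A labelled formula is $w:\varphi$. Equality statements $w=v$ and inequality statements $w\neq v$ may also occur. A tableau is a tree whose nodes carry labelled formulas, (in)equality statements or $\bot$; a branch is a root-to-leaf path, identified with the set of items on it. Rules (premises / alternative conclusion sets separated by $\mid$): Decomposition rules (all labels in the conclusions are fresh on the branch): $(\neg^+)$ $w^+:\neg\varphi$ / $v^-:\varphi$; $(\neg^-)$ $w^-:\neg\varphi$ / $v^+:\varphi$; $(\to^+)$ $w^+:\varphi\to\psi$ / $\{v^-:\varphi,u^-:\psi\}\mid\{v^-:\varphi,u^+:\psi\}\mid\{v^+:\varphi,u^+:\psi\}$; $(\to^-)$ $w^-:\varphi\to\psi$ / $\{v^+:\varphi,u^-:\psi\}$; $(\equiv^+)$ $w^+:\varphi\equiv\psi$ / $\{v^+:\varphi,u^+:\psi,v^+=u^+\}\mid\{v^-:\varphi,u^-:\psi,v^-=u^-\}$; $(\equiv^-)$ $w^-:\varphi\equiv\psi$ / $\{v^+:\varphi,u^+:\psi,v^+\neq u^+\}\mid\{v^+:\varphi,u^-:\psi\}\mid\{v^-:\varphi,u^+:\psi\}\mid\{v^-:\varphi,u^-:\psi,v^-\neq u^-\}$. Equality rules, where $\varphi\approx\psi$ abbreviates the three premises $w:\varphi$, $v:\psi$, $w=v$ for some labels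 $w,v$: $(\equiv^\neg)$ $\varphi\approx\psi$, $u:\neg\varphi$, $y:\neg\psi$ / $u=y$; $(\equiv^\to)$ $\varphi\approx\psi$, $\chi\approx\theta$, $x:\varphi\to\chi$, $z:\psi\to\theta$ / $x=z$; $(\equiv^\equiv)$ $\varphi\approx\psi$, $\chi\approx\theta$, $x:\varphi\equiv\chi$, $z:\psi\equiv\theta$ / $x=z$; $(\mathsf F)$ $w:\varphi$, $v:\varphi$ / $w=v$; $(\mathsf{sym})$ $w=v$ / $v=w$; $(\mathsf{tran})$ $w=v$, $v=u$ / $w=u$. Closure rules: $(\bot_1)$ $w=v$, $w\neq v$ / $\bot$; $(\bot_2)$ $w^+=v^-$ / $\bot$. A decomposition rule may be applied to $w:\varphi$ on a branch only if it has not been applied to $w:\varphi$ there before; an equality rule only if its conclusion is not already on the branch; closure rules are applied eagerly. A branch is closed if a closure rule has been applied on it, open otherwise; fully expanded if closed or no rule is applicable. $\varphi$ is tableau-satisfiable if there is an open fully expanded tableau with root $w^+:\varphi$. The decision procedure runs $\mathsf{TC}_{\mathsf{SCI}}$ from root $w^+:\varphi$ and answers "satisfiable" iff an open fully expanded branch is obtained. *)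

theory Defs
  imports Main "HOL-Computational_Algebra.Polynomial"
begin

datatype form = Atom nat | Neg form | Imp form form | Ident form form

fun fsize :: "form \<Rightarrow> nat" where
  "fsize (Atom p) = 1"
| "fsize (Neg f) = 1 + fsize f"
| "fsize (Imp f g) = 1 + fsize f + fsize g"
| "fsize (Ident f g) = 1 + fsize f + fsize g"

fun atoms :: "form \<Rightarrow> nat set" where
  "atoms (Atom p) = {p}"
| "atoms (Neg f) = atoms f"
| "atoms (Imp f g) = atoms f \<union> atoms g"
| "atoms (Ident f g) = atoms f \<union> atoms g"

record 'u sci_struct =
  U :: "'u set"
  D :: "'u set"
  mneg :: "'u \<Rightarrow> 'u"
  mimp :: "'u \<Rightarrow> 'u \<Rightarrow> 'u"
  mident :: "'u \<Rightarrow> 'u \<Rightarrow> 'u"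

definition sci_model :: "'u sci_struct \<Rightarrow> bool" where
  "sci_model M \<longleftrightarrow>
     U M \<noteq> {} \<and> D M \<subseteq> U M \<and>
     (\<forall>a\<in>U M. mneg M a \<in> U M) \<and>
     (\<forall>a\<in>U M. \<forall>b\<in>U M. mimp M a b \<in> U M \<and> mident M a b \<in> U M) \<and>
     (\<forall>a\<in>U M. mneg M a \<in> D M \<longleftrightarrow> a \<notin> D M) \<and>
     (\<forall>a\<in>U M. \<forall>b\<in>U M. mimp M a b \<in> D M \<longleftrightarrow> a \<notin> D M \<or> b \<in> D M) \<and>
     (\<forall>a\<in>U M. \<forall>b\<in>U M. mident M a b \<in> D M \<longleftrightarrow> a = b)"

definition valuation :: "'u sci_struct \<Rightarrow> (form \<Rightarrow> 'u) \<Rightarrow> bool" where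
  "valuation M V \<longleftrightarrow>
     (\<forall>f. V f \<in> U M) \<and>
     (\<forall>f. V (Neg f) = mneg M (V f)) \<and>
     (\<forall>f g. V (Imp f g) = mimp M (V f) (V g)) \<and>
     (\<forall>f g. V (Ident f g) = mident M (V f) (V g))"

text \<open>HOL cannot quantify over the type that a universe lives in, so satisfiability is relative
  to a type \<open>'u\<close>; universes are arbitrary nonempty subsets of it. All infinite types give the same notion;
  a finite type may be too small to contain the universe that a given formula needs.\<close>

definition satisfiable :: "'u itself \<Rightarrow> form \<Rightarrow> bool" where
  "satisfiable _ f \<longleftrightarrow>
     (\<exists>(M :: 'u sci_struct) V. sci_model M \<and> valuation M V \<and> V f \<in> D M)"

datatype label = Plus nat | Minus nat

datatype item = Fm label form | Eq label label | Neq label label | Bot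

fun item_labels :: "item \<Rightarrow> label set" where
  "item_labels (Fm w f) = {w}"
| "item_labels (Eq w v) = {w, v}"
| "item_labels (Neq w v) = {w, v}"
| "item_labels Bot = {}"

definition labels :: "item set \<Rightarrow> label set" where
  "labels B = \<Union> (item_labels ` B)"

text \<open>The labels introduced by one rule application are new to the branch and pairwise different.
  (With a common label for \<open>\<phi>\<close> and \<open>\<psi>\<close> the rule \<open>F\<close> would yield \<open>\<phi> \<approx> \<psi>\<close>, which is unsound.)\<close>

definition fresh :: "item set \<Rightarrow> label list \<Rightarrow> bool" where
  "fresh B ls \<longleftrightarrow> distinct ls \<and> set ls \<inter> labels B = {}"

text \<open>\<open>decomp B w f alts\<close>: applying the decomposition rule for \<open>w : f\<close> on a branch with
  items \<open>B\<close> can produce the alternative conclusion sets \<open>alts\<close>.\<close>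

inductive decomp :: "item set \<Rightarrow> label \<Rightarrow> form \<Rightarrow> item list list \<Rightarrow> bool"
  for B :: "item set" where
  neg_plus: "fresh B [Minus v] \<Longrightarrow>
    decomp B (Plus w) (Neg f) [[Fm (Minus v) f]]"
| neg_minus: "fresh B [Plus v] \<Longrightarrow>
    decomp B (Minus w) (Neg f) [[Fm (Plus v) f]]"
| imp_plus: "fresh B [Plus v, Minus v', Plus u, Minus u'] \<Longrightarrow>
    decomp B (Plus w) (Imp f g)
      [[Fm (Minus v') f, Fm (Minus u') g],
       [Fm (Minus v') f, Fm (Plus u) g],
       [Fm (Plus v) f, Fm (Plus u) g]]"
| imp_minus: "fresh B [Plus v, Minus u'] \<Longrightarrow>
    decomp B (Minus w) (Imp f g) [[Fm (Plus v) f, Fm (Minus u') g]]"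
| ident_plus: "fresh B [Plus v, Minus v', Plus u, Minus u'] \<Longrightarrow>
    decomp B (Plus w) (Ident f g)
      [[Fm (Plus v) f, Fm (Plus u) g, Eq (Plus v) (Plus u)],
       [Fm (Minus v') f, Fm (Minus u') g, Eq (Minus v') (Minus u')]]"
| ident_minus: "fresh B [Plus v, Minus v', Plus u, Minus u'] \<Longrightarrow>
    decomp B (Minus w) (Ident f g)
      [[Fm (Plus v) f, Fm (Plus u) g, Neq (Plus v) (Plus u)],
       [Fm (Plus v) f, Fm (Minus u') g],
       [Fm (Minus v') f, Fm (Plus u) g],
       [Fm (Minus v') f, Fm (Minus u') g, Neq (Minus v') (Minus u')]]"

definition sim :: "item set \<Rightarrow> form \<Rightarrow> form \<Rightarrow> bool" where
  "sim B f g \<longleftrightarrow> (\<exists>w v. Fm w f \<in> B \<and> Fm v g \<in> B \<and> Eq w v \<in> B)"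

inductive eq_rule :: "item set \<Rightarrow> label \<Rightarrow> label \<Rightarrow> bool"
  for B :: "item set" where
  eq_neg: "sim B f g \<Longrightarrow> Fm u (Neg f) \<in> B \<Longrightarrow> Fm y (Neg g) \<in> B \<Longrightarrow> eq_rule B u y"
| eq_imp: "sim B f g \<Longrightarrow> sim B h k \<Longrightarrow> Fm x (Imp f h) \<in> B \<Longrightarrow> Fm z (Imp g k) \<in> B \<Longrightarrow>
    eq_rule B x z"
| eq_ident: "sim B f g \<Longrightarrow> sim B h k \<Longrightarrow> Fm x (Ident f h) \<in> B \<Longrightarrow> Fm z (Ident g k) \<in> B \<Longrightarrow>
    eq_rule B x z"
| F: "Fm w f \<in> B \<Longrightarrow> Fm v f \<in> B \<Longrightarrow> eq_rule B w v"
| sym: "Eq w v \<in> B \<Longrightarrow> eq_rule B v w"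
| tran: "Eq w v \<in> B \<Longrightarrow> Eq v u \<in> B \<Longrightarrow> eq_rule B w u"

inductive closure_rule :: "item set \<Rightarrow> bool"
  for B :: "item set" where
  bot1: "Eq w v \<in> B \<Longrightarrow> Neq w v \<in> B \<Longrightarrow> closure_rule B"
| bot2: "Eq (Plus w) (Minus v) \<in> B \<Longrightarrow> closure_rule B"

text \<open>A branch is the list of its items together with the record of the labelled formulas that
  have been decomposed on it.\<close>

record branch =
  items :: "item list"
  decomposed :: "(label \<times> form) set"

definition closed_branch :: "branch \<Rightarrow> bool" where
  "closed_branch b \<longleftrightarrow> Bot \<in> set (items b)"

text \<open>\<open>expand b bs\<close>: some rule may be applied on \<open>b\<close>, and replaces it by the branches \<open>bs\<close>.
  Eagerness of the closure rules: the other rules require that no closure rule is applicable.\<close>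

inductive expand :: "branch \<Rightarrow> branch list \<Rightarrow> bool" where
  closure: "\<not> closed_branch b \<Longrightarrow> closure_rule (set (items b)) \<Longrightarrow>
    expand b [b\<lparr>items := items b @ [Bot]\<rparr>]"
| decomposition: "\<not> closed_branch b \<Longrightarrow> \<not> closure_rule (set (items b)) \<Longrightarrow>
    Fm w f \<in> set (items b) \<Longrightarrow> (w, f) \<notin> decomposed b \<Longrightarrow>
    decomp (set (items b)) w f alts \<Longrightarrow>
    expand b (map (\<lambda>a. \<lparr>items = items b @ a, decomposed = insert (w, f) (decomposed b)\<rparr>) alts)"
| equality: "\<not> closed_branch b \<Longrightarrow> \<not> closure_rule (set (items b)) \<Longrightarrow>
    eq_rule (set (items b)) w v \<Longrightarrow> Eq w v \<notin> set (items b) \<Longrightarrow>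
    expand b [b\<lparr>items := items b @ [Eq w v]\<rparr>]"

definition fully_expanded :: "branch \<Rightarrow> bool" where
  "fully_expanded b \<longleftrightarrow> closed_branch b \<or> \<not> (\<exists>bs. expand b bs)"

text \<open>One rule application, followed along one of its alternatives.\<close>

definition extends :: "branch \<Rightarrow> branch \<Rightarrow> bool" where
  "extends b b' \<longleftrightarrow> (\<exists>bs. expand b bs \<and> b' \<in> set bs)"

definition start :: "nat \<Rightarrow> form \<Rightarrow> branch" where
  "start w f = \<lparr>items = [Fm (Plus w) f], decomposed = {}\<rparr>"

text \<open>A node of a tree carries all items on the path from the root to it (not only the items added
  there), so the leaves are the branches.\<close>

datatype tree_tab = Tab (root: branch) (subtabs: "tree_tab list")

inductive tableau :: "tree_tab \<Rightarrow> bool" where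
  leaf: "tableau (Tab b [])"
| node: "expand b (map root ts) \<Longrightarrow> (\<And>t. t \<in> set ts \<Longrightarrow> tableau t) \<Longrightarrow> tableau (Tab b ts)"

fun branches :: "tree_tab \<Rightarrow> branch set" where
  "branches (Tab b ts) = (if ts = [] then {b} else \<Union> (branches ` set ts))"

definition full_tableau_for :: "form \<Rightarrow> tree_tab \<Rightarrow> bool" where
  "full_tableau_for f t \<longleftrightarrow>
     tableau t \<and> (\<exists>w. root t = start w f) \<and> (\<forall>b \<in> branches t. fully_expanded b)"

definition open_tableau :: "tree_tab \<Rightarrow> bool" where
  "open_tableau t \<longleftrightarrow> (\<exists>b \<in> branches t. \<not> closed_branch b)"

definition tableau_satisfiable :: "form \<Rightarrow> bool" where
  "tableau_satisfiable f \<longleftrightarrow> (\<exists>t. full_tableau_for f t \<and> open_tableau t)"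

text \<open>The machine model is a nondeterministic register machine whose registers hold binary trees
  (the flow-chart variant of Jones' WHILE language, N. D. Jones, Computability and Complexity:
  From a Programming Perspective, 1997). Every instruction is a single operation on pointers
  into an immutable heap of pairs; there is no unit-cost comparison of trees. With unit cost per
  instruction, and inputs measured by their number of nodes, the polynomial-time and the
  nondeterministic polynomial-time problems are those of Turing machines.\<close>

datatype tree = Tip | Node tree tree

fun tsize :: "tree \<Rightarrow> nat" where
  "tsize Tip = 1"
| "tsize (Node a b) = 1 + tsize a + tsize b"

fun left :: "tree \<Rightarrow> tree" where
  "left Tip = Tip"
| "left (Node a b) = a"

fun right :: "tree \<Rightarrow> tree" where
  "right Tip = Tip"
| "right (Node a b) = b"

datatype instr =
    CLEAR nat
  | MOVE nat nat
  | NODE nat nat nat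
  | LEFT nat nat
  | RIGHT nat nat
  | JUMP nat
  | JTIP nat nat
  | CHOOSE nat

type_synonym prog = "instr list"
type_synonym config = "nat \<times> (nat \<Rightarrow> tree)"

text \<open>\<open>JTIP r l\<close> jumps to \<open>l\<close> if register \<open>r\<close> holds \<open>Tip\<close>; \<open>CHOOSE l\<close> nondeterministically
  jumps to \<open>l\<close> or continues.\<close>

fun exec :: "instr \<Rightarrow> config \<Rightarrow> config set" where
  "exec (CLEAR r) (pc, s) = {(Suc pc, s(r := Tip))}"
| "exec (MOVE r x) (pc, s) = {(Suc pc, s(r := s x))}"
| "exec (NODE r x y) (pc, s) = {(Suc pc, s(r := Node (s x) (s y)))}"
| "exec (LEFT r x) (pc, s) = {(Suc pc, s(r := left (s x)))}"
| "exec (RIGHT r x) (pc, s) = {(Suc pc, s(r := right (s x)))}"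
| "exec (JUMP l) (pc, s) = {(l, s)}"
| "exec (JTIP r l) (pc, s) = {(if s r = Tip then l else Suc pc, s)}"
| "exec (CHOOSE l) (pc, s) = {(l, s), (Suc pc, s)}"

definition step :: "prog \<Rightarrow> config \<Rightarrow> config \<Rightarrow> bool" where
  "step P c c' \<longleftrightarrow> fst c < length P \<and> c' \<in> exec (P ! fst c) c"

definition init :: "tree \<Rightarrow> config" where
  "init x = (0, (\<lambda>_. Tip)(0 := x))"

definition results :: "prog \<Rightarrow> tree \<Rightarrow> (nat \<Rightarrow> tree) set" where
  "results P x = {s. \<exists>n pc. (step P ^^ n) (init x) (pc, s) \<and> pc \<ge> length P}"

text \<open>The final content of register 0 is the answer: \<open>Tip\<close> means rejection.\<close>

definition accepts :: "prog \<Rightarrow> tree \<Rightarrow> bool" where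
  "accepts P x \<longleftrightarrow> (\<exists>s \<in> results P x. s 0 \<noteq> Tip)"

text \<open>Every computation on \<open>x\<close>, whatever its choices, halts after at most \<open>T\<close> steps.\<close>

definition halts_within :: "prog \<Rightarrow> tree \<Rightarrow> nat \<Rightarrow> bool" where
  "halts_within P x T \<longleftrightarrow> (\<forall>n c. (step P ^^ n) (init x) c \<longrightarrow> n \<le> T)"

definition poly_time :: "prog \<Rightarrow> bool" where
  "poly_time P \<longleftrightarrow> (\<exists>p :: nat poly. \<forall>x. halts_within P x (poly p (tsize x)))"

definition decides :: "prog \<Rightarrow> tree set \<Rightarrow> bool" where
  "decides P L \<longleftrightarrow> (\<forall>x. accepts P x \<longleftrightarrow> x \<in> L)"

definition NP :: "tree set set" where
  "NP = {L. \<exists>P. poly_time P \<and> decides P L}"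

definition deterministic :: "prog \<Rightarrow> bool" where
  "deterministic P \<longleftrightarrow> (\<forall>l. CHOOSE l \<notin> set P)"

text \<open>The explicit bound on the output size is needed because shared subtrees allow a tree
  of exponential size to be built in polynomially many steps.\<close>

definition poly_time_computable :: "(tree \<Rightarrow> tree) \<Rightarrow> bool" where
  "poly_time_computable h \<longleftrightarrow>
     (\<exists>P. deterministic P \<and> poly_time P \<and> (\<forall>x. \<forall>s \<in> results P x. s 0 = h x)) \<and>
     (\<exists>q :: nat poly. \<forall>x. tsize (h x) \<le> poly q (tsize x))"

definition poly_reducible :: "tree set \<Rightarrow> tree set \<Rightarrow> bool" where
  "poly_reducible L L' \<longleftrightarrow> (\<exists>h. poly_time_computable h \<and> (\<forall>x. x \<in> L \<longleftrightarrow> h x \<in> L'))"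

definition NP_hard :: "tree set \<Rightarrow> bool" where
  "NP_hard L \<longleftrightarrow> (\<forall>L' \<in> NP. poly_reducible L' L)"

definition NP_complete :: "tree set \<Rightarrow> bool" where
  "NP_complete L \<longleftrightarrow> L \<in> NP \<and> NP_hard L"

text \<open>Binary notation, least significant bit first.\<close>

fun enc_nat :: "nat \<Rightarrow> tree" where
  "enc_nat n =
     (if n = 0 then Tip else Node (if odd n then Node Tip Tip else Tip) (enc_nat (n div 2)))"

declare enc_nat.simps [simp del]

fun enc_form :: "form \<Rightarrow> tree" where
  "enc_form (Atom p) = Node (enc_nat 0) (enc_nat p)"
| "enc_form (Neg f) = Node (enc_nat 1) (enc_form f)"
| "enc_form (Imp f g) = Node (enc_nat 2) (Node (enc_form f) (enc_form g))"
| "enc_form (Ident f g) = Node (enc_nat 3) (Node (enc_form f) (enc_form g))"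

fun enc_label :: "label \<Rightarrow> tree" where
  "enc_label (Plus n) = Node (enc_nat 0) (enc_nat n)"
| "enc_label (Minus n) = Node (enc_nat 1) (enc_nat n)"

fun enc_item :: "item \<Rightarrow> tree" where
  "enc_item (Fm w f) = Node (enc_nat 0) (Node (enc_label w) (enc_form f))"
| "enc_item (Eq w v) = Node (enc_nat 1) (Node (enc_label w) (enc_label v))"
| "enc_item (Neq w v) = Node (enc_nat 2) (Node (enc_label w) (enc_label v))"
| "enc_item Bot = Node (enc_nat 3) Tip"

definition enc_items :: "item list \<Rightarrow> tree" where
  "enc_items xs = foldr (\<lambda>i. Node (enc_item i)) xs Tip"

text \<open>\<open>fsize\<close> does not count the length of the names of atoms. Up to that length it
  agrees with the size of the encoding.\<close>

lemma fsize_le_tsize_enc_form: "fsize f \<le> tsize (enc_form f)"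
  by (induction f) auto

lemma tsize_enc_nat: "n < 2 ^ k \<Longrightarrow> tsize (enc_nat n) \<le> 4 * k + 1"
proof (induction k arbitrary: n)
  case 0
  then show ?case by (simp add: enc_nat.simps)
next
  case (Suc k)
  show ?case
  proof (cases "n = 0")
    case True
    then show ?thesis by (simp add: enc_nat.simps)
  next
    case False
    have "n div 2 < 2 ^ k" using Suc.prems by auto
    then have "tsize (enc_nat (n div 2)) \<le> 4 * k + 1" by (rule Suc.IH)
    then show ?thesis using False by (subst enc_nat.simps) auto
  qed
qed

lemma tsize_enc_form: "atoms f \<subseteq> {..<2 ^ k} \<Longrightarrow> tsize (enc_form f) \<le> (4 * k + 11) * fsize f"
proof (induction f)
  case (Atom p)
  then show ?case
    using tsize_enc_nat[of p k] by (simp add: enc_nat.simps[of 0])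
next
  case (Neg f)
  have "tsize (enc_nat 1) \<le> 5" using tsize_enc_nat[of 1 1] by simp
  then show ?case using Neg by (simp add: algebra_simps)
next
  case (Imp f g)
  have "tsize (enc_nat 2) \<le> 9" using tsize_enc_nat[of 2 2] by simp
  then show ?case using Imp by (simp add: algebra_simps)
next
  case (Ident f g)
  have "tsize (enc_nat 3) \<le> 9" using tsize_enc_nat[of 3 2] by simp
  then show ?case using Ident by (simp add: algebra_simps)
qed

definition SCI_SAT :: "'u itself \<Rightarrow> tree set" where
  "SCI_SAT T = enc_form ` {f. satisfiable T f}"

text \<open>\<open>runs_tableau P f\<close>: on input \<open>f\<close>, the computations of \<open>P\<close> construct the branches of a
  fully expanded tableau for \<open>f\<close>. Each computation produces one branch (in register 1; the
  nondeterminism selects the alternatives), and accepts iff that branch is open.\<close>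

definition runs_tableau :: "prog \<Rightarrow> form \<Rightarrow> bool" where
  "runs_tableau P f \<longleftrightarrow>
     (\<exists>t. full_tableau_for f t \<and>
        {(s 0 \<noteq> Tip, s 1) | s. s \<in> results P (enc_form f)} =
        {(\<not> closed_branch b, enc_items (items b)) | b. b \<in> branches t})"

end

(* Soundness: an interpretation of the labels in a model survives, along one alternative, every rule
   application. Completeness: the classes of labels on an open fully expanded branch form a model.
   Decomposition consumes subformula occurrences, so a branch has at most |f| labels and |f|^2
   equalities, whence the polynomial bound on its length.

   The machine program tests each rule premise by a bounded first-order query over the list of items;
   such queries compile to nested loops of polynomial running time.

   NP-hardness is a version of Cook's theorem that exploits the identity connective: being a congruence,
   it makes SCI formulas usable as terms, so that time steps, register contents and trees are denoted by
   formulas over a fixed finite set of atoms and each machine instruction becomes a conjunction of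
   identities. *)

theory Submission
  imports Defs
begin

subsection \<open>Branch invariants and termination\<close>

text \<open>Fresh labels are pairwise distinct, so on a branch every label carries exactly one
  formula. Labels can therefore be counted through subformula occurrences, and a search through
  pairs of labelled formulas meets every instance of the equality rules, even of those whose
  premises are equalities only. Soundness follows some alternative of each rule and completeness
  inspects any open branch, so every fully expanded tableau answers correctly and the program may
  fix a strategy.

  The obstacle on the machine side is that the outcomes of all choices have to be the branches of
  one and the same tableau. Hence execution relates a command to the list of its outcomes, and the
  tableau is assembled along the run.

  In the reduction the machine has no arithmetic: the time bound becomes a power
  \<open>(n + c) ^ k\<close>, counted in unary by nested loops. An arbitrary model may have several
  elements for one tree and may identify program locations; the formula only has to force an
  accepting run. The converse uses one intended model, which exploits that a true implication may
  have any designated value.\<close>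

fun pol :: "label \<Rightarrow> bool" where
  "pol (Plus n) = True"
| "pol (Minus n) = False"

definition fms :: "item set \<Rightarrow> (label \<times> form) set" where
  "fms B = {(w, f). Fm w f \<in> B}"

definition eqs :: "item set \<Rightarrow> (label \<times> label) set" where
  "eqs B = {(w, v). Eq w v \<in> B}"

lemma fms_simps [simp]:
  "fms {} = {}"
  "fms (insert (Fm w f) B) = insert (w, f) (fms B)"
  "fms (insert (Eq w v) B) = fms B"
  "fms (insert (Neq w v) B) = fms B"
  "fms (insert Bot B) = fms B"
  "fms (A \<union> B) = fms A \<union> fms B"
  by (auto simp: fms_def)

lemma mem_fms [simp]: "(w, f) \<in> fms B \<longleftrightarrow> Fm w f \<in> B"
  by (simp add: fms_def)

lemma eqs_simps [simp]:
  "eqs {} = {}"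
  "eqs (insert (Fm w f) B) = eqs B"
  "eqs (insert (Eq w v) B) = insert (w, v) (eqs B)"
  "eqs (insert (Neq w v) B) = eqs B"
  "eqs (insert Bot B) = eqs B"
  "eqs (A \<union> B) = eqs A \<union> eqs B"
  by (auto simp: eqs_def)

lemma mem_eqs [simp]: "(w, v) \<in> eqs B \<longleftrightarrow> Eq w v \<in> B"
  by (simp add: eqs_def)

lemma labels_simps [simp]:
  "labels {} = {}"
  "labels (insert i B) = item_labels i \<union> labels B"
  "labels (A \<union> B) = labels A \<union> labels B"
  by (auto simp: labels_def)

lemma item_labelsI: "i \<in> B \<Longrightarrow> w \<in> item_labels i \<Longrightarrow> w \<in> labels B"
  by (auto simp: labels_def)

lemma finite_labels [simp]: "finite B \<Longrightarrow> finite (labels B)"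
proof -
  have "finite (item_labels i)" for i by (cases i) auto
  then show "finite B \<Longrightarrow> finite (labels B)" by (auto simp: labels_def)
qed

lemma finite_fms [simp]: "finite B \<Longrightarrow> finite (fms B)"
  by (rule finite_subset[of _ "(\<lambda>i. case i of Fm w f \<Rightarrow> (w, f)) ` B"])
    (force simp: fms_def image_iff)+

lemma eqs_subset: "eqs B \<subseteq> labels B \<times> labels B"
  by (auto intro: item_labelsI)

lemma finite_eqs [simp]: "finite B \<Longrightarrow> finite (eqs B)"
  by (rule finite_subset[OF eqs_subset]) simp

text \<open>A Hintikka condition for one labelled formula: it forgets which alternative was taken
  and keeps what the truth value at \<open>w\<close> needs. Being monotone in the items, it survives
  all later extensions of the branch.\<close>

fun dec_ok :: "item set \<Rightarrow> label \<Rightarrow> form \<Rightarrow> bool" where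
  "dec_ok B w (Atom p) \<longleftrightarrow> True"
| "dec_ok B w (Neg f) \<longleftrightarrow> (\<exists>v. Fm v f \<in> B \<and> (pol v \<longleftrightarrow> \<not> pol w))"
| "dec_ok B w (Imp f g) \<longleftrightarrow>
     (\<exists>v u. Fm v f \<in> B \<and> Fm u g \<in> B \<and> (pol w \<longleftrightarrow> pol v \<longrightarrow> pol u))"
| "dec_ok B w (Ident f g) \<longleftrightarrow>
     (\<exists>v u. Fm v f \<in> B \<and> Fm u g \<in> B \<and>
        (if pol w then Eq v u \<in> B else Neq v u \<in> B \<or> pol v \<noteq> pol u))"

lemma dec_ok_mono: "dec_ok B w f \<Longrightarrow> B \<subseteq> B' \<Longrightarrow> dec_ok B' w f"
  by (cases f) (auto 4 4)

text \<open>Each alternative contains every immediate subformula exactly once under a label of its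
  own; only the principal connective is lost, whence the \<open>Suc\<close>. Both the bound on
  labels and the termination measure rest on this count.\<close>

lemma decomp_alt_conj:
  assumes "decomp B w f alts" and "a \<in> set alts"
  shows "inj_on fst (fms (set a)) \<and> fst ` fms (set a) \<inter> labels B = {} \<and>
    Suc (\<Sum>p\<in>fms (set a). fsize (snd p)) = fsize f \<and>
    labels (set a) = fst ` fms (set a) \<and> Bot \<notin> set a"
  using assms(1)
proof cases
  case (neg_plus v w f)
  then show ?thesis using assms(2) by (simp add: fresh_def insert_commute)
next
  case (neg_minus v w f)
  then show ?thesis using assms(2) by (simp add: fresh_def insert_commute)
next
  case (imp_plus v v' u u' w f g)
  then show ?thesis using assms(2) by (simp add: fresh_def) (elim disjE; simp add: insert_commute)
next
  case (imp_minus v u' w f g)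
  then show ?thesis using assms(2) by (simp add: fresh_def insert_commute)
next
  case (ident_plus v v' u u' w f g)
  then show ?thesis using assms(2) by (simp add: fresh_def) (elim disjE; simp add: insert_commute)
next
  case (ident_minus v v' u u' w f g)
  then show ?thesis using assms(2) by (simp add: fresh_def) (elim disjE; simp add: insert_commute)
qed

lemmas decomp_alt =
  decomp_alt_conj[THEN conjunct1]
  decomp_alt_conj[THEN conjunct2, THEN conjunct1]
  decomp_alt_conj[THEN conjunct2, THEN conjunct2, THEN conjunct1]
  decomp_alt_conj[THEN conjunct2, THEN conjunct2, THEN conjunct2, THEN conjunct1]
  decomp_alt_conj[THEN conjunct2, THEN conjunct2, THEN conjunct2, THEN conjunct2]

lemma dec_okI:
  "Fm v f \<in> B \<Longrightarrow> (pol v \<longleftrightarrow> \<not> pol w) \<Longrightarrow> dec_ok B w (Neg f)"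
  "Fm v f \<in> B \<Longrightarrow> Fm u g \<in> B \<Longrightarrow> (pol w \<longleftrightarrow> pol v \<longrightarrow> pol u) \<Longrightarrow> dec_ok B w (Imp f g)"
  "Fm v f \<in> B \<Longrightarrow> Fm u g \<in> B \<Longrightarrow> pol w \<Longrightarrow> Eq v u \<in> B \<Longrightarrow> dec_ok B w (Ident f g)"
  "Fm v f \<in> B \<Longrightarrow> Fm u g \<in> B \<Longrightarrow> \<not> pol w \<Longrightarrow> Neq v u \<in> B \<Longrightarrow> dec_ok B w (Ident f g)"
  "Fm v f \<in> B \<Longrightarrow> Fm u g \<in> B \<Longrightarrow> \<not> pol w \<Longrightarrow> pol v \<noteq> pol u \<Longrightarrow> dec_ok B w (Ident f g)"
  by auto

lemma decomp_dec_ok: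
  assumes "decomp B w f alts"
  shows "\<forall>a\<in>set alts. dec_ok (set a) w f"
  using assms
proof cases
  case (neg_plus v w g)
  then show ?thesis using dec_okI(1)[of "Minus v"] by simp
next
  case (neg_minus v w g)
  then show ?thesis using dec_okI(1)[of "Plus v"] by simp
next
  case (imp_plus v v' u u' w g h)
  then show ?thesis
    using dec_okI(2)[of "Minus v'" g _ "Minus u'" h] dec_okI(2)[of "Minus v'" g _ "Plus u" h]
      dec_okI(2)[of "Plus v" g _ "Plus u" h] by (simp del: dec_ok.simps)
next
  case (imp_minus v u' w g h)
  then show ?thesis using dec_okI(2)[of "Plus v" g _ "Minus u'" h] by (simp del: dec_ok.simps)
next
  case (ident_plus v v' u u' w g h)
  then show ?thesis
    using dec_okI(3)[of "Minus v'" g _ "Minus u'" h] dec_okI(3)[of "Plus v" g _ "Plus u" h]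
    by (simp del: dec_ok.simps)
next
  case (ident_minus v v' u u' w g h)
  then show ?thesis
    using dec_okI(4)[of "Minus v'" g _ "Minus u'" h] dec_okI(4)[of "Plus v" g _ "Plus u" h]
      dec_okI(5)[of "Minus v'" g _ "Plus u" h] dec_okI(5)[of "Plus v" g _ "Minus u'" h]
    by (simp del: dec_ok.simps)
qed

lemma decomp_alts_nonempty: "decomp B w f alts \<Longrightarrow> alts \<noteq> []"
  by (induction rule: decomp.induct) auto

lemma decomp_exists:
  assumes "finite B" and "\<And>p. f \<noteq> Atom p"
  shows "\<exists>alts. decomp B w f alts"
proof -
  let ?idx = "\<lambda>l. case l of Plus n \<Rightarrow> n | Minus n \<Rightarrow> n"
  have "finite (?idx ` labels B)" using assms(1) by simp
  then obtain k where "\<forall>n\<in>?idx ` labels B. n \<le> k"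
    using finite_nat_set_iff_bounded_le by blast
  then have k: "Plus n \<notin> labels B" "Minus n \<notin> labels B" if "n > k" for n
    using that by fastforce+
  \<comment> \<open>Labels of opposite sign never coincide, so one index beyond \<open>k\<close>
    serves both signs.\<close>
  have one: "fresh B [Plus (Suc k)]" "fresh B [Minus (Suc k)]"
    and two: "fresh B [Plus (Suc k), Minus (Suc (Suc k))]"
    and four: "fresh B [Plus (Suc k), Minus (Suc k), Plus (Suc (Suc k)), Minus (Suc (Suc k))]"
    using k by (auto simp: fresh_def)
  show ?thesis
    by (cases f; cases w)
      (use assms(2) in \<open>blast intro: decomp.intros one two four\<close>)+
qed

section \<open>Branch invariant and termination measure\<close>

definition und :: "branch \<Rightarrow> (label \<times> form) set" where
  "und b = fms (set (items b)) - decomposed b"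

text \<open>The last conjunct is an amortised count: an undecomposed formula of size s gives rise to
  at most s - 1 further labels. Decomposition trades potential labels for actual ones, so
  \<open>N\<close> also bounds the labels of all later branches.\<close>

definition binv :: "nat \<Rightarrow> branch \<Rightarrow> bool" where
  "binv N b \<longleftrightarrow>
     inj_on fst (fms (set (items b))) \<and>
     labels (set (items b)) = fst ` fms (set (items b)) \<and>
     decomposed b \<subseteq> fms (set (items b)) \<and>
     (\<forall>(w, f) \<in> decomposed b. dec_ok (set (items b)) w f) \<and>
     card (labels (set (items b))) + (\<Sum>p\<in>und b. fsize (snd p) - 1) \<le> N"

text \<open>One summand per kind of rule: formula size still to be consumed, room left among the
  \<open>N * N\<close> possible equalities, and the single \<open>Bot\<close>. Atoms are never
  decomposed and contribute a constant.\<close>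

definition mu :: "nat \<Rightarrow> branch \<Rightarrow> nat" where
  "mu N b = (\<Sum>p\<in>und b. fsize (snd p)) + (N * N - card (eqs (set (items b)))) +
     (if Bot \<in> set (items b) then 0 else 1)"

lemma fsize_pos: "fsize f > 0"
  by (cases f) auto

lemma finite_und [simp]: "finite (und b)"
  by (simp add: und_def)

lemma binv_start: "binv (fsize f) (start w f)"
  using fsize_pos[of f] by (auto simp: binv_def start_def und_def)

lemma mu_start: "mu (fsize f) (start w f) \<le> fsize f * fsize f + fsize f + 1"
  by (auto simp: mu_def start_def und_def)

lemma eq_rule_labels: "eq_rule B w v \<Longrightarrow> w \<in> labels B \<and> v \<in> labels B"
  by (induction rule: eq_rule.induct) (auto intro: item_labelsI)

lemma und_decomposition:
  assumes inv: "binv N b" and d: "decomp (set (items b)) w f alts" and a: "a \<in> set alts"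
    and wf: "(w, f) \<in> und b"
  shows "und \<lparr>items = items b @ a, decomposed = insert (w, f) (decomposed b)\<rparr> =
    (und b - {(w, f)}) \<union> fms (set a)"
    and "und b \<inter> fms (set a) = {}"
proof -
  have "labels (set (items b)) = fst ` fms (set (items b))"
    and sub: "decomposed b \<subseteq> fms (set (items b))" using inv by (simp_all add: binv_def)
  then have disj: "fms (set (items b)) \<inter> fms (set a) = {}" using decomp_alt(2)[OF d a] by auto
  then show "und b \<inter> fms (set a) = {}" by (auto simp: und_def)
  have "(w, f) \<notin> fms (set a)" using disj wf unfolding und_def by blast
  moreover have "decomposed b \<inter> fms (set a) = {}" using sub disj by blast
  ultimately show "und \<lparr>items = items b @ a, decomposed = insert (w, f) (decomposed b)\<rparr> =
    (und b - {(w, f)}) \<union> fms (set a)" unfolding und_def by auto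
qed

text \<open>A rule lowers its own summand of \<open>mu\<close> and raises no other. For the strict
  decrease, the bound on labels matters in the equality case, where the truncated difference must
  not already be 0.\<close>

lemma expand_step:
  assumes ex: "expand b bs" and inv: "binv N b" and mem: "b' \<in> set bs"
  shows "binv N b' \<and> mu N b' < mu N b"
  using ex
proof cases
  case closure
  then have b': "b' = b\<lparr>items := items b @ [Bot]\<rparr>" using mem by simp
  have "und b' = und b" by (auto simp: b' und_def)
  moreover have "dec_ok (insert Bot (set (items b))) w f"
    if "dec_ok (set (items b)) w f" for w f using that by (rule dec_ok_mono) auto
  ultimately show ?thesis using inv closure by (auto simp: b' binv_def mu_def closed_branch_def)
next
  case (decomposition w f alts)
  let ?B = "set (items b)"
  obtain a where a: "a \<in> set alts"
    and b': "b' = \<lparr>items = items b @ a, decomposed = insert (w, f) (decomposed b)\<rparr>"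
    using decomposition(1) mem by auto
  note alt = decomp_alt[OF decomposition(6) a]
  note I = inv[unfolded binv_def]
  have lab: "labels ?B = fst ` fms ?B" using I by simp
  have wf: "(w, f) \<in> und b" using decomposition by (simp add: und_def)
  note u = und_decomposition[OF inv decomposition(6) a wf]
  have und': "und b' = (und b - {(w, f)}) \<union> fms (set a)" unfolding b' by (rule u(1))
  have dis2: "(und b - {(w, f)}) \<inter> fms (set a) = {}" using u(2) by blast
  have S: "sum h (und b') = sum h (und b - {(w, f)}) + sum h (fms (set a))"
    for h :: "_ \<Rightarrow> nat" unfolding und' by (rule sum.union_disjoint) (use dis2 in auto)
  have S2: "sum h (und b) = h (w, f) + sum h (und b - {(w, f)})" for h :: "_ \<Rightarrow> nat"
    by (rule sum.remove) (use wf in auto)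
  have c1: "card (fms (set a)) = card (labels (set a))"
    unfolding alt(4) using alt(1) by (simp add: card_image)
  \<comment> \<open>Splitting each size into its predecessor and 1 turns the size equation for the
    alternative into a count of its new labels.\<close>
  have "(\<Sum>p\<in>fms (set a). fsize (snd p)) = (\<Sum>p\<in>fms (set a). (fsize (snd p) - 1) + 1)"
    using fsize_pos by (intro sum.cong) (auto simp: Suc_leI)
  also have "\<dots> = (\<Sum>p\<in>fms (set a). fsize (snd p) - 1) + card (labels (set a))"
    by (simp add: sum.distrib c1 del: One_nat_def)
  finally have c2: "Suc ((\<Sum>p\<in>fms (set a). fsize (snd p) - 1) + card (labels (set a))) = fsize f"
    using alt(3) by simp
  have c3: "card (labels (set (items b'))) \<le> card (labels ?B) + card (labels (set a))"
    by (simp add: b' card_Un_le)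
  have IN: "card (labels ?B) + (\<Sum>p\<in>und b. fsize (snd p) - 1) \<le> N" using I by blast
  have "card (labels (set (items b'))) + (\<Sum>p\<in>und b'. fsize (snd p) - 1) \<le> N"
    using c2 c3 S[of "\<lambda>p. fsize (snd p) - 1"] S2[of "\<lambda>p. fsize (snd p) - 1"] IN fsize_pos[of f]
    unfolding snd_conv by linarith
  moreover have "inj_on fst (fms (set (items b')))"
  proof -
    have "fst ` (fms ?B - fms (set a)) \<inter> fst ` (fms (set a) - fms ?B) = {}"
      using alt(2) lab by blast
    then show ?thesis using I alt(1) by (simp add: b' inj_on_Un)
  qed
  moreover have "\<forall>(w', f') \<in> decomposed b'. dec_ok (set (items b')) w' f'"
  proof clarify
    fix w' f' assume "(w', f') \<in> decomposed b'"
    then have "dec_ok ?B w' f' \<or> dec_ok (set a) w' f'"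
      using decomp_dec_ok[OF decomposition(6)] a I by (auto simp: b')
    then show "dec_ok (set (items b')) w' f'" by (rule disjE; elim dec_ok_mono) (auto simp: b')
  qed
  moreover have "labels (set (items b')) = fst ` fms (set (items b'))"
    using lab alt(4) by (simp add: b' image_Un)
  moreover have "decomposed b' \<subseteq> fms (set (items b'))"
    using I decomposition(4) by (auto simp: b')
  ultimately have "binv N b'" unfolding binv_def by blast
  moreover have "mu N b' < mu N b"
  proof -
    have "card (eqs ?B) \<le> card (eqs (set (items b')))"
      by (rule card_mono) (auto simp: b')
    then show ?thesis
      using S[of "\<lambda>p. fsize (snd p)"] S2[of "\<lambda>p. fsize (snd p)"] alt(3,5)
      by (simp add: mu_def b')
  qed
  ultimately show ?thesis ..
next
  case (equality w v)
  let ?B = "set (items b)"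
  have b': "b' = b\<lparr>items := items b @ [Eq w v]\<rparr>" using equality mem by simp
  have und: "und b' = und b" by (auto simp: b' und_def)
  note I = inv[unfolded binv_def]
  have lab: "labels (insert (Eq w v) ?B) = labels ?B"
    using eq_rule_labels[OF equality(4)] by auto
  have "\<forall>(w, f) \<in> decomposed b. dec_ok (set (items b')) w f"
    using I by (fastforce simp: b' elim: dec_ok_mono)
  moreover have "card (fst ` fms ?B) + (\<Sum>p\<in>und b. fsize (snd p) - Suc 0) \<le> N"
    using I unfolding One_nat_def by metis
  ultimately have inv': "binv N b'"
    using I und lab unfolding binv_def by (simp add: b')
  \<comment> \<open>The conclusion relates labels already present, so all equalities are pairs of at
    most \<open>N\<close> labels.\<close>
  have "card (eqs (set (items b'))) \<le> card (labels ?B \<times> labels ?B)"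
    using eqs_subset[of "set (items b')"] lab by (intro card_mono) (auto simp: b')
  also have "\<dots> \<le> N * N" using I by (auto simp: card_cartesian_product intro!: mult_le_mono)
  finally have "card (eqs (set (items b'))) \<le> N * N" .
  moreover have "card (eqs (set (items b'))) = Suc (card (eqs ?B))"
    using equality(5) by (simp add: b')
  ultimately have "mu N b' < mu N b" using und by (simp add: mu_def b')
  with inv' show ?thesis ..
qed

lemma extends_step: "extends b b' \<Longrightarrow> binv N b \<Longrightarrow> binv N b' \<and> mu N b' < mu N b"
  unfolding extends_def using expand_step by blast

lemma extends_steps: "(extends ^^ n) b b' \<Longrightarrow> binv N b \<Longrightarrow> binv N b' \<and> mu N b' + n \<le> mu N b"
proof (induction n arbitrary: b')
  case (Suc n)
  then obtain c where "(extends ^^ n) b c" "extends c b'" by auto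
  then show ?case using Suc extends_step[of c b' N] by fastforce
qed simp

text \<open>For a formula of size x, \<open>mu\<close> starts at no more than
  \<open>x * x + x + 1\<close>, and every rule application lowers it.\<close>

lemma extends_bound: "(extends ^^ n) (start w f) b \<Longrightarrow> n \<le> poly [:1, 1, 1:] (fsize f)"
  using extends_steps[of n _ _ "fsize f", OF _ binv_start] mu_start[of f w]
  by (fastforce simp: algebra_simps)

text \<open>Keeps an expanded node from being mistaken for a leaf by \<open>branches\<close>, which
  tests for an empty list of subtrees.\<close>

lemma expand_nonempty: "expand b bs \<Longrightarrow> bs \<noteq> []"
  by (cases rule: expand.cases) (auto dest: decomp_alts_nonempty)

text \<open>Any applicable rule may be chosen at a node; \<open>mu\<close> guarantees termination
  for every strategy.\<close>

lemma tableau_exists: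
  "binv N b \<Longrightarrow> \<exists>t. tableau t \<and> root t = b \<and> (\<forall>b'\<in>branches t. fully_expanded b')"
proof (induction "mu N b" arbitrary: b rule: less_induct)
  case less
  show ?case
  proof (cases "\<exists>bs. expand b bs")
    case False
    then show ?thesis
      by (intro exI[of _ "Tab b []"]) (auto intro: tableau.intros simp: fully_expanded_def)
  next
    case True
    then obtain bs where bs: "expand b bs" ..
    have "\<forall>c\<in>set bs. \<exists>t. tableau t \<and> root t = c \<and> (\<forall>b'\<in>branches t. fully_expanded b')"
      using expand_step[OF bs less.prems] less.hyps by blast
    then obtain T where T: "\<forall>c\<in>set bs. tableau (T c) \<and> root (T c) = c \<and>
        (\<forall>b'\<in>branches (T c). fully_expanded b')" by metis
    have "map root (map T bs) = bs" using T by (auto intro: map_idI)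
    then show ?thesis using T bs expand_nonempty[OF bs]
      by (intro exI[of _ "Tab b (map T bs)"]) (auto intro!: tableau.intros)
  qed
qed

lemma tableau_branch_inv:
  "tableau t \<Longrightarrow> binv N (root t) \<Longrightarrow> b \<in> branches t \<Longrightarrow> binv N b"
proof (induction rule: tableau.induct)
  case (node c ts)
  show ?case
  proof (cases "ts = []")
    case False
    then obtain t where t: "t \<in> set ts" "b \<in> branches t" using node.prems by auto
    have "binv N (root t)" using expand_step[OF node(1)] node.prems t by auto
    then show ?thesis using node.IH t by blast
  qed (use node in auto)
qed auto

subsection \<open>Soundness\<close>

text \<open>The last clause ties the sign of a label to the truth of its value; it makes
  \<open>bot2\<close> sound and decides which alternative survives a decomposition.\<close>

definition sat_branch :: "'u sci_struct \<Rightarrow> (form \<Rightarrow> 'u) \<Rightarrow> (label \<Rightarrow> 'u) \<Rightarrow> item set \<Rightarrow> bool" where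
  "sat_branch M V I B \<longleftrightarrow>
     (\<forall>w f. Fm w f \<in> B \<longrightarrow> I w = V f) \<and> (\<forall>w v. Eq w v \<in> B \<longrightarrow> I w = I v) \<and>
     (\<forall>w v. Neq w v \<in> B \<longrightarrow> I w \<noteq> I v) \<and> Bot \<notin> B \<and>
     (\<forall>w \<in> labels B. I w \<in> D M \<longleftrightarrow> pol w)"

lemma sat_branch_closure: "sat_branch M V I B \<Longrightarrow> \<not> closure_rule B"
proof
  assume s: "sat_branch M V I B" and "closure_rule B"
  from this(2) show False
  proof cases
    case (bot2 w v)
    then have "Plus w \<in> labels B" "Minus v \<in> labels B" by (auto intro: item_labelsI)
    then show False using s bot2 unfolding sat_branch_def by (metis pol.simps)
  qed (use s in \<open>unfold sat_branch_def, metis\<close>)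
qed

lemma sat_branch_eq:
  assumes "valuation M V" and "sat_branch M V I B" and "eq_rule B w v"
  shows "I w = I v"
proof -
  have fm: "I x = V f" if "Fm x f \<in> B" for x f using assms(2) that by (simp add: sat_branch_def)
  have eq: "I x = I y" if "Eq x y \<in> B" for x y
    using assms(2) that unfolding sat_branch_def by blast
  have sim: "V f = V g" if "sim B f g" for f g
    using that fm eq unfolding sim_def by metis
  show ?thesis using assms(3)
  proof cases
    case (eq_neg f g)
    then show ?thesis using fm sim assms(1) unfolding valuation_def by metis
  next
    case (eq_imp f g h k)
    then show ?thesis using fm sim assms(1) unfolding valuation_def by metis
  next
    case (eq_ident f g h k)
    then show ?thesis using fm sim assms(1) unfolding valuation_def by metis
  next
    case (F f)
    then show ?thesis using fm by metis
  next
    case sym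
    then show ?thesis using eq by metis
  next
    case (tran u)
    then show ?thesis using eq by metis
  qed
qed

text \<open>A label foreign to the branch may be reinterpreted at will; this is how the fresh labels
  of a conclusion receive their values.\<close>

lemma sat_branch_fresh:
  assumes "sat_branch M V I B" and "\<And>w. w \<in> labels B \<Longrightarrow> J w = I w"
  shows "sat_branch M V J B"
proof -
  have "w \<in> labels B" if "Fm w f \<in> B" for w f using that by (auto intro: item_labelsI)
  moreover have "w \<in> labels B" "v \<in> labels B" if "Eq w v \<in> B \<or> Neq w v \<in> B" for w v
    using that by (auto intro: item_labelsI)
  ultimately show ?thesis using assms unfolding sat_branch_def by metis
qed

lemma sat_branch_simps [simp]:
  "sat_branch M V I {}"
  "sat_branch M V I (insert (Fm w f) B) \<longleftrightarrow>
     I w = V f \<and> (I w \<in> D M \<longleftrightarrow> pol w) \<and> sat_branch M V I B"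
  "sat_branch M V I (insert (Eq w v) B) \<longleftrightarrow>
     I w = I v \<and> (I w \<in> D M \<longleftrightarrow> pol w) \<and> (I v \<in> D M \<longleftrightarrow> pol v) \<and> sat_branch M V I B"
  "sat_branch M V I (insert (Neq w v) B) \<longleftrightarrow>
     I w \<noteq> I v \<and> (I w \<in> D M \<longleftrightarrow> pol w) \<and> (I v \<in> D M \<longleftrightarrow> pol v) \<and> sat_branch M V I B"
  by (auto simp: sat_branch_def)

lemma sat_branch_Un:
  "sat_branch M V I (A \<union> B) \<longleftrightarrow> sat_branch M V I A \<and> sat_branch M V I B"
  unfolding sat_branch_def by auto

text \<open>The truth values of the immediate subformulas in \<open>M\<close> select the
  alternative, and each fresh label takes the value of its formula.\<close>

lemma sat_branch_decomp:
  assumes m: "sci_model M" and v: "valuation M V" and s: "sat_branch M V I B"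
    and d: "decomp B w f alts" and w: "Fm w f \<in> B"
  shows "\<exists>a\<in>set alts. \<exists>J. sat_branch M V J (B \<union> set a)"
proof -
  have V: "V f \<in> D M \<longleftrightarrow> pol w"
    using s w unfolding sat_branch_def by (metis item_labels.simps(1) item_labelsI singletonI)
  have neg: "V (Neg g) \<in> D M \<longleftrightarrow> V g \<notin> D M"
    and imp: "V (Imp g h) \<in> D M \<longleftrightarrow> V g \<notin> D M \<or> V h \<in> D M"
    and ident: "V (Ident g h) \<in> D M \<longleftrightarrow> V g = V h" for g h
    using m v by (simp_all add: sci_model_def valuation_def)
  have upd: "sat_branch M V (I(x := a)) B" if "x \<notin> labels B" for x a
    using s that by (intro sat_branch_fresh[OF s]) auto
  have upd2: "sat_branch M V (I(x := a, y := b)) B" if "x \<notin> labels B" "y \<notin> labels B" for x a y b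
    using s that by (intro sat_branch_fresh[OF s]) auto
  have *: "\<exists>a\<in>set alts. \<exists>J. sat_branch M V J B \<and> sat_branch M V J (set a)"
    using d V
  proof cases
    case (neg_plus v w g)
    then show ?thesis using V neg upd[of "Minus v" "V g"] by (auto simp: fresh_def)
  next
    case (neg_minus v w g)
    then show ?thesis using V neg upd[of "Plus v" "V g"] by (auto simp: fresh_def)
  next
    case (imp_plus v v' u u' w g h)
    \<comment> \<open>Of the two fresh labels offered for a subformula, the one whose sign matches
      its truth value.\<close>
    define x where "x = (if V g \<in> D M then Plus v else Minus v')"
    define y where "y = (if V h \<in> D M then Plus u else Minus u')"
    have xy: "x \<notin> labels B" "y \<notin> labels B" "x \<noteq> y" "V g \<in> D M \<longleftrightarrow> pol x" "V h \<in> D M \<longleftrightarrow> pol y"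
      using imp_plus by (auto simp: fresh_def x_def y_def)
    have "[Fm x g, Fm y h] \<in> set alts" using imp_plus V imp by (auto simp: x_def y_def)
    moreover have "sat_branch M V (I(x := V g, y := V h)) (set [Fm x g, Fm y h])" using xy by simp
    ultimately show ?thesis using upd2[OF xy(1,2)] by metis
  next
    case (imp_minus v u' w g h)
    then show ?thesis using V imp upd2[of "Plus v" "Minus u'" "V g" "V h"] by (auto simp: fresh_def)
  next
    case (ident_plus v v' u u' w g h)
    define x where "x = (if V g \<in> D M then Plus v else Minus v')"
    define y where "y = (if V h \<in> D M then Plus u else Minus u')"
    have xy: "x \<notin> labels B" "y \<notin> labels B" "x \<noteq> y" "V g \<in> D M \<longleftrightarrow> pol x" "V h \<in> D M \<longleftrightarrow> pol y"
      using ident_plus by (auto simp: fresh_def x_def y_def)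
    have "V g = V h" using ident_plus V ident by simp
    then have "[Fm x g, Fm y h, Eq x y] \<in> set alts"
      using ident_plus by (cases "V g \<in> D M") (simp_all add: x_def y_def)
    moreover have "sat_branch M V (I(x := V g, y := V h)) (set [Fm x g, Fm y h, Eq x y])"
      using xy \<open>V g = V h\<close> by simp
    ultimately show ?thesis using upd2[OF xy(1,2)] by metis
  next
    case (ident_minus v v' u u' w g h)
    define x where "x = (if V g \<in> D M then Plus v else Minus v')"
    define y where "y = (if V h \<in> D M then Plus u else Minus u')"
    \<comment> \<open>If the signs differ then so do the values; only equal signs call for an
      explicit inequality.\<close>
    define a where "a = (if V g \<in> D M \<longleftrightarrow> V h \<in> D M then [Fm x g, Fm y h, Neq x y]
      else [Fm x g, Fm y h])"
    have xy: "x \<notin> labels B" "y \<notin> labels B" "x \<noteq> y" "V g \<in> D M \<longleftrightarrow> pol x" "V h \<in> D M \<longleftrightarrow> pol y"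
      using ident_minus by (auto simp: fresh_def x_def y_def)
    have "V g \<noteq> V h" using ident_minus V ident by simp
    then have "sat_branch M V (I(x := V g, y := V h)) (set a)"
      using xy by (simp add: a_def)
    moreover have "a \<in> set alts"
      using ident_minus
      by (cases "V g \<in> D M"; cases "V h \<in> D M") (simp_all add: x_def y_def a_def)
    ultimately show ?thesis using upd2[OF xy(1,2)] by metis
  qed
  then show ?thesis by (auto simp: sat_branch_Un)
qed

lemma sat_branch_expand:
  assumes "sci_model M" and "valuation M V" and "sat_branch M V I (set (items b))" and "expand b bs"
  shows "\<exists>b'\<in>set bs. \<exists>J. sat_branch M V J (set (items b'))"
  using assms(4)
proof cases
  case closure
  then show ?thesis using sat_branch_closure[OF assms(3)] by simp
next
  case (decomposition w f alts)
  then show ?thesis using sat_branch_decomp[OF assms(1-3)] by auto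
next
  case (equality w v)
  have "sat_branch M V I {Eq w v}"
    using sat_branch_eq[OF assms(2,3) equality(4)] eq_rule_labels[OF equality(4)] assms(3)
    unfolding sat_branch_def by simp metis
  then have "sat_branch M V I (set (items b) \<union> {Eq w v})" using assms(3) using sat_branch_Un by blast
  then show ?thesis using equality(1) by auto
qed

lemma sat_branch_tableau:
  assumes "sci_model M" and "valuation M V"
  shows "tableau t \<Longrightarrow> sat_branch M V I (set (items (root t))) \<Longrightarrow> open_tableau t"
proof (induction arbitrary: I rule: tableau.induct)
  case (leaf b)
  then show ?case by (simp add: open_tableau_def sat_branch_def closed_branch_def)
next
  case (node b ts)
  have "sat_branch M V I (set (items b))" using node.prems by simp
  from sat_branch_expand[OF assms this node(1)]
  obtain t J where t: "t \<in> set ts" "sat_branch M V J (set (items (root t)))" by auto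
  then have "open_tableau t" using node.IH by blast
  then show ?case using t(1) by (auto simp: open_tableau_def)
qed

lemma sound:
  assumes "satisfiable T f" and "full_tableau_for f t"
  shows "open_tableau t"
proof -
  obtain M and V :: "form \<Rightarrow> 'a" where m: "sci_model M" "valuation M V" "V f \<in> D M"
    using assms(1) by (auto simp: satisfiable_def)
  obtain w where w: "root t = start w f" "tableau t" using assms(2) by (auto simp: full_tableau_for_def)
  \<comment> \<open>The root label is the only one so far, so a constant interpretation is
    enough.\<close>
  have "sat_branch M V (\<lambda>_. V f) (set (items (root t)))"
    using m by (auto simp: w start_def sat_branch_def)
  then show ?thesis by (rule sat_branch_tableau[OF m(1,2) w(2)])
qed

subsection \<open>Completeness\<close>

fun code :: "label \<Rightarrow> nat" where
  "code (Plus n) = 2 * n + 2"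
| "code (Minus n) = 2 * n + 3"

lemma even_code [simp]: "even (code w) \<longleftrightarrow> pol w"
  by (cases w) auto

lemma code_inject [simp]: "code w = code v \<longleftrightarrow> w = v"
  by (cases w; cases v; simp; presburger)

locale hintikka =
  fixes B :: "item set"
  assumes saturated: "eq_rule B w v \<Longrightarrow> Eq w v \<in> B"
    and not_closed: "\<not> closure_rule B"
    and decomposed: "Fm w f \<in> B \<Longrightarrow> dec_ok B w f"
begin

lemma Eq_refl: "Fm w f \<in> B \<Longrightarrow> Eq w w \<in> B"
  by (rule saturated, rule F)

lemma Eq_sym: "Eq w v \<in> B \<Longrightarrow> Eq v w \<in> B"
  by (rule saturated, rule sym)

lemma Eq_trans: "Eq w v \<in> B \<Longrightarrow> Eq v u \<in> B \<Longrightarrow> Eq w u \<in> B"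
  by (rule saturated, rule tran)

lemma Eq_same: "Fm w f \<in> B \<Longrightarrow> Fm v f \<in> B \<Longrightarrow> Eq w v \<in> B"
  by (rule saturated, rule F)

text \<open>\<open>bot2\<close> forbids an equality between labels of opposite sign in one order;
  rule \<open>sym\<close> reduces the other order to it.\<close>

lemma Eq_pol:
  assumes "Eq w v \<in> B" shows "pol w \<longleftrightarrow> pol v"
proof -
  have "Eq (Plus n) (Minus m) \<notin> B" for n m using not_closed bot2 by blast
  moreover from this have "Eq (Minus n) (Plus m) \<notin> B" for n m using Eq_sym by blast
  ultimately show ?thesis using assms by (cases w; cases v) auto
qed

text \<open>The universe of the model is the set of natural numbers, and the even ones are designated.
  Every class of labels is represented by the code of one of its elements; \<open>0\<close> and \<open>1\<close> serve
  as default values.\<close>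

definition cls :: "label \<Rightarrow> nat" where
  "cls w = code (SOME v. Eq w v \<in> B)"

lemma cls_eqI: "Eq w v \<in> B \<Longrightarrow> cls w = cls v"
proof -
  assume "Eq w v \<in> B"
  then have "(\<lambda>x. Eq w x \<in> B) = (\<lambda>x. Eq v x \<in> B)"
    using Eq_sym Eq_trans by blast
  then show ?thesis by (simp add: cls_def)
qed

text \<open>Rule \<open>F\<close> with the same premise twice yields reflexivity, so the choice made
  in \<open>cls\<close> succeeds for every label that carries a formula.\<close>

lemma Eq_some: "Fm w f \<in> B \<Longrightarrow> Eq w (SOME v. Eq w v \<in> B) \<in> B"
  by (rule someI[of "\<lambda>v. Eq w v \<in> B" w], rule Eq_refl)

lemma cls_eqD: "Fm w f \<in> B \<Longrightarrow> Fm v g \<in> B \<Longrightarrow> cls w = cls v \<Longrightarrow> Eq w v \<in> B"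
  using Eq_some[of w f] Eq_some[of v g] Eq_sym Eq_trans unfolding cls_def code_inject by metis

lemma even_cls: "Fm w f \<in> B \<Longrightarrow> even (cls w) \<longleftrightarrow> pol w"
  using Eq_pol[OF Eq_some[of w f]] by (simp add: cls_def)

text \<open>The operations of the model start as relations read off the branch. The congruence rules
  make them single-valued on classes; the decompositions give their results the required
  parity.\<close>

definition op1 :: "nat \<Rightarrow> nat \<Rightarrow> bool" where
  "op1 a c \<longleftrightarrow> (\<exists>w f u. Fm w f \<in> B \<and> Fm u (Neg f) \<in> B \<and> a = cls w \<and> c = cls u)"

definition op2 :: "(form \<Rightarrow> form \<Rightarrow> form) \<Rightarrow> nat \<Rightarrow> nat \<Rightarrow> nat \<Rightarrow> bool" where
  "op2 C a b c \<longleftrightarrow> (\<exists>w f v g u. Fm w f \<in> B \<and> Fm v g \<in> B \<and> Fm u (C f g) \<in> B \<and>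
     a = cls w \<and> b = cls v \<and> c = cls u)"

lemma sim_cls: "Fm w f \<in> B \<Longrightarrow> Fm v g \<in> B \<Longrightarrow> cls w = cls v \<Longrightarrow> sim B f g"
  using cls_eqD unfolding sim_def by blast

lemma op1_unique: "op1 a c \<Longrightarrow> op1 a d \<Longrightarrow> c = d"
  unfolding op1_def using sim_cls eq_neg saturated cls_eqI by metis

lemma op2_Imp_unique: "op2 Imp a b c \<Longrightarrow> op2 Imp a b d \<Longrightarrow> c = d"
  unfolding op2_def
proof clarify
  fix w f v g u w' f' v' g' u'
  assume *: "Fm w f \<in> B" "Fm v g \<in> B" "Fm u (Imp f g) \<in> B" "Fm w' f' \<in> B" "Fm v' g' \<in> B"
    "Fm u' (Imp f' g') \<in> B" "cls w = cls w'" "cls v = cls v'"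
  show "cls u = cls u'"
    by (rule cls_eqI, rule saturated,
        rule eq_imp[OF sim_cls[OF *(1) *(4) *(7)] sim_cls[OF *(2) *(5) *(8)] *(3) *(6)])
qed

lemma op2_Ident_unique: "op2 Ident a b c \<Longrightarrow> op2 Ident a b d \<Longrightarrow> c = d"
  unfolding op2_def
proof clarify
  fix w f v g u w' f' v' g' u'
  assume *: "Fm w f \<in> B" "Fm v g \<in> B" "Fm u (Ident f g) \<in> B" "Fm w' f' \<in> B" "Fm v' g' \<in> B"
    "Fm u' (Ident f' g') \<in> B" "cls w = cls w'" "cls v = cls v'"
  show "cls u = cls u'"
    by (rule cls_eqI, rule saturated,
        rule eq_ident[OF sim_cls[OF *(1) *(4) *(7)] sim_cls[OF *(2) *(5) *(8)] *(3) *(6)])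
qed

lemma cls_same: "Fm w f \<in> B \<Longrightarrow> Fm v f \<in> B \<Longrightarrow> cls w = cls v"
  by (rule cls_eqI, rule Eq_same)

text \<open>Decomposition has introduced a label of its own for the subformula; rule
  \<open>F\<close> places it in the class of any other label of that formula. The two binary cases
  follow the same pattern.\<close>

lemma op1_even: "op1 a c \<Longrightarrow> even c \<longleftrightarrow> odd a"
  unfolding op1_def
proof clarify
  fix w f u assume *: "Fm w f \<in> B" "Fm u (Neg f) \<in> B"
  obtain v where "Fm v f \<in> B" "pol v \<longleftrightarrow> \<not> pol u" using decomposed[OF *(2)] by auto
  then show "even (cls u) \<longleftrightarrow> odd (cls w)"
    using even_cls * cls_same[of w f v] by metis
qed

lemma op2_Imp_even: "op2 Imp a b c \<Longrightarrow> even c \<longleftrightarrow> odd a \<or> even b"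
  unfolding op2_def
proof clarify
  fix w f v g u assume *: "Fm w f \<in> B" "Fm v g \<in> B" "Fm u (Imp f g) \<in> B"
  obtain w' v' where "Fm w' f \<in> B" "Fm v' g \<in> B" "pol u \<longleftrightarrow> pol w' \<longrightarrow> pol v'"
    using decomposed[OF *(3)] by auto
  then show "even (cls u) \<longleftrightarrow> odd (cls w) \<or> even (cls v)"
    using even_cls * cls_same[of w f w'] cls_same[of v g v'] by metis
qed

lemma op2_Ident_even: "op2 Ident a b c \<Longrightarrow> even c \<longleftrightarrow> a = b"
  unfolding op2_def
proof clarify
  fix w f v g u assume *: "Fm w f \<in> B" "Fm v g \<in> B" "Fm u (Ident f g) \<in> B"
  obtain w' v' where wv: "Fm w' f \<in> B" "Fm v' g \<in> B"
    "if pol u then Eq w' v' \<in> B else Neq w' v' \<in> B \<or> pol w' \<noteq> pol v'"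
    using decomposed[OF *(3)] by auto
  have cls: "cls w = cls w'" "cls v = cls v'" using cls_same * wv by blast+
  have "cls w' = cls v' \<longleftrightarrow> pol u"
  proof
    assume "cls w' = cls v'"
    then have "Eq w' v' \<in> B" using cls_eqD wv by blast
    \<comment> \<open>An inequality would close the branch by \<open>bot1\<close>, and different
      signs contradict \<open>Eq_pol\<close>.\<close>
    then show "pol u" using wv(3) not_closed bot1 Eq_pol by metis
  next
    assume "pol u"
    then show "cls w' = cls v'" using wv(3) cls_eqI by simp
  qed
  then show "even (cls u) \<longleftrightarrow> cls w = cls v"
    using even_cls[OF *(3)] cls by simp
qed

text \<open>Outside the relations any value of the right parity will do, because the conditions on a
  model only concern which results are designated.\<close>

definition model :: "nat sci_struct" where
  "model = \<lparr>U = UNIV, D = {a. even a},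
     mneg = (\<lambda>a. if \<exists>c. op1 a c then SOME c. op1 a c else if even a then 1 else 0),
     mimp = (\<lambda>a b. if \<exists>c. op2 Imp a b c then SOME c. op2 Imp a b c
       else if odd a \<or> even b then 0 else 1),
     mident = (\<lambda>a b. if \<exists>c. op2 Ident a b c then SOME c. op2 Ident a b c
       else if a = b then 0 else 1)\<rparr>"

lemma model_neg: "op1 a c \<Longrightarrow> mneg model a = c"
  unfolding model_def by (auto intro: op1_unique someI)

lemma model_imp: "op2 Imp a b c \<Longrightarrow> mimp model a b = c"
  unfolding model_def by (auto intro: op2_Imp_unique someI)

lemma model_ident: "op2 Ident a b c \<Longrightarrow> mident model a b = c"
  unfolding model_def by (auto intro: op2_Ident_unique someI)

lemma sci_model_model: "sci_model model"
proof -
  have "even (mneg model a) \<longleftrightarrow> odd a" for a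
  proof (cases "\<exists>c. op1 a c")
    case True
    then obtain c where "op1 a c" ..
    then show ?thesis using model_neg op1_even by simp
  next
    case False
    then have "mneg model a = (if even a then 1 else 0)" unfolding model_def by (simp del: not_ex)
    then show ?thesis by simp
  qed
  moreover have "even (mimp model a b) \<longleftrightarrow> odd a \<or> even b" for a b
  proof (cases "\<exists>c. op2 Imp a b c")
    case True
    then obtain c where "op2 Imp a b c" ..
    then show ?thesis using model_imp op2_Imp_even by simp
  next
    case False
    then have "mimp model a b = (if odd a \<or> even b then 0 else 1)" unfolding model_def by (simp del: not_ex)
    then show ?thesis by simp
  qed
  moreover have "even (mident model a b) \<longleftrightarrow> a = b" for a b
  proof (cases "\<exists>c. op2 Ident a b c")
    case True
    then obtain c where "op2 Ident a b c" ..
    then show ?thesis using model_ident op2_Ident_even by simp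
  next
    case False
    then have "mident model a b = (if a = b then 0 else 1)" unfolding model_def by (simp del: not_ex)
    then show ?thesis by simp
  qed
  moreover have "U model = UNIV" "D model = {a. even a}" by (simp_all add: model_def)
  ultimately show ?thesis by (simp add: sci_model_def)
qed

primrec val :: "form \<Rightarrow> nat" where
  "val (Atom p) = (if \<exists>w. Fm w (Atom p) \<in> B then cls (SOME w. Fm w (Atom p) \<in> B) else 0)"
| "val (Neg f) = mneg model (val f)"
| "val (Imp f g) = mimp model (val f) (val g)"
| "val (Ident f g) = mident model (val f) (val g)"

lemma valuation_val: "valuation model val"
  by (simp add: valuation_def model_def)

text \<open>The truth lemma: every compound labelled formula has been decomposed, so its subformulas
  carry labels as well, and their classes lie in the relations that define the operations.\<close>

lemma val_cls: "Fm w f \<in> B \<Longrightarrow> val f = cls w"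
proof (induction f arbitrary: w)
  case (Atom p)
  then have "Fm (SOME w. Fm w (Atom p) \<in> B) (Atom p) \<in> B" by (rule someI)
  from cls_same[OF this Atom] show ?case using Atom by auto
next
  case (Neg f)
  obtain v where v: "Fm v f \<in> B" using decomposed[OF Neg.prems] by auto
  then have "op1 (cls v) (cls w)" using Neg.prems unfolding op1_def by blast
  then show ?case using Neg.IH[OF v] model_neg by simp
next
  case (Imp f g)
  obtain v u where v: "Fm v f \<in> B" "Fm u g \<in> B" using decomposed[OF Imp.prems] by auto
  then have "op2 Imp (cls v) (cls u) (cls w)" using Imp.prems unfolding op2_def by blast
  then show ?case using Imp.IH(1)[OF v(1)] Imp.IH(2)[OF v(2)] model_imp by simp
next
  case (Ident f g)
  obtain v u where v: "Fm v f \<in> B" "Fm u g \<in> B" using decomposed[OF Ident.prems] by auto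
  then have "op2 Ident (cls v) (cls u) (cls w)" using Ident.prems unfolding op2_def by blast
  then show ?case using Ident.IH(1)[OF v(1)] Ident.IH(2)[OF v(2)] model_ident by simp
qed

lemma satisfiable_nat: "Fm (Plus n) f \<in> B \<Longrightarrow> satisfiable TYPE(nat) f"
  unfolding satisfiable_def using sci_model_model valuation_val val_cls[of "Plus n" f]
    even_cls[of "Plus n" f] by (intro exI[of _ model] exI[of _ val]) (auto simp: model_def)

end

section \<open>Transfer between universes and completeness\<close>

text \<open>The model is copied onto the range of \<open>h\<close>, a carrier inside the target
  type; \<open>inv h\<close> pulls arguments back.\<close>

lemma satisfiable_transfer:
  fixes h :: "'a \<Rightarrow> 'u"
  assumes "satisfiable TYPE('a) f" and h: "inj h"
  shows "satisfiable TYPE('u) f"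
proof -
  obtain M :: "'a sci_struct" and V where m: "sci_model M" "valuation M V" "V f \<in> D M"
    using assms(1) by (auto simp: satisfiable_def)
  define g where "g = inv h"
  have g [simp]: "g (h a) = a" for a using h by (simp add: g_def)
  have [simp]: "h a = h b \<longleftrightarrow> a = b" for a b using h by (simp add: inj_eq)
  have [simp]: "h a \<in> h ` S \<longleftrightarrow> a \<in> S" for a S using h by (simp add: inj_image_mem_iff)
  define M' where "M' = \<lparr>U = h ` U M, D = h ` D M, mneg = (\<lambda>a. h (mneg M (g a))),
    mimp = (\<lambda>a b. h (mimp M (g a) (g b))), mident = (\<lambda>a b. h (mident M (g a) (g b)))\<rparr>"
  have "sci_model M'" using m(1) unfolding sci_model_def M'_def by (simp add: image_mono)
  moreover have "valuation M' (h \<circ> V)" using m(2) unfolding valuation_def M'_def by simp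
  moreover have "(h \<circ> V) f \<in> D M'" using m(3) by (simp add: M'_def)
  ultimately show ?thesis unfolding satisfiable_def by blast
qed

lemma open_branch_hintikka:
  assumes inv: "binv N b" and full: "fully_expanded b" and "\<not> closed_branch b"
  shows "hintikka (set (items b))"
proof
  have no: "\<not> expand b bs" for bs using full assms(3) by (simp add: fully_expanded_def)
  show nc: "\<not> closure_rule (set (items b))" using no assms(3) closure by blast
  show "Eq w v \<in> set (items b)" if "eq_rule (set (items b)) w v" for w v
    using no assms(3) nc that equality by blast
  show "dec_ok (set (items b)) w f" if w: "Fm w f \<in> set (items b)" for w f
  proof (cases "(w, f) \<in> decomposed b")
    case True
    then show ?thesis using inv unfolding binv_def by blast
  next
    case False
    \<comment> \<open>Fresh labels always exist, so an undecomposed compound formula would leave a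
      rule applicable.\<close>
    have "\<exists>p. f = Atom p"
    proof (rule ccontr)
      assume "\<nexists>p. f = Atom p"
      then obtain alts where "decomp (set (items b)) w f alts"
        using decomp_exists[of "set (items b)" f w] by auto
      then show False using no assms(3) nc w False decomposition by blast
    qed
    then show ?thesis by auto
  qed
qed

lemma expand_items_mono: "expand b bs \<Longrightarrow> b' \<in> set bs \<Longrightarrow> set (items b) \<subseteq> set (items b')"
  by (cases rule: expand.cases) auto

lemma tableau_items_mono:
  "tableau t \<Longrightarrow> b \<in> branches t \<Longrightarrow> set (items (root t)) \<subseteq> set (items b)"
proof (induction rule: tableau.induct)
  case (node c ts)
  show ?case
  proof (cases "ts = []")
    case False
    then obtain t where t: "t \<in> set ts" "b \<in> branches t" using node.prems by auto
    then have "set (items c) \<subseteq> set (items (root t))" using expand_items_mono[OF node(1)] by simp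
    then show ?thesis using node.IH t by auto
  qed (use node in auto)
qed auto

lemma complete:
  assumes inf: "infinite (UNIV :: 'u set)" and t: "full_tableau_for f t" and "open_tableau t"
  shows "satisfiable TYPE('u) f"
proof -
  obtain w where w: "tableau t" "root t = start w f" "\<forall>b\<in>branches t. fully_expanded b"
    using t by (auto simp: full_tableau_for_def)
  obtain b where b: "b \<in> branches t" "\<not> closed_branch b"
    using assms(3) by (auto simp: open_tableau_def)
  have "binv (fsize f) b" using tableau_branch_inv[OF w(1) _ b(1)] w(2) binv_start by simp
  then interpret hintikka "set (items b)" using open_branch_hintikka w(3) b by blast
  have "Fm (Plus w) f \<in> set (items b)"
    using tableau_items_mono[OF w(1) b(1)] w(2) by (auto simp: start_def)
  then have "satisfiable TYPE(nat) f" by (rule satisfiable_nat)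
  moreover obtain h :: "nat \<Rightarrow> 'u" where "inj h" using infinite_countable_subset[OF inf] by blast
  ultimately show ?thesis by (rule satisfiable_transfer)
qed

lemma full_tableau_exists: "\<exists>t. full_tableau_for f t"
  using tableau_exists[OF binv_start[of f 0]] unfolding full_tableau_for_def by metis

theorem tableau_decides:
  assumes "infinite (UNIV :: 'u set)"
  shows "full_tableau_for f t \<Longrightarrow> satisfiable TYPE('u) f \<longleftrightarrow> open_tableau t"
    and "satisfiable TYPE('u) f \<longleftrightarrow> tableau_satisfiable f"
  using sound complete[OF assms] full_tableau_exists unfolding tableau_satisfiable_def by metis+

subsection \<open>A structured language for the tree machine\<close>

type_synonym state = "nat \<Rightarrow> tree"

datatype com =
    SKIP
  | CLR nat
  | MOV nat nat
  | NOD nat nat nat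
  | LFT nat nat
  | RGT nat nat
  | Sq com com (infixr ";;" 60)
  | If nat com com
  | While nat com
  | Choose com com

fun clen :: "com \<Rightarrow> nat" where
  "clen SKIP = 0"
| "clen (c1 ;; c2) = clen c1 + clen c2"
| "clen (If r c1 c2) = clen c1 + clen c2 + 2"
| "clen (While r c) = clen c + 2"
| "clen (Choose c1 c2) = clen c1 + clen c2 + 2"
| "clen _ = 1"

text \<open>\<open>If r c1 c2\<close> executes \<open>c1\<close> if register \<open>r\<close> holds \<open>Tip\<close>; \<open>While r c\<close> iterates until it does.\<close>

fun comp :: "com \<Rightarrow> nat \<Rightarrow> prog" where
  "comp SKIP i = []"
| "comp (CLR d) i = [CLEAR d]"
| "comp (MOV d x) i = [MOVE d x]"
| "comp (NOD d x y) i = [NODE d x y]"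
| "comp (LFT d x) i = [LEFT d x]"
| "comp (RGT d x) i = [RIGHT d x]"
| "comp (c1 ;; c2) i = comp c1 i @ comp c2 (i + clen c1)"
| "comp (If r c1 c2) i =
     JTIP r (i + clen c2 + 2) # comp c2 (Suc i) @
     JUMP (i + clen c1 + clen c2 + 2) # comp c1 (i + clen c2 + 2)"
| "comp (While r c) i = JTIP r (i + clen c + 2) # comp c (Suc i) @ [JUMP i]"
| "comp (Choose c1 c2) i =
     CHOOSE (i + clen c1 + 2) # comp c1 (Suc i) @
     JUMP (i + clen c1 + clen c2 + 2) # comp c2 (i + clen c1 + 2)"

lemma length_comp [simp]: "length (comp c i) = clen c"
  by (induction c arbitrary: i) auto

text \<open>\<open>exe c s ss n\<close>: the computations of \<open>c\<close> from \<open>s\<close> end in the states \<open>ss\<close> after at most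
  \<open>n\<close> steps. The outcomes form a list, so that distinct computations stay distinct even if
  they reach the same state.\<close>

inductive exe :: "com \<Rightarrow> state \<Rightarrow> state list \<Rightarrow> nat \<Rightarrow> bool" where
  skip: "exe SKIP s [s] n"
| clr: "exe (CLR d) s [s(d := Tip)] 1"
| mov: "exe (MOV d x) s [s(d := s x)] 1"
| nod: "exe (NOD d x y) s [s(d := Node (s x) (s y))] 1"
| lft: "exe (LFT d x) s [s(d := left (s x))] 1"
| rgt: "exe (RGT d x) s [s(d := right (s x))] 1"
| sq: "exe c1 s ss n \<Longrightarrow> list_all2 (\<lambda>t us. exe c2 t us m) ss uss \<Longrightarrow>
    exe (c1 ;; c2) s (concat uss) (n + m)"
| if_tip: "s r = Tip \<Longrightarrow> exe c1 s ss n \<Longrightarrow> exe (If r c1 c2) s ss (n + 2)"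
| if_node: "s r \<noteq> Tip \<Longrightarrow> exe c2 s ss n \<Longrightarrow> exe (If r c1 c2) s ss (n + 2)"
| while_end: "s r = Tip \<Longrightarrow> exe (While r c) s [s] 1"
| while_step: "s r \<noteq> Tip \<Longrightarrow> exe c s ss n \<Longrightarrow>
    list_all2 (\<lambda>t us. exe (While r c) t us m) ss uss \<Longrightarrow>
    exe (While r c) s (concat uss) (n + m + 2)"
| choose: "exe c1 s ss n \<Longrightarrow> exe c2 s us n \<Longrightarrow> exe (Choose c1 c2) s (ss @ us) (n + 2)"
| weaken: "exe c s ss n \<Longrightarrow> n \<le> m \<Longrightarrow> exe c s ss m"

text \<open>The counterpart of \<open>exe\<close> for machine code, where \<open>e\<close> is the
  exit address of a fragment. The exit of one fragment is the entry of the next, so fragments chain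
  by \<open>mex_trans\<close>.\<close>

inductive mex :: "prog \<Rightarrow> nat \<Rightarrow> config \<Rightarrow> state list \<Rightarrow> nat \<Rightarrow> bool" for P e where
  finished: "mex P e (e, s) [s] n"
| det: "pc < length P \<Longrightarrow> exec (P ! pc) (pc, s) = {c'} \<Longrightarrow> mex P e c' ss n \<Longrightarrow>
    mex P e (pc, s) ss (Suc n)"
| cho: "pc < length P \<Longrightarrow> P ! pc = CHOOSE l \<Longrightarrow> mex P e (Suc pc, s) ss n \<Longrightarrow>
    mex P e (l, s) us n \<Longrightarrow> mex P e (pc, s) (ss @ us) (Suc n)"

lemma mex_weaken: "mex P e c ss n \<Longrightarrow> n \<le> m \<Longrightarrow> mex P e c ss m"
proof (induction arbitrary: m rule: mex.induct)
  case (det pc s c' ss n)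
  then obtain m' where "m = Suc m'" by (cases m) auto
  then show ?case using det by (auto intro: mex.det)
next
  case (cho pc l s ss n us)
  then obtain m' where "m = Suc m'" by (cases m) auto
  then show ?case using cho by (auto intro: mex.cho)
qed (rule mex.finished)

lemma mex_trans:
  "mex P e c ss n \<Longrightarrow> list_all2 (\<lambda>s us. mex P e' (e, s) us m) ss uss \<Longrightarrow>
   mex P e' c (concat uss) (n + m)"
proof (induction arbitrary: uss rule: mex.induct)
  case (finished s n)
  then show ?case by (auto simp: list_all2_Cons1 intro: mex_weaken)
next
  case (det pc s c' ss n)
  then show ?case by (auto intro: mex.det)
next
  case (cho pc l s ss n us)
  then obtain xs ys where "uss = xs @ ys"
    "list_all2 (\<lambda>s us. mex P e' (e, s) us m) ss xs"
    "list_all2 (\<lambda>s us. mex P e' (e, s) us m) us ys"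
    by (auto simp: list_all2_append1)
  then show ?case using cho by (auto intro: mex.cho)
qed

text \<open>For fragments followed by a jump: a loop body returns to its test, and the branch laid
  out first skips the other one.\<close>

lemma mex_jump:
  assumes "mex P e c ss n" and "e < length P" and "P ! e = JUMP e'"
  shows "mex P e' c ss (Suc n)"
proof -
  have "list_all2 (\<lambda>s us. mex P e' (e, s) us 1) ss (map (\<lambda>s. [s]) ss)"
    using assms(2,3)
    by (auto simp: list.rel_map list.rel_refl intro!: list.rel_refl_strong mex.det[OF _ _ finished, of e P _ e' _ 0, simplified])
  from mex_trans[OF assms(1) this] show ?thesis by simp
qed

fun placed :: "prog \<Rightarrow> nat \<Rightarrow> prog \<Rightarrow> bool" where
  "placed P i [] \<longleftrightarrow> True"
| "placed P i (x # xs) \<longleftrightarrow> i < length P \<and> P ! i = x \<and> placed P (Suc i) xs"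

lemma placed_append [simp]:
  "placed P i (xs @ ys) \<longleftrightarrow> placed P i xs \<and> placed P (i + length xs) ys"
  by (induction xs arbitrary: i) auto

lemma placed_self: "placed (xs @ ys) (length xs) ys"
proof (induction ys arbitrary: xs)
  case (Cons y ys)
  show ?case using Cons[of "xs @ [y]"] by simp
qed simp

text \<open>Compiler correctness, by induction on the execution and not on the command, because a
  loop body runs repeatedly.\<close>

lemma exe_mex: "exe c s ss n \<Longrightarrow> placed P i (comp c i) \<Longrightarrow> mex P (i + clen c) (i, s) ss n"
proof (induction arbitrary: i rule: exe.induct)
  case (skip s n)
  then show ?case using mex.finished[of P i s n] by simp
next
  case (sq c1 s ss n c2 m uss)
  have "list_all2 (\<lambda>t us. mex P (i + clen (c1 ;; c2)) (i + clen c1, t) us m) ss uss"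
    using sq.IH(2) by (rule list_all2_mono) (use sq.prems in \<open>auto simp: add.assoc\<close>)
  with sq.IH(1) sq.prems show ?case by (auto intro: mex_trans)
next
  case (if_tip s r c1 ss n c2)
  have "mex P (i + clen (If r c1 c2)) (i + clen c2 + 2, s) ss n"
    using if_tip.IH[of "i + clen c2 + 2"] if_tip.prems by (simp add: algebra_simps)
  then have "mex P (i + clen (If r c1 c2)) (i, s) ss (Suc n)"
    by (rule mex.det[rotated 2]) (use if_tip in auto)
  then show ?case by (rule mex_weaken) simp
next
  case (if_node s r c2 ss n c1)
  have "mex P (Suc i + clen c2) (Suc i, s) ss n"
    using if_node.IH[of "Suc i"] if_node.prems by simp
  then have "mex P (i + clen (If r c1 c2)) (Suc i, s) ss (Suc n)"
    by (rule mex_jump) (use if_node.prems in \<open>auto simp: algebra_simps\<close>)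
  then have "mex P (i + clen (If r c1 c2)) (i, s) ss (Suc (Suc n))"
    by (rule mex.det[rotated 2]) (use if_node in auto)
  then show ?case by simp
next
  case (while_end s r c)
  have "mex P (i + clen (While r c)) (i, s) [s] (Suc 0)"
    by (rule mex.det[OF _ _ mex.finished]) (use while_end in auto)
  then show ?case by simp
next
  case (while_step s r c ss n m uss)
  have "mex P (Suc i + clen c) (Suc i, s) ss n"
    using while_step.IH(1)[of "Suc i"] while_step.prems by simp
  then have 1: "mex P i (Suc i, s) ss (Suc n)"
    by (rule mex_jump) (use while_step.prems in auto)
  have "list_all2 (\<lambda>t us. mex P (i + clen (While r c)) (i, t) us m) ss uss"
    using while_step.IH(2) by (rule list_all2_mono) (use while_step.prems in auto)
  from mex_trans[OF 1 this]
  have "mex P (i + clen (While r c)) (i, s) (concat uss) (Suc (Suc n + m))"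
    by (rule mex.det[rotated 2]) (use while_step in auto)
  then show ?case by simp
next
  case (choose c1 s ss n c2 us)
  have "mex P (Suc i + clen c1) (Suc i, s) ss n"
    using choose.IH(1)[of "Suc i"] choose.prems by simp
  then have 1: "mex P (i + clen (Choose c1 c2)) (Suc i, s) ss (Suc n)"
    by (rule mex_jump) (use choose.prems in \<open>auto simp: algebra_simps\<close>)
  have "mex P (i + clen (Choose c1 c2)) (i + clen c1 + 2, s) us n"
    using choose.IH(2)[of "i + clen c1 + 2"] choose.prems by (simp add: algebra_simps)
  then have 2: "mex P (i + clen (Choose c1 c2)) (i + clen c1 + 2, s) us (Suc n)"
    by (rule mex_weaken) simp
  have "mex P (i + clen (Choose c1 c2)) (i, s) (ss @ us) (Suc (Suc n))"
    by (rule mex.cho[OF _ _ 1 2]) (use choose.prems in auto)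
  then show ?case by simp
next
  case (weaken c s ss n m)
  then show ?case by (blast intro: mex_weaken)
qed (auto intro!: mex.det[OF _ _ mex.finished, of _ _ _ _ _ 0, simplified])

lemma step_runs_Suc:
  "(step P ^^ Suc n) c d \<longleftrightarrow> (\<exists>c'. step P c c' \<and> (step P ^^ n) c' d)"
  by (subst relpowp.simps, subst relpowp_commute[symmetric], simp only: relcompp_apply)

text \<open>With \<open>e\<close> beyond the program no step is possible at the exit, so every
  computation is a prefix of one that ends in a recorded state. The bound in \<open>mex\<close> thus
  limits all runs, and its list exhausts the results.\<close>

lemma mex_results:
  assumes "mex P e c ss n" and "e \<ge> length P"
  shows "(\<forall>k d. (step P ^^ k) c d \<longrightarrow> k \<le> n) \<and>
    (\<forall>s. (\<exists>k pc. (step P ^^ k) c (pc, s) \<and> pc \<ge> length P) \<longleftrightarrow> s \<in> set ss)"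
  using assms
proof (induction rule: mex.induct)
  case (finished s n)
  have no: "\<not> step P (e, s) d" for d using finished by (simp add: step_def)
  have "(step P ^^ k) (e, s) d \<longleftrightarrow> k = 0 \<and> d = (e, s)" for k d
    by (cases k) (auto simp: step_runs_Suc no simp del: relpowp.simps(2))
  then show ?case using finished by auto
next
  case (det pc s c' ss n)
  have st: "step P (pc, s) d \<longleftrightarrow> d = c'" for d using det by (simp add: step_def)
  have "(step P ^^ k) (pc, s) d \<longleftrightarrow>
      k = 0 \<and> d = (pc, s) \<or> (\<exists>j. k = Suc j \<and> (step P ^^ j) c' d)" for k d
    by (cases k) (auto simp: step_runs_Suc st simp del: relpowp.simps(2))
  then show ?case using det by (auto; blast)
next
  case (cho pc l s ss n us)
  have st: "step P (pc, s) d \<longleftrightarrow> d = (l, s) \<or> d = (Suc pc, s)" for d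
    using cho by (simp add: step_def)
  have "(step P ^^ k) (pc, s) d \<longleftrightarrow> k = 0 \<and> d = (pc, s) \<or>
      (\<exists>j. k = Suc j \<and> ((step P ^^ j) (l, s) d \<or> (step P ^^ j) (Suc pc, s) d))" for k d
    by (cases k) (auto simp: step_runs_Suc st simp del: relpowp.simps(2))
  then show ?case using cho by (auto; blast)
qed

lemma exe_results:
  assumes "exe c (snd (init x)) ss n"
  shows "results (comp c 0) x = set ss" and "halts_within (comp c 0) x n"
proof -
  have "mex (comp c 0) (0 + clen c) (0, snd (init x)) ss n"
    by (rule exe_mex[OF assms]) (use placed_self[of "[]"] in simp)
  then have "mex (comp c 0) (clen c) (init x) ss n" by (simp add: init_def)
  from mex_results[OF this] show "results (comp c 0) x = set ss" "halts_within (comp c 0) x n"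
    by (auto simp: results_def halts_within_def)
qed

fun no_choice :: "com \<Rightarrow> bool" where
  "no_choice (c1 ;; c2) \<longleftrightarrow> no_choice c1 \<and> no_choice c2"
| "no_choice (If r c1 c2) \<longleftrightarrow> no_choice c1 \<and> no_choice c2"
| "no_choice (While r c) \<longleftrightarrow> no_choice c"
| "no_choice (Choose c1 c2) \<longleftrightarrow> False"
| "no_choice _ \<longleftrightarrow> True"

lemma deterministic_comp: "no_choice c \<Longrightarrow> deterministic (comp c i)"
  unfolding deterministic_def by (induction c arbitrary: i) auto

lemma exe_sq1: "exe c1 s [t] n \<Longrightarrow> exe c2 t us m \<Longrightarrow> exe (c1 ;; c2) s us (n + m)"
  using sq[of c1 s "[t]" n c2 m "[us]"] by simp

lemma exe_while1:
  "s r \<noteq> Tip \<Longrightarrow> exe c s [t] n \<Longrightarrow> exe (While r c) t us m \<Longrightarrow> exe (While r c) s us (n + m + 2)"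
  using while_step[of s r c "[t]" n m "[us]"] by simp

section \<open>Loop-free code and a rule for deterministic loops\<close>

fun straight :: "com \<Rightarrow> bool" where
  "straight (c1 ;; c2) \<longleftrightarrow> straight c1 \<and> straight c2"
| "straight (If r c1 c2) \<longleftrightarrow> straight c1 \<and> straight c2"
| "straight (While r c) \<longleftrightarrow> False"
| "straight (Choose c1 c2) \<longleftrightarrow> False"
| "straight _ \<longleftrightarrow> True"

text \<open>The default equation is meant for \<open>SKIP\<close>; loops and choices are excluded by
  \<open>straight\<close>.\<close>

fun run :: "com \<Rightarrow> state \<Rightarrow> state" where
  "run (CLR d) s = s(d := Tip)"
| "run (MOV d x) s = s(d := s x)"
| "run (NOD d x y) s = s(d := Node (s x) (s y))"
| "run (LFT d x) s = s(d := left (s x))"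
| "run (RGT d x) s = s(d := right (s x))"
| "run (c1 ;; c2) s = run c2 (run c1 s)"
| "run (If r c1 c2) s = (if s r = Tip then run c1 s else run c2 s)"
| "run _ s = s"

lemma exe_straight: "straight c \<Longrightarrow> exe c s [run c s] (clen c)"
proof (induction c arbitrary: s)
  case (Sq c1 c2)
  then show ?case by (auto intro: exe_sq1)
next
  case (If r c1 c2)
  then have "exe c1 s [run c1 s] (clen c1 + clen c2)" "exe c2 s [run c2 s] (clen c1 + clen c2)"
    using weaken[of c1 s _ "clen c1"] weaken[of c2 s _ "clen c2"] by simp_all
  then show ?case using if_tip[of s r c1 _ "clen c1 + clen c2" c2]
      if_node[of s r c2 _ "clen c1 + clen c2" c1] by simp
qed (auto intro: exe.intros exe.intros[simplified])

text \<open>The ghost value \<open>g\<close> stands for the data that the registers encode. An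
  iteration costs the body plus the test and the jump back; the final test adds 1.\<close>

lemma exe_while_det:
  assumes body: "\<And>g s. I g s \<Longrightarrow> s r \<noteq> Tip \<Longrightarrow> \<exists>s' g'. exe c s [s'] K \<and> I g' s' \<and> (m g' :: nat) < m g"
  shows "I g s \<Longrightarrow> \<exists>s' g'. exe (While r c) s [s'] (m g * (K + 2) + 1) \<and> I g' s' \<and> s' r = Tip"
proof (induction "m g" arbitrary: g s rule: less_induct)
  case less
  show ?case
  proof (cases "s r = Tip")
    case True
    have "exe (While r c) s [s] (m g * (K + 2) + 1)" by (rule weaken[OF while_end[of s r, OF True]]) simp
    then show ?thesis using less.prems True by blast
  next
    case False
    obtain t h where t: "exe c s [t] K" "I h t" "m h < m g" using body[OF less.prems False] by blast
    obtain s' g' where s': "exe (While r c) t [s'] (m h * (K + 2) + 1)" "I g' s'" "s' r = Tip"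
      using less.hyps[OF t(3,2)] by blast
    have "K + (m h * (K + 2) + 1) + 2 = Suc (m h) * (K + 2) + 1" by simp
    also have "\<dots> \<le> m g * (K + 2) + 1" using t(3) by (intro add_mono mult_le_mono) auto
    finally have "exe (While r c) s [s'] (m g * (K + 2) + 1)"
      using weaken[OF exe_while1[of s r, OF False t(1) s'(1)]] by simp
    then show ?thesis using s' by blast
  qed
qed

subsection \<open>Expressions and bounded queries\<close>

datatype exp = XT | XV nat | XL exp | XR exp | XN exp exp

fun ev :: "exp \<Rightarrow> state \<Rightarrow> tree" where
  "ev XT s = Tip"
| "ev (XV r) s = s r"
| "ev (XL e) s = left (ev e s)"
| "ev (XR e) s = right (ev e s)"
| "ev (XN a b) s = Node (ev a s) (ev b s)"

fun evars :: "exp \<Rightarrow> nat set" where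
  "evars XT = {}"
| "evars (XV r) = {r}"
| "evars (XL e) = evars e"
| "evars (XR e) = evars e"
| "evars (XN a b) = evars a \<union> evars b"

fun esz :: "exp \<Rightarrow> nat" where
  "esz XT = 1"
| "esz (XV r) = 1"
| "esz (XL e) = Suc (esz e)"
| "esz (XR e) = Suc (esz e)"
| "esz (XN a b) = Suc (esz a + esz b)"

text \<open>Stack discipline: the result goes to \<open>d\<close>, temporaries lie above it, and the
  registers below \<open>d\<close> survive.\<close>

fun ec :: "exp \<Rightarrow> nat \<Rightarrow> com" where
  "ec XT d = CLR d"
| "ec (XV r) d = MOV d r"
| "ec (XL e) d = ec e d ;; LFT d d"
| "ec (XR e) d = ec e d ;; RGT d d"
| "ec (XN a b) d = ec a d ;; ec b (Suc d) ;; NOD d d (Suc d)"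

lemma ec_straight [simp]: "straight (ec e d)"
  by (induction e arbitrary: d) auto

lemma ec_no_choice [simp]: "no_choice (ec e d)"
  by (induction e arbitrary: d) auto

lemma clen_ec [simp]: "clen (ec e d) = esz e"
  by (induction e arbitrary: d) auto

lemma ev_cong: "(\<And>r. r \<in> evars e \<Longrightarrow> s r = t r) \<Longrightarrow> ev e s = ev e t"
  by (induction e) auto

lemma run_ec: "evars e \<subseteq> {..<d} \<Longrightarrow> run (ec e d) s d = ev e s \<and> (\<forall>r<d. run (ec e d) s r = s r)"
proof (induction e arbitrary: d s)
  case (XN a b)
  have "evars b \<subseteq> {..<Suc d}" using XN.prems by auto
  note 1 = XN.IH(1)[of d s] and 2 = XN.IH(2)[OF this, of "run (ec a d) s"]
  have "ev b (run (ec a d) s) = ev b s" using 1 XN.prems by (intro ev_cong) auto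
  then show ?case using 1 2 XN.prems by simp
qed simp_all

lemma exe_ec:
  assumes "evars e \<subseteq> {..<d}"
  shows "\<exists>s'. exe (ec e d) s [s'] (esz e) \<and> s' d = ev e s \<and> (\<forall>r<d. s' r = s r)"
proof (rule exI, rule conjI)
  show "exe (ec e d) s [run (ec e d) s] (esz e)" using exe_straight[of "ec e d" s] by simp
qed (rule run_ec[OF assms])

lemma tsize_pos [simp]: "0 < tsize t"
  by (cases t) auto

lemma tsize_left [simp]: "tsize (left t) \<le> tsize t"
  by (cases t) auto

lemma tsize_right [simp]: "tsize (right t) \<le> tsize t"
  by (cases t) auto

lemma esz_pos [simp]: "0 < esz e"
  by (cases e) auto

lemma tsize_ev: "(\<And>r. r \<in> evars e \<Longrightarrow> tsize (s r) \<le> m) \<Longrightarrow> 1 \<le> m \<Longrightarrow> tsize (ev e s) \<le> esz e * m"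
proof (induction e)
  case (XL e)
  then show ?case using order_trans[OF tsize_left[of "ev e s"]] by (simp add: trans_le_add2)
next
  case (XR e)
  then show ?case using order_trans[OF tsize_right[of "ev e s"]] by (simp add: trans_le_add2)
next
  case (XN a b)
  then have "tsize (ev a s) \<le> esz a * m" "tsize (ev b s) \<le> esz b * m" by auto
  then show ?case using XN.prems(2) by (simp add: algebra_simps)
qed auto

fun cx :: "tree \<Rightarrow> exp" where
  "cx Tip = XT"
| "cx (Node a b) = XN (cx a) (cx b)"

lemma ev_cx [simp]: "ev (cx t) s = t"
  by (induction t) auto

lemma evars_cx [simp]: "evars (cx t) = {}"
  by (induction t) auto

lemma esz_cx [simp]: "esz (cx t) = tsize t"
  by (induction t) auto

fun els :: "tree \<Rightarrow> tree list" where
  "els Tip = []"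
| "els (Node a b) = a # els b"

lemma length_els: "length (els t) \<le> tsize t"
  by (induction t) auto

lemma tsize_els: "x \<in> set (els t) \<Longrightarrow> tsize x \<le> tsize t"
  by (induction t) auto

text \<open>Decides whether registers \<open>k + 1\<close> and \<open>k + 2\<close> hold the same tree, with a worklist of pairs.\<close>

definition eq_step :: "nat \<Rightarrow> com" where
  "eq_step k =
    LFT (k+2) (k+1) ;; RGT (k+1) (k+1) ;; LFT (k+3) (k+2) ;; RGT (k+2) (k+2) ;;
    If (k+3)
      (If (k+2) SKIP (CLR k ;; CLR (k+1)))
      (If (k+2) (CLR k ;; CLR (k+1))
        (RGT (k+4) (k+3) ;; RGT (k+5) (k+2) ;; NOD (k+4) (k+4) (k+5) ;; NOD (k+1) (k+4) (k+1) ;;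
         LFT (k+4) (k+3) ;; LFT (k+5) (k+2) ;; NOD (k+4) (k+4) (k+5) ;; NOD (k+1) (k+4) (k+1)))"

definition eq_com :: "nat \<Rightarrow> com" where
  "eq_com k = NOD (k+1) (k+1) (k+2) ;; CLR (k+2) ;; NOD (k+1) (k+1) (k+2) ;;
     NOD k (k+2) (k+2) ;; While (k+1) (eq_step k)"

fun pairs_tree :: "(tree \<times> tree) list \<Rightarrow> tree" where
  "pairs_tree [] = Tip"
| "pairs_tree ((a, b) # ps) = Node (Node a b) (pairs_tree ps)"

text \<open>Each round strips a root from a left component or empties the worklist, so the total
  size of the left components bounds the rounds. A round takes the 22 instructions of the body and 2
  for loop control; 5 covers the set-up and the last test.\<close>

lemma exe_eq_com:
  "\<exists>s'. exe (eq_com k) s [s'] (24 * tsize (s (k+1)) + 5) \<and>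
     (s' k \<noteq> Tip \<longleftrightarrow> s (k+1) = s (k+2)) \<and> (\<forall>r<k. s' r = s r)"
proof -
  define I where "I ps t \<longleftrightarrow> t (k+1) = pairs_tree ps \<and>
    (t k \<noteq> Tip \<and> (\<forall>(a, b)\<in>set ps. a = b) \<longleftrightarrow> s (k+1) = s (k+2)) \<and> (\<forall>r<k. t r = s r)" for ps t
  define m where "m ps = sum_list (map (\<lambda>p. tsize (fst p)) ps)" for ps :: "(tree \<times> tree) list"
  have step: "\<exists>t' ps'. exe (eq_step k) t [t'] 22 \<and> I ps' t' \<and> m ps' < m ps"
    if I: "I ps t" and ne: "t (k+1) \<noteq> Tip" for ps t
  proof -
    obtain a b qs where ps: "ps = (a, b) # qs"
      using I ne by (cases ps) (auto simp: I_def)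
    have e: "exe (eq_step k) t [run (eq_step k) t] 22"
      by (rule weaken[OF exe_straight]) (auto simp: eq_step_def)
    let ?t = "run (eq_step k) t"
    have t: "t (Suc k) = Node (Node a b) (pairs_tree qs)" using I ps by (simp add: I_def)
    have "\<exists>ps'. I ps' ?t \<and> m ps' < m ps"
    proof (cases a)
      case Tip
      show ?thesis
      proof (cases b)
        case Tip
        then have "I qs ?t" using I t \<open>a = Tip\<close> ps by (simp add: I_def eq_step_def)
        then show ?thesis using ps by (auto simp: m_def)
      next
        case (Node b1 b2)
        then have "I [] ?t" using I t \<open>a = Tip\<close> ps by (simp add: I_def eq_step_def)
        then show ?thesis using ps by (intro exI[of _ "[]"]) (simp add: m_def)
      qed
    next
      case (Node a1 a2)
      show ?thesis
      proof (cases b)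
        case Tip
        then have "I [] ?t" using I t Node ps by (simp add: I_def eq_step_def)
        then show ?thesis using ps by (intro exI[of _ "[]"]) (simp add: m_def)
      next
        case (Node b1 b2)
        then have "I ((a1, b1) # (a2, b2) # qs) ?t"
          using I t \<open>a = Node a1 a2\<close> ps by (simp add: I_def eq_step_def) blast?
        then show ?thesis using ps \<open>a = Node a1 a2\<close>
          by (intro exI[of _ "(a1, b1) # (a2, b2) # qs"]) (simp add: m_def)
      qed
    qed
    with e show ?thesis by blast
  qed
  let ?p = "NOD (k+1) (k+1) (k+2) ;; CLR (k+2) ;; NOD (k+1) (k+1) (k+2) ;; NOD k (k+2) (k+2)"
  define t where "t = run ?p s"
  have "I [(s (k+1), s (k+2))] t" by (simp add: I_def t_def)
  from exe_while_det[of I "k+1" "eq_step k" 22 m, OF step this]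
  obtain s' ps where s': "exe (While (k+1) (eq_step k)) t [s'] (m [(s (k+1), s (k+2))] * (22 + 2) + 1)"
    "I ps s'" "s' (k+1) = Tip" by blast
  have "ps = []" using s'(2,3) by (cases ps) (auto simp: I_def)
  have "exe (eq_com k) s [s'] (1 + (1 + (1 + (1 + (m [(s (k+1), s (k+2))] * (22 + 2) + 1)))))"
    unfolding eq_com_def
    by (intro exe_sq1[OF nod] exe_sq1[OF clr]) (use s'(1) in \<open>simp add: t_def\<close>)
  then have "exe (eq_com k) s [s'] (24 * tsize (s (k+1)) + 5)" by (rule weaken) (simp add: m_def)
  then show ?thesis using s'(2) \<open>ps = []\<close> by (intro exI[of _ s']) (simp add: I_def)
qed

section \<open>Bounded first-order queries\<close>

datatype qry = QEq exp exp | QNot qry | QAnd qry qry | QEx nat exp qry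

fun sem :: "qry \<Rightarrow> state \<Rightarrow> bool" where
  "sem (QEq a b) s \<longleftrightarrow> ev a s = ev b s"
| "sem (QNot q) s \<longleftrightarrow> \<not> sem q s"
| "sem (QAnd p q) s \<longleftrightarrow> sem p s \<and> sem q s"
| "sem (QEx i e q) s \<longleftrightarrow> (\<exists>x\<in>set (els (ev e s)). sem q (s(i := x)))"

fun fv :: "qry \<Rightarrow> nat set" where
  "fv (QEq a b) = evars a \<union> evars b"
| "fv (QNot q) = fv q"
| "fv (QAnd p q) = fv p \<union> fv q"
| "fv (QEx i e q) = evars e \<union> (fv q - {i})"

fun bv :: "qry \<Rightarrow> nat set" where
  "bv (QEq a b) = {}"
| "bv (QNot q) = bv q"
| "bv (QAnd p q) = bv p \<union> bv q"
| "bv (QEx i e q) = insert i (bv q)"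

text \<open>Evaluation overwrites the bound registers. The first conjunct must therefore not destroy
  what the second one reads, and the body of a quantifier, being evaluated repeatedly, must not
  destroy its own free registers or the witness.\<close>

fun wfq :: "qry \<Rightarrow> bool" where
  "wfq (QEq a b) \<longleftrightarrow> True"
| "wfq (QNot q) \<longleftrightarrow> wfq q"
| "wfq (QAnd p q) \<longleftrightarrow> wfq p \<and> wfq q \<and> bv p \<inter> fv q = {}"
| "wfq (QEx i e q) \<longleftrightarrow> wfq q \<and> i \<notin> bv q \<and> fv q \<inter> bv q = {}"

text \<open>Register \<open>k\<close> receives the truth value, with \<open>Tip\<close> for false.
  For a quantifier, \<open>k + 1\<close> holds the list still to be searched; clearing it ends the
  loop and leaves the witness in \<open>i\<close>.\<close>

fun qc :: "qry \<Rightarrow> nat \<Rightarrow> com" where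
  "qc (QEq a b) k = ec a (k+1) ;; ec b (k+2) ;; eq_com k"
| "qc (QNot q) k = qc q k ;; If k (NOD k k k) (CLR k)"
| "qc (QAnd p q) k = qc p k ;; If k SKIP (qc q k)"
| "qc (QEx i e q) k = ec e (k+1) ;; CLR k ;;
     While (k+1) (LFT i (k+1) ;; RGT (k+1) (k+1) ;; qc q (k+2) ;;
       If (k+2) SKIP (MOV k (k+2) ;; CLR (k+1)))"

text \<open>The second argument bounds the sizes of the trees in the free registers.\<close>

fun qcost :: "qry \<Rightarrow> nat \<Rightarrow> nat" where
  "qcost (QEq a b) m = esz a + esz b + 24 * (esz a * m) + 5"
| "qcost (QNot q) m = qcost q m + 4"
| "qcost (QAnd p q) m = qcost p m + qcost q m + 2"
| "qcost (QEx i e q) m = esz e + 2 + esz e * m * (qcost q (esz e * m) + 8)"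

lemma qc_no_choice [simp]: "no_choice (qc q k)"
  by (induction q arbitrary: k) (auto simp: eq_com_def eq_step_def)

lemma sem_cong: "(\<And>r. r \<in> fv q \<Longrightarrow> s r = t r) \<Longrightarrow> sem q s \<longleftrightarrow> sem q t"
proof (induction q arbitrary: s t)
  case (QEq a b)
  then show ?case using ev_cong[of a s t] ev_cong[of b s t] by auto
next
  case (QAnd p q)
  have "sem p s \<longleftrightarrow> sem p t" by (rule QAnd.IH(1)) (use QAnd.prems in auto)
  moreover have "sem q s \<longleftrightarrow> sem q t" by (rule QAnd.IH(2)) (use QAnd.prems in auto)
  ultimately show ?case by simp
next
  case (QEx i e q)
  have "ev e s = ev e t" using QEx.prems by (intro ev_cong) auto
  moreover have "sem q (s(i := x)) \<longleftrightarrow> sem q (t(i := x))" for x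
    by (rule QEx.IH) (use QEx.prems in auto)
  ultimately show ?case by simp
next
  case (QNot q)
  have "sem q s \<longleftrightarrow> sem q t" by (rule QNot.IH) (use QNot.prems in simp)
  then show ?case by simp
qed

text \<open>Besides the query, an element costs 8: two instructions fetch it, at most four act on
  the outcome, two control the loop. Below \<open>k\<close> the body changes only its own bound
  registers, so later elements are tested as if in the original state.\<close>

lemma exe_ex_loop:
  assumes q: "\<And>s. (\<forall>r\<in>fv q. tsize (s r) \<le> m) \<Longrightarrow> \<exists>s'. exe (qc q (k+2)) s [s'] K \<and>
      (s' (k+2) \<noteq> Tip \<longleftrightarrow> sem q s) \<and> (\<forall>r<k+2. r \<notin> bv q \<longrightarrow> s' r = s r)"
    and i: "i < k" "i \<notin> bv q" and v: "fv q \<subseteq> {..<k}" "bv q \<subseteq> {..<k}" "fv q \<inter> bv q = {}"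
  shows "s k = Tip \<Longrightarrow> (\<forall>x\<in>set (els (s (k+1))). tsize x \<le> m) \<Longrightarrow>
    (\<forall>r\<in>fv q - {i}. tsize (s r) \<le> m) \<Longrightarrow>
    \<exists>s'. exe (While (k+1) (LFT i (k+1) ;; RGT (k+1) (k+1) ;; qc q (k+2) ;;
            If (k+2) SKIP (MOV k (k+2) ;; CLR (k+1)))) s [s'] (length (els (s (k+1))) * (K + 8) + 1) \<and>
      (s' k \<noteq> Tip \<longleftrightarrow> (\<exists>x\<in>set (els (s (k+1))). sem q (s(i := x)))) \<and>
      (\<forall>x. find (\<lambda>x. sem q (s(i := x))) (els (s (k+1))) = Some x \<longrightarrow> s' i = x) \<and>
      (\<forall>r<k. r \<notin> bv q \<longrightarrow> r \<noteq> i \<longrightarrow> s' r = s r)"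
proof (induction "els (s (k+1))" arbitrary: s)
  case Nil
  have e: "els (s (k+1)) = []" using Nil.hyps ..
  then have t: "s (k+1) = Tip" by (cases "s (k+1)") simp_all
  show ?case unfolding e
    using Nil.prems(1) exe.while_end[where s = s and r = "k+1", OF t]
    by (intro exI[of _ s] conjI) simp_all
next
  case (Cons x xs)
  let ?body = "LFT i (k+1) ;; RGT (k+1) (k+1) ;; qc q (k+2) ;;
            If (k+2) SKIP (MOV k (k+2) ;; CLR (k+1))"
  obtain u where u: "s (k+1) = Node x u" "els u = xs"
    using Cons.hyps(2) by (cases "s (k+1)") simp_all
  define t where "t = s(i := x, k+1 := u)"
  have t: "exe (LFT i (k+1) ;; RGT (k+1) (k+1)) s [t] (1 + 1)"
    using exe_straight[of "LFT i (k+1) ;; RGT (k+1) (k+1)" s] u i by (simp add: t_def)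
  have tr: "t r = (s(i := x)) r" if "r < k" for r using that by (simp add: t_def)
  have sem_t: "sem q t \<longleftrightarrow> sem q (s(i := x))" using v tr by (intro sem_cong) auto
  have x: "x \<in> set (els (s (k+1)))" using Cons.hyps(2)[symmetric] by simp
  have "\<forall>r\<in>fv q. tsize (t r) \<le> m"
  proof
    fix r assume r: "r \<in> fv q"
    then have "t r = (s(i := x)) r" using v(1) by (intro tr) auto
    then show "tsize (t r) \<le> m" using Cons.prems(2,3) r x by (cases "r = i") simp_all
  qed
  from q[OF this] obtain w where w: "exe (qc q (k+2)) t [w] K" "w (k+2) \<noteq> Tip \<longleftrightarrow> sem q t"
    "\<forall>r<k+2. r \<notin> bv q \<longrightarrow> w r = t r" by blast
  have pre: "exe ?body s us (1 + (1 + (K + n)))"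
    if "exe (If (k+2) SKIP (MOV k (k+2) ;; CLR (k+1))) w us n" for us n
    by (rule exe_sq1[OF lft exe_sq1[OF rgt exe_sq1[OF _ that]]])
      (use w(1) i u in \<open>simp add: t_def\<close>)
  have k1: "k \<notin> bv q" "Suc k \<notin> bv q" using v by auto
  show ?case
  proof (cases "sem q t")
    case False
    have "exe ?body s [w] (1 + (1 + (K + (0 + 2))))"
      by (rule pre, rule if_tip[OF _ skip]) (use w False in simp)
    have wk: "w k = Tip" "w (k+1) = u"
      using w(3) k1 i Cons.prems(1) by (auto simp: t_def)
    have wr: "w r = s r" if "r < k" "r \<notin> bv q" "r \<noteq> i" for r using w(3) that by (simp add: t_def)
    have semw: "sem q (w(i := y)) \<longleftrightarrow> sem q (s(i := y))" for y
      using v wr by (intro sem_cong) auto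
    have "\<forall>r\<in>fv q - {i}. tsize (w r) \<le> m"
    proof
      fix r assume r: "r \<in> fv q - {i}"
      then have "w r = s r" using v by (intro wr) auto
      then show "tsize (w r) \<le> m" using Cons.prems(3) r by simp
    qed
    moreover have "\<forall>y\<in>set (els (w (k+1))). tsize y \<le> m"
      using Cons.prems(2) Cons.hyps(2)[symmetric] wk u by auto
    moreover have xs: "els (w (k+1)) = xs" using wk u by simp
    ultimately obtain s' where s': "exe (While (k+1) ?body) w [s'] (length xs * (K + 8) + 1)"
      "s' k \<noteq> Tip \<longleftrightarrow> (\<exists>x\<in>set xs. sem q (s(i := x)))"
      "\<forall>x. find (\<lambda>x. sem q (s(i := x))) xs = Some x \<longrightarrow> s' i = x"
      "\<forall>r<k. r \<notin> bv q \<longrightarrow> r \<noteq> i \<longrightarrow> s' r = w r"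
      using Cons.hyps(1)[OF xs[symmetric] wk(1)] unfolding xs semw by blast
    have "exe (While (k+1) ?body) s [s']
        (1 + (1 + (K + (0 + 2))) + (length xs * (K + 8) + 1) + 2)"
      by (rule exe_while1) (use \<open>exe ?body s [w] _\<close> s'(1) u in auto)
    then have "exe (While (k+1) ?body) s [s'] (length (els (s (k+1))) * (K + 8) + 1)"
      by (rule weaken) (use u in simp)
    moreover have "els (s (k+1)) = x # xs" using Cons.hyps(2) ..
    moreover have "\<forall>r<k. r \<notin> bv q \<longrightarrow> r \<noteq> i \<longrightarrow> s' r = s r" using s'(4) wr by simp
    moreover have "\<not> sem q (s(i := x))" using False sem_t by blast
    ultimately show ?thesis using s'(2,3) by (intro exI[of _ s']) simp
  next
    case True
    \<comment> \<open>Success clears the remaining list, so the loop stops while \<open>i\<close>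
      still holds the witness.\<close>
    define z where "z = w(k := w (k+2), k+1 := Tip)"
    have "exe ?body s [z] (1 + (1 + (K + (1 + 1 + 2))))"
      by (rule pre, rule if_node[OF _ exe_sq1[OF mov]])
        (use w True clr[of "k+1" "w(k := w (k+2))"] in \<open>auto simp: z_def\<close>)
    then have "exe (While (k+1) ?body) s [z] (1 + (1 + (K + (1 + 1 + 2))) + 1 + 2)"
      by (rule exe_while1[rotated]) (use u while_end[of z "k+1"] in \<open>auto simp: z_def\<close>)
    then have "exe (While (k+1) ?body) s [z] (length (els (s (k+1))) * (K + 8) + 1)"
      by (rule weaken) (use u in simp)
    moreover have "z i = x" "z k \<noteq> Tip" using w True i by (auto simp: z_def t_def)
    moreover have "\<forall>r<k. r \<notin> bv q \<longrightarrow> r \<noteq> i \<longrightarrow> z r = s r" using w(3) by (simp add: z_def t_def)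
    moreover have "els (s (k+1)) = x # xs" using Cons.hyps(2) ..
    moreover have "sem q (s(i := x))" using True sem_t by blast
    ultimately show ?thesis by (intro exI[of _ z]) simp
  qed
qed

text \<open>Correctness of the body is a hypothesis, since the lemma serves inside the induction of
  \<open>exe_qc\<close> and again in \<open>vexe_fnd\<close>, where the witness left in
  \<open>i\<close> matters.\<close>

lemma exe_QEx:
  assumes q: "\<And>s. (\<forall>r\<in>fv q. tsize (s r) \<le> esz e * m) \<Longrightarrow>
      \<exists>s'. exe (qc q (k+2)) s [s'] (qcost q (esz e * m)) \<and>
      (s' (k+2) \<noteq> Tip \<longleftrightarrow> sem q s) \<and> (\<forall>r<k+2. r \<notin> bv q \<longrightarrow> s' r = s r)"
    and wf: "wfq (QEx i e q)" and v: "i < k" "evars e \<subseteq> {..<k}" "fv q \<subseteq> {..<k}" "bv q \<subseteq> {..<k}"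
    and m: "1 \<le> m" "\<forall>r\<in>fv (QEx i e q). tsize (s r) \<le> m"
  shows "\<exists>s'. exe (qc (QEx i e q) k) s [s'] (qcost (QEx i e q) m) \<and>
      (s' k \<noteq> Tip \<longleftrightarrow> sem (QEx i e q) s) \<and>
      (\<forall>x. find (\<lambda>x. sem q (s(i := x))) (els (ev e s)) = Some x \<longrightarrow> s' i = x) \<and>
      (\<forall>r<k. r \<notin> bv q \<longrightarrow> r \<noteq> i \<longrightarrow> s' r = s r)"
proof -
  have "evars e \<subseteq> {..<k+1}" using v by auto
  from exe_ec[OF this, of s] obtain t where t: "exe (ec e (k+1)) s [t] (esz e)" "t (k+1) = ev e s"
    "\<forall>r<k+1. t r = s r" by blast
  define w where "w = t(k := Tip)"
  have w: "w k = Tip" "w (k+1) = ev e s" "\<And>r. r < k \<Longrightarrow> w r = s r" using t by (auto simp: w_def)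
  have sz: "tsize (ev e s) \<le> esz e * m" using m by (intro tsize_ev) auto
  have "\<forall>x\<in>set (els (w (k+1))). tsize x \<le> esz e * m" using w(2) order_trans[OF tsize_els sz] by simp
  moreover have "\<forall>r\<in>fv q - {i}. tsize (w r) \<le> esz e * m"
  proof
    fix r assume "r \<in> fv q - {i}"
    then have "tsize (w r) \<le> m" using m v w(3) by auto
    also have "m \<le> esz e * m" using esz_pos[of e] by (cases "esz e") auto
    finally show "tsize (w r) \<le> esz e * m" .
  qed
  moreover have "sem q (w(i := x)) \<longleftrightarrow> sem q (s(i := x))" for x
    using w v by (intro sem_cong) auto
  ultimately obtain s' where s': "exe (While (k+1) (LFT i (k+1) ;; RGT (k+1) (k+1) ;; qc q (k+2) ;;
            If (k+2) SKIP (MOV k (k+2) ;; CLR (k+1)))) w [s']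
            (length (els (ev e s)) * (qcost q (esz e * m) + 8) + 1)"
      "s' k \<noteq> Tip \<longleftrightarrow> (\<exists>x\<in>set (els (ev e s)). sem q (s(i := x)))"
      "\<forall>x. find (\<lambda>x. sem q (s(i := x))) (els (ev e s)) = Some x \<longrightarrow> s' i = x"
      "\<forall>r<k. r \<notin> bv q \<longrightarrow> r \<noteq> i \<longrightarrow> s' r = s r"
    using exe_ex_loop[of q "esz e * m" k "qcost q (esz e * m)" i w, OF q v(1) _ v(3,4)] wf w by auto
  have "exe (qc (QEx i e q) k) s [s']
     (esz e + (1 + (length (els (ev e s)) * (qcost q (esz e * m) + 8) + 1)))"
    unfolding qc.simps
    by (rule exe_sq1[OF t(1) exe_sq1[OF clr]]) (use s'(1) in \<open>simp add: w_def\<close>)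
  then have "exe (qc (QEx i e q) k) s [s'] (qcost (QEx i e q) m)"
    by (rule weaken) (use sz length_els[of "ev e s"] in simp)
  then show ?thesis using s'(2-4) by (intro exI[of _ s']) simp
qed

lemma exe_qc:
  "wfq q \<Longrightarrow> fv q \<subseteq> {..<k} \<Longrightarrow> bv q \<subseteq> {..<k} \<Longrightarrow> 1 \<le> m \<Longrightarrow> \<forall>r\<in>fv q. tsize (s r) \<le> m \<Longrightarrow>
   \<exists>s'. exe (qc q k) s [s'] (qcost q m) \<and> (s' k \<noteq> Tip \<longleftrightarrow> sem q s) \<and>
     (\<forall>r<k. r \<notin> bv q \<longrightarrow> s' r = s r)"
proof (induction q arbitrary: k m s)
  case (QEq a b)
  have "evars a \<subseteq> {..<k+1}" using QEq.prems by auto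
  from exe_ec[OF this, of s] obtain t where t: "exe (ec a (k+1)) s [t] (esz a)" "t (k+1) = ev a s"
    "\<forall>r<k+1. t r = s r" by blast
  have "evars b \<subseteq> {..<k+2}" using QEq.prems by auto
  from exe_ec[OF this, of t] obtain w where w: "exe (ec b (k+2)) t [w] (esz b)" "w (k+2) = ev b t"
    "\<forall>r<k+2. w r = t r" by blast
  have b: "ev b t = ev b s" using t QEq.prems by (intro ev_cong) auto
  obtain s' where s': "exe (eq_com k) w [s'] (24 * tsize (w (k+1)) + 5)"
    "s' k \<noteq> Tip \<longleftrightarrow> w (k+1) = w (k+2)" "\<forall>r<k. s' r = w r" using exe_eq_com by blast
  have "tsize (w (k+1)) \<le> esz a * m" using w t QEq.prems by (auto intro!: tsize_ev)
  then have "exe (qc (QEq a b) k) s [s'] (qcost (QEq a b) m)"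
    using weaken[OF exe_sq1[OF t(1) exe_sq1[OF w(1) s'(1)]]] by simp
  then show ?case using s' w t b by (intro exI[of _ s']) auto
next
  case (QNot q)
  then have "wfq q" "fv q \<subseteq> {..<k}" "bv q \<subseteq> {..<k}" "\<forall>r\<in>fv q. tsize (s r) \<le> m" by auto
  from QNot.IH[OF this(1-3) QNot.prems(4) this(4)]
  obtain t where t: "exe (qc q k) s [t] (qcost q m)" "t k \<noteq> Tip \<longleftrightarrow> sem q s"
    "\<forall>r<k. r \<notin> bv q \<longrightarrow> t r = s r" by blast
  let ?i = "If k (NOD k k k) (CLR k)"
  have "exe ?i t [run ?i t] 4" by (rule weaken[OF exe_straight]) auto
  from exe_sq1[OF t(1) this] show ?case using t by (intro exI[of _ "run ?i t"]) auto
next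
  case (QAnd p q)
  then have "wfq p" "fv p \<subseteq> {..<k}" "bv p \<subseteq> {..<k}" "\<forall>r\<in>fv p. tsize (s r) \<le> m" by auto
  from QAnd.IH(1)[OF this(1-3) QAnd.prems(4) this(4)]
  obtain t where t: "exe (qc p k) s [t] (qcost p m)" "t k \<noteq> Tip \<longleftrightarrow> sem p s"
    "\<forall>r<k. r \<notin> bv p \<longrightarrow> t r = s r" by blast
  have fv: "t r = s r" if "r \<in> fv q" for r using that QAnd.prems t(3) by auto
  show ?case
  proof (cases "sem p s")
    case False
    have "exe (If k SKIP (qc q k)) t [t] (qcost q m + 2)"
      by (rule if_tip[OF _ skip]) (use t False in simp)
    from exe_sq1[OF t(1) this] show ?thesis using t False by (intro exI[of _ t]) (auto simp: add.assoc)
  next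
    case True
    have "wfq q" "fv q \<subseteq> {..<k}" "bv q \<subseteq> {..<k}" "\<forall>r\<in>fv q. tsize (t r) \<le> m"
      using QAnd.prems fv by auto
    from QAnd.IH(2)[OF this(1-3) QAnd.prems(4) this(4)]
    obtain w where w: "exe (qc q k) t [w] (qcost q m)" "w k \<noteq> Tip \<longleftrightarrow> sem q t"
      "\<forall>r<k. r \<notin> bv q \<longrightarrow> w r = t r" by blast
    have "exe (If k SKIP (qc q k)) t [w] (qcost q m + 2)"
      by (rule if_node[OF _ w(1)]) (use t True in simp)
    from exe_sq1[OF t(1) this] show ?thesis using t w True sem_cong[of q t s] fv
      by (intro exI[of _ w]) (auto simp: add.assoc)
  qed
next
  case (QEx i e q)
  have m: "1 \<le> esz e * m" using QEx.prems(4) esz_pos[of e] by (simp add: Suc_le_eq)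
  have v: "i < k" "evars e \<subseteq> {..<k}" "fv q \<subseteq> {..<k}" "bv q \<subseteq> {..<k}" and wf: "wfq q"
    using QEx.prems by auto
  then have "fv q \<subseteq> {..<k+2}" "bv q \<subseteq> {..<k+2}" by auto
  from exe_QEx[OF QEx.IH[OF wf this m] QEx.prems(1) v QEx.prems(4,5)] show ?case by auto
qed

subsection \<open>Programs on visible registers\<close>

text \<open>Registers below \<open>K\<close> are program variables; the others are scratch space, and
  \<open>vexe\<close> abstracts from their contents.\<close>

abbreviation agree :: "nat \<Rightarrow> state \<Rightarrow> state \<Rightarrow> bool" where
  "agree K s t \<equiv> \<forall>r<K. s r = t r"

definition vexe :: "nat \<Rightarrow> com \<Rightarrow> state \<Rightarrow> state list \<Rightarrow> nat \<Rightarrow> bool" where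
  "vexe K c s ts n \<longleftrightarrow>
     (\<forall>s'. agree K s' s \<longrightarrow> (\<exists>ts'. exe c s' ts' n \<and> list_all2 (agree K) ts' ts))"

lemma vexeI1:
  assumes "\<And>s'. agree K s' s \<Longrightarrow> \<exists>t'. exe c s' [t'] n \<and> agree K t' t"
  shows "vexe K c s [t] n"
  unfolding vexe_def
proof (intro allI impI)
  fix s' assume "agree K s' s"
  from assms[OF this] obtain t' where "exe c s' [t'] n" "agree K t' t" by blast
  then show "\<exists>ts'. exe c s' ts' n \<and> list_all2 (agree K) ts' [t]" by (intro exI[of _ "[t']"]) simp
qed

lemma vexeD: "vexe K c s ts n \<Longrightarrow> agree K s' s \<Longrightarrow> \<exists>ts'. exe c s' ts' n \<and> list_all2 (agree K) ts' ts"
  unfolding vexe_def by blast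

lemma vexe_weaken: "vexe K c s ts n \<Longrightarrow> n \<le> m \<Longrightarrow> vexe K c s ts m"
  unfolding vexe_def by (meson weaken)

lemma vexe_skip: "vexe K SKIP s [s] 0"
  by (rule vexeI1) (blast intro: skip)

lemma list_all2_choice:
  "list_all2 (\<lambda>x z. \<exists>y. P x y \<and> Q y z) xs zs \<Longrightarrow> \<exists>ys. list_all2 P xs ys \<and> list_all2 Q ys zs"
proof (induction rule: list_all2_induct)
  case (Cons x xs z zs)
  then obtain y ys where "P x y" "Q y z" "list_all2 P xs ys" "list_all2 Q ys zs" by blast
  then show ?case by (intro exI[of _ "y # ys"]) simp
qed simp

lemma list_all2_concat: "list_all2 (list_all2 P) xss yss \<Longrightarrow> list_all2 P (concat xss) (concat yss)"
  by (induction rule: list_all2_induct) (auto intro: list_all2_appendI)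

lemma vexe_bind:
  assumes "list_all2 (agree K) ss' ss" and "list_all2 (\<lambda>t us. vexe K c t us m) ss uss"
  shows "\<exists>uss'. list_all2 (\<lambda>t us. exe c t us m) ss' uss' \<and>
    list_all2 (agree K) (concat uss') (concat uss)"
proof -
  have "list_all2 (\<lambda>t us. \<exists>us'. exe c t us' m \<and> list_all2 (agree K) us' us) ss' uss"
    by (rule list_all2_trans[OF _ assms]) (rule vexeD)
  from list_all2_choice[OF this] show ?thesis using list_all2_concat by blast
qed

lemma vexe_sq:
  assumes "vexe K c1 s ss n" and "list_all2 (\<lambda>t us. vexe K c2 t us m) ss uss"
  shows "vexe K (c1 ;; c2) s (concat uss) (n + m)"
  unfolding vexe_def
proof (intro allI impI)
  fix s' assume "agree K s' s"
  from vexeD[OF assms(1) this] obtain ss' where ss': "exe c1 s' ss' n" "list_all2 (agree K) ss' ss" by blast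
  from vexe_bind[OF ss'(2) assms(2)] ss'(1)
  show "\<exists>ts'. exe (c1 ;; c2) s' ts' (n + m) \<and> list_all2 (agree K) ts' (concat uss)"
    using sq by blast
qed

lemma vexe_sq1: "vexe K c1 s [t] n \<Longrightarrow> vexe K c2 t us m \<Longrightarrow> vexe K (c1 ;; c2) s us (n + m)"
  using vexe_sq[of K c1 s "[t]" n c2 m "[us]"] by simp

lemma vexe_if_tip: "r < K \<Longrightarrow> s r = Tip \<Longrightarrow> vexe K c1 s ts n \<Longrightarrow> vexe K (If r c1 c2) s ts (n + 2)"
  unfolding vexe_def
proof (intro allI impI)
  fix s' assume r: "r < K" "s r = Tip" and s': "agree K s' s"
    and c: "\<forall>s'. agree K s' s \<longrightarrow> (\<exists>ts'. exe c1 s' ts' n \<and> list_all2 (agree K) ts' ts)"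
  then obtain ts' where "exe c1 s' ts' n" "list_all2 (agree K) ts' ts" by blast
  moreover have "s' r = Tip" using r s' by simp
  ultimately show "\<exists>ts'. exe (If r c1 c2) s' ts' (n + 2) \<and> list_all2 (agree K) ts' ts"
    by (intro exI[of _ ts'] conjI if_tip)
qed

lemma vexe_if_node: "r < K \<Longrightarrow> s r \<noteq> Tip \<Longrightarrow> vexe K c2 s ts n \<Longrightarrow> vexe K (If r c1 c2) s ts (n + 2)"
  unfolding vexe_def
proof (intro allI impI)
  fix s' assume r: "r < K" "s r \<noteq> Tip" and s': "agree K s' s"
    and c: "\<forall>s'. agree K s' s \<longrightarrow> (\<exists>ts'. exe c2 s' ts' n \<and> list_all2 (agree K) ts' ts)"
  then obtain ts' where "exe c2 s' ts' n" "list_all2 (agree K) ts' ts" by blast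
  moreover have "s' r \<noteq> Tip" using r s' by simp
  ultimately show "\<exists>ts'. exe (If r c1 c2) s' ts' (n + 2) \<and> list_all2 (agree K) ts' ts"
    by (intro exI[of _ ts'] conjI if_node)
qed

lemma vexe_choose:
  assumes "vexe K c1 s ss n" and "vexe K c2 s us n"
  shows "vexe K (Choose c1 c2) s (ss @ us) (n + 2)"
  unfolding vexe_def
proof (intro allI impI)
  fix s' assume s': "agree K s' s"
  obtain ss' where "exe c1 s' ss' n" "list_all2 (agree K) ss' ss" using vexeD[OF assms(1) s'] by blast
  moreover obtain us' where "exe c2 s' us' n" "list_all2 (agree K) us' us"
    using vexeD[OF assms(2) s'] by blast
  ultimately show "\<exists>ts'. exe (Choose c1 c2) s' ts' (n + 2) \<and> list_all2 (agree K) ts' (ss @ us)"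
    by (intro exI[of _ "ss' @ us'"] conjI choose list_all2_appendI)
qed

lemma vexe_while_end: "r < K \<Longrightarrow> s r = Tip \<Longrightarrow> vexe K (While r c) s [s] 1"
  by (rule vexeI1, rule exI, rule conjI, rule while_end) simp_all

lemma vexe_while_step:
  assumes "r < K" and "s r \<noteq> Tip" and "vexe K c s ss n"
    and "list_all2 (\<lambda>t us. vexe K (While r c) t us m) ss uss"
  shows "vexe K (While r c) s (concat uss) (n + m + 2)"
  unfolding vexe_def
proof (intro allI impI)
  fix s' assume s': "agree K s' s"
  from vexeD[OF assms(3) this] obtain ss' where ss': "exe c s' ss' n" "list_all2 (agree K) ss' ss" by blast
  have "s' r \<noteq> Tip" using s' assms by simp
  with vexe_bind[OF ss'(2) assms(4)] ss'(1)
  show "\<exists>ts'. exe (While r c) s' ts' (n + m + 2) \<and> list_all2 (agree K) ts' (concat uss)"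
    using while_step by blast
qed

lemma vexe_while_det:
  assumes r: "r < K" and body: "\<And>g s. I g s \<Longrightarrow> s r \<noteq> Tip \<Longrightarrow>
    \<exists>s' g'. vexe K c s [s'] C \<and> I g' s' \<and> (m g' :: nat) < m g"
  shows "I g s \<Longrightarrow> \<exists>s' g'. vexe K (While r c) s [s'] (m g * (C + 2) + 1) \<and> I g' s' \<and> s' r = Tip"
proof (induction "m g" arbitrary: g s rule: less_induct)
  case less
  show ?case
  proof (cases "s r = Tip")
    case True
    have "vexe K (While r c) s [s] (m g * (C + 2) + 1)"
      by (rule vexe_weaken[OF vexe_while_end[where s = s, OF r True]]) simp
    then show ?thesis using less.prems True by blast
  next
    case False
    obtain t h where t: "vexe K c s [t] C" "I h t" "m h < m g" using body[OF less.prems False] by blast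
    obtain s' g' where s': "vexe K (While r c) t [s'] (m h * (C + 2) + 1)" "I g' s'" "s' r = Tip"
      using less.hyps[OF t(3,2)] by blast
    have "C + (m h * (C + 2) + 1) + 2 = Suc (m h) * (C + 2) + 1" by simp
    also have "\<dots> \<le> m g * (C + 2) + 1" using t(3) by (intro add_mono mult_le_mono) auto
    finally have "C + (m h * (C + 2) + 1) + 2 \<le> m g * (C + 2) + 1" .
    moreover have "vexe K (While r c) s (concat [[s']]) (C + (m h * (C + 2) + 1) + 2)"
      by (rule vexe_while_step[where s = s, OF r False t(1)]) (use s'(1) in simp)
    ultimately have "vexe K (While r c) s [s'] (m g * (C + 2) + 1)"
      using vexe_weaken by simp
    then show ?thesis using s' by blast
  qed
qed

section \<open>Assignments, tests and searches\<close>

text \<open>An expression is evaluated in scratch register \<open>k\<close> first, as it may mention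
  the register it is assigned to and evaluation destroys its target.\<close>

fun asgs :: "nat \<Rightarrow> (nat \<times> exp) list \<Rightarrow> com" where
  "asgs k [] = SKIP"
| "asgs k ((d, e) # ds) = (ec e k ;; MOV d k) ;; asgs k ds"

fun upds :: "(nat \<times> exp) list \<Rightarrow> state \<Rightarrow> state" where
  "upds [] s = s"
| "upds ((d, e) # ds) s = upds ds (s(d := ev e s))"

fun acost :: "(nat \<times> exp) list \<Rightarrow> nat" where
  "acost [] = 0"
| "acost ((d, e) # ds) = Suc (esz e) + acost ds"

lemma asgs_no_choice [simp]: "no_choice (asgs k ds)"
  by (induction k ds rule: asgs.induct) auto

lemma vexe_asgs:
  "K \<le> k \<Longrightarrow> list_all (\<lambda>(d, e). d < K \<and> evars e \<subseteq> {..<K}) ds \<Longrightarrow>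
    vexe K (asgs k ds) s [upds ds s] (acost ds)"
proof (induction ds arbitrary: s)
  case Nil
  then show ?case by (simp add: vexe_skip)
next
  case (Cons p ds)
  obtain d e where p: "p = (d, e)" by (cases p)
  have d: "d < K" "evars e \<subseteq> {..<K}" using Cons.prems p by auto
  have "vexe K (ec e k ;; MOV d k) s [s(d := ev e s)] (esz e + 1)"
  proof (rule vexeI1)
    fix s' assume s': "agree K s' s"
    have "evars e \<subseteq> {..<k}" using d Cons.prems by auto
    from exe_ec[OF this, of s'] obtain t where t: "exe (ec e k) s' [t] (esz e)" "t k = ev e s'"
      "\<forall>r<k. t r = s' r" by blast
    have "ev e s' = ev e s" by (rule ev_cong) (use s' d in auto)
    then have "agree K (t(d := t k)) (s(d := ev e s))" using t s' Cons.prems(1) by simp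
    then show "\<exists>t'. exe (ec e k ;; MOV d k) s' [t'] (esz e + 1) \<and> agree K t' (s(d := ev e s))"
      using exe_sq1[OF t(1) mov] by blast
  qed
  moreover have "vexe K (asgs k ds) (s(d := ev e s)) [upds ds (s(d := ev e s))] (acost ds)"
    using Cons by (auto simp: p)
  ultimately have "vexe K (asgs k (p # ds)) s [upds ds (s(d := ev e s))] (esz e + 1 + acost ds)"
    unfolding p asgs.simps by (rule vexe_sq1)
  then show ?case by (simp add: p)
qed

text \<open>Three zones: program variables below \<open>K\<close>, bound registers of queries
  between \<open>K\<close> and \<open>k\<close>, temporaries from \<open>k\<close> on. A query then
  leaves the visible state unchanged.\<close>

definition qok :: "nat \<Rightarrow> nat \<Rightarrow> qry \<Rightarrow> bool" where
  "qok K k q \<longleftrightarrow> wfq q \<and> fv q \<subseteq> {..<K} \<and> bv q \<subseteq> {K..<k} \<and> K \<le> k"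

definition bounded :: "nat \<Rightarrow> nat \<Rightarrow> state \<Rightarrow> bool" where
  "bounded K m s \<longleftrightarrow> 1 \<le> m \<and> (\<forall>r<K. tsize (s r) \<le> m)"

text \<open>\<open>If\<close> expects the branch for \<open>Tip\<close>, that is for a false query,
  first; hence the exchange.\<close>

definition ifq :: "nat \<Rightarrow> qry \<Rightarrow> com \<Rightarrow> com \<Rightarrow> com" where
  "ifq k q c1 c2 = qc q k ;; If k c2 c1"

lemma ifq_no_choice [simp]: "no_choice (ifq k q c1 c2) \<longleftrightarrow> no_choice c1 \<and> no_choice c2"
  by (auto simp: ifq_def)

lemma vexe_ifq:
  assumes q: "qok K k q" and s: "bounded K m s"
    and c: "vexe K (if sem q s then c1 else c2) s ts n"
  shows "vexe K (ifq k q c1 c2) s ts (qcost q m + n + 2)"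
  unfolding vexe_def
proof (intro allI impI)
  fix s' assume s': "agree K s' s"
  have v: "wfq q" "fv q \<subseteq> {..<k}" "bv q \<subseteq> {..<k}" "fv q \<subseteq> {..<K}" "K \<le> k" "bv q \<inter> {..<K} = {}"
    using q by (auto simp: qok_def)
  have "\<forall>r\<in>fv q. tsize (s' r) \<le> m" using s' s v by (auto simp: bounded_def)
  from exe_qc[OF v(1-3) _ this] obtain t where t: "exe (qc q k) s' [t] (qcost q m)"
    "t k \<noteq> Tip \<longleftrightarrow> sem q s'" "\<forall>r<k. r \<notin> bv q \<longrightarrow> t r = s' r" using s by (auto simp: bounded_def)
  have "sem q s' \<longleftrightarrow> sem q s" by (rule sem_cong) (use s' v in auto)
  then have tk: "t k \<noteq> Tip \<longleftrightarrow> sem q s" using t by simp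
  have "t r = s r" if "r < K" for r
  proof -
    have "r < k" "r \<notin> bv q" using that v(5,6) by auto
    then show ?thesis using t(3) s' that by simp
  qed
  then have "agree K t s" by simp
  from vexeD[OF c this] obtain ts' where ts': "exe (if sem q s then c1 else c2) t ts' n"
    "list_all2 (agree K) ts' ts" by blast
  have "exe (If k c2 c1) t ts' (n + 2)"
  proof (cases "sem q s")
    case True
    then show ?thesis using ts'(1) tk by (intro if_node) simp_all
  next
    case False
    then show ?thesis using ts'(1) tk by (intro if_tip) simp_all
  qed
  from exe_sq1[OF t(1) this] ts'(2)
  show "\<exists>ts'. exe (ifq k q c1 c2) s' ts' (qcost q m + n + 2) \<and> list_all2 (agree K) ts' ts"
    unfolding ifq_def by (auto simp: add.assoc)
qed

text \<open>\<open>fnd k i e q\<close> searches the list \<open>e\<close> for an element that satisfies \<open>q\<close>; register \<open>i\<close>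
  receives it, or \<open>Tip\<close> if there is none.\<close>

definition fnd :: "nat \<Rightarrow> nat \<Rightarrow> exp \<Rightarrow> qry \<Rightarrow> com" where
  "fnd k i e q = qc (QEx i e q) k ;; If k (CLR i) SKIP"

definition fval :: "nat \<Rightarrow> exp \<Rightarrow> qry \<Rightarrow> state \<Rightarrow> tree" where
  "fval i e q s = (case find (\<lambda>x. sem q (s(i := x))) (els (ev e s)) of Some x \<Rightarrow> x | None \<Rightarrow> Tip)"

lemma vexe_fnd:
  assumes q: "qok K k q" and i: "i < K" and e: "evars e \<subseteq> {..<K}" and s: "bounded K m s"
  shows "vexe K (fnd k i e q) s [s(i := fval i e q s)] (qcost (QEx i e q) m + 3)"
proof (rule vexeI1)
  fix s' assume s': "agree K s' s"
  have v: "wfq q" "fv q \<subseteq> {..<k}" "bv q \<subseteq> {..<k}" "fv q \<subseteq> {..<K}" "K \<le> k" "bv q \<inter> {..<K} = {}"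
    using q by (auto simp: qok_def)
  have v2: "i \<notin> bv q" "fv q \<inter> bv q = {}" using v i by auto
  have wf: "wfq (QEx i e q)" using v(1) v2 by simp
  have ik: "i < k" and ek: "evars e \<subseteq> {..<k}" using i e v(5) by auto
  have m: "1 \<le> m" using s by (simp add: bounded_def)
  then have m2: "1 \<le> esz e * m" using esz_pos[of e] by (simp add: Suc_le_eq)
  have fvb: "\<forall>r\<in>fv (QEx i e q). tsize (s' r) \<le> m"
  proof
    fix r assume "r \<in> fv (QEx i e q)"
    then have "r < K" using e v(4) by auto
    then show "tsize (s' r) \<le> m" using s' s by (simp add: bounded_def)
  qed
  have v3: "fv q \<subseteq> {..<k+2}" "bv q \<subseteq> {..<k+2}" using v(2,3) by auto
  obtain t where t: "exe (qc (QEx i e q) k) s' [t] (qcost (QEx i e q) m)"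
    "t k \<noteq> Tip \<longleftrightarrow> sem (QEx i e q) s'"
    "\<forall>x. find (\<lambda>x. sem q (s'(i := x))) (els (ev e s')) = Some x \<longrightarrow> t i = x"
    "\<forall>r<k. r \<notin> bv q \<longrightarrow> r \<noteq> i \<longrightarrow> t r = s' r"
    using exe_QEx[OF exe_qc[OF v(1) v3 m2] wf ik ek v(2,3) m fvb] by blast
  have ev: "ev e s' = ev e s" by (rule ev_cong) (use s' e in auto)
  have se: "sem q (s'(i := x)) \<longleftrightarrow> sem q (s(i := x))" for x
    by (rule sem_cong) (use s' v(4) in auto)
  have tr: "t r = s r" if "r < K" "r \<noteq> i" for r
  proof -
    have "r < k" "r \<notin> bv q" using that v(5,6) by auto
    then show ?thesis using t(4) s' that by simp
  qed
  have fn: "find (\<lambda>x. sem q (s'(i := x))) (els (ev e s')) = find (\<lambda>x. sem q (s(i := x))) (els (ev e s))"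
    by (simp add: ev se)
  let ?i = "If k (CLR i) SKIP"
  have "exe ?i t [run ?i t] 3" by (rule weaken[OF exe_straight]) simp_all
  from exe_sq1[OF t(1) this]
  have e1: "exe (fnd k i e q) s' [run ?i t] (qcost (QEx i e q) m + 3)" by (simp add: fnd_def)
  have "agree K (run ?i t) (s(i := fval i e q s))"
  proof (cases "find (\<lambda>x. sem q (s(i := x))) (els (ev e s))")
    case None
    then have "\<not> sem (QEx i e q) s'" unfolding fn[symmetric] by (auto simp: find_None_iff)
    then show ?thesis using t(2) None tr by (simp add: fval_def)
  next
    case (Some x)
    then have "sem (QEx i e q) s'" unfolding fn[symmetric] by (auto simp: find_Some_iff)
    then show ?thesis using t(2,3) Some tr fn by (simp add: fval_def)
  qed
  then show "\<exists>t'. exe (fnd k i e q) s' [t'] (qcost (QEx i e q) m + 3) \<and>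
      agree K t' (s(i := fval i e q s))" using e1 by blast
qed

lemma fval_found:
  assumes "\<exists>x\<in>set (els (ev e s)). sem q (s(i := x))"
  shows "fval i e q s \<in> set (els (ev e s))" and "sem q (s(i := fval i e q s))"
proof -
  obtain x where x: "find (\<lambda>x. sem q (s(i := x))) (els (ev e s)) = Some x"
    using assms by (cases "find (\<lambda>x. sem q (s(i := x))) (els (ev e s))") (auto simp: find_None_iff)
  then have "x \<in> set (els (ev e s))" "sem q (s(i := x))"
    by (auto simp: find_Some_iff)
  then show "fval i e q s \<in> set (els (ev e s))" "sem q (s(i := fval i e q s))"
    using x by (simp_all add: fval_def)
qed

lemma fval_not_found:
  assumes "\<not> (\<exists>x\<in>set (els (ev e s)). sem q (s(i := x)))"
  shows "fval i e q s = Tip"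
proof -
  have "find (\<lambda>x. sem q (s(i := x))) (els (ev e s)) = None" using assms by (auto simp: find_None_iff)
  then show ?thesis by (simp add: fval_def)
qed

subsection \<open>Polynomially bounded functions\<close>

lemma poly_nat_mono: "x \<le> y \<Longrightarrow> poly p x \<le> poly p (y :: nat)"
  by (induction p) (auto intro: mult_le_mono)

definition pb :: "(nat \<Rightarrow> nat) \<Rightarrow> bool" where
  "pb f \<longleftrightarrow> (\<exists>p. \<forall>n. f n \<le> poly p n)"

lemma pb_const: "pb (\<lambda>n. c)"
  unfolding pb_def by (intro exI[of _ "[:c:]"]) simp

lemma pb_id: "pb (\<lambda>n. n)"
  unfolding pb_def by (intro exI[of _ "[:0, 1:]"]) simp

lemma pb_add: "pb f \<Longrightarrow> pb g \<Longrightarrow> pb (\<lambda>n. f n + g n)"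
  unfolding pb_def by (metis add_mono poly_add)

lemma pb_mult: "pb f \<Longrightarrow> pb g \<Longrightarrow> pb (\<lambda>n. f n * g n)"
  unfolding pb_def by (metis mult_le_mono poly_mult)

lemma pb_Suc: "pb f \<Longrightarrow> pb (\<lambda>n. Suc (f n))"
  using pb_add[OF pb_const[of 1]] by simp

lemma pb_power: "pb f \<Longrightarrow> pb (\<lambda>n. f n ^ k)"
  by (induction k) (auto intro: pb_const pb_mult)

text \<open>Polynomials with natural coefficients are monotone, so upper bounds may be substituted
  into each other.\<close>

lemma pb_compose:
  assumes "pb f" and "pb g" shows "pb (\<lambda>n. f (g n))"
proof -
  obtain p q where p: "\<And>n. f n \<le> poly p n" and q: "\<And>n. g n \<le> poly q n"
    using assms unfolding pb_def by blast
  have "f (g n) \<le> poly (pcompose p q) n" for n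
    using order_trans[OF p poly_nat_mono[OF q]] by (simp add: poly_pcompose)
  then show ?thesis unfolding pb_def by blast
qed

lemmas pb_intros = pb_const pb_id pb_add pb_mult pb_Suc pb_power

lemma pb_qcost: "pb (qcost q)"
proof (induction q)
  case (QEx i e q)
  have "pb (\<lambda>m. qcost q (esz e * m))" by (rule pb_compose[OF QEx]) (intro pb_intros)
  then have "pb (\<lambda>m. esz e + 2 + esz e * m * (qcost q (esz e * m) + 8))"
    by (intro pb_intros)
  then show ?case by (simp add: pb_def)
next
  case (QEq a b)
  have "pb (\<lambda>m. esz a + esz b + 24 * (esz a * m) + 5)" by (intro pb_intros)
  then show ?case by (simp add: pb_def)
next
  case (QNot q)
  then have "pb (\<lambda>m. qcost q m + 4)" by (intro pb_intros)
  then show ?case by (simp add: pb_def)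
next
  case (QAnd p q)
  then have "pb (\<lambda>m. qcost p m + qcost q m + 2)" by (intro pb_intros)
  then show ?case by (simp add: pb_def)
qed

subsection \<open>Encodings\<close>

abbreviation "one_bit \<equiv> Node Tip Tip"

definition nxt :: "nat \<Rightarrow> nat" where
  "nxt n = 2 * n + 1"

lemma enc_nat_0 [simp]: "enc_nat 0 = Tip"
  by (simp add: enc_nat.simps)

lemma enc_nat_nxt: "enc_nat (nxt n) = Node one_bit (enc_nat n)"
  by (subst enc_nat.simps) (simp add: nxt_def)

lemma enc_nat_1 [simp]: "enc_nat (Suc 0) = Node one_bit Tip"
  using enc_nat_nxt[of 0] by (simp add: nxt_def)

lemma enc_nat_2 [simp]: "enc_nat 2 = Node Tip (Node one_bit Tip)"
  by (subst enc_nat.simps) simp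

lemma enc_nat_3 [simp]: "enc_nat 3 = Node one_bit (Node one_bit Tip)"
  by (subst enc_nat.simps) simp

fun dec_nat :: "tree \<Rightarrow> nat" where
  "dec_nat Tip = 0"
| "dec_nat (Node d t) = (if d = Tip then 0 else 1) + 2 * dec_nat t"

lemma dec_enc_nat [simp]: "dec_nat (enc_nat n) = n"
proof (induction n rule: less_induct)
  case (less n)
  show ?case
  proof (cases "n = 0")
    case False
    then have "dec_nat (enc_nat (n div 2)) = n div 2" by (intro less) simp
    then show ?thesis using False by (subst enc_nat.simps) auto
  qed simp
qed

lemma enc_nat_inject [simp]: "enc_nat n = enc_nat m \<longleftrightarrow> n = m"
  by (metis dec_enc_nat)

lemma enc_label_inject [simp]: "enc_label w = enc_label v \<longleftrightarrow> w = v"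
  by (cases w; cases v) auto

lemma enc_form_inject [simp]: "enc_form f = enc_form g \<longleftrightarrow> f = g"
proof (induction f arbitrary: g)
  case (Atom p)
  show ?case by (cases g) auto
next
  case (Neg f)
  then show ?case by (cases g) auto
next
  case (Imp f f')
  then show ?case by (cases g) auto
next
  case (Ident f f')
  then show ?case by (cases g) auto
qed

lemma enc_item_inject [simp]: "enc_item i = enc_item j \<longleftrightarrow> i = j"
  by (cases i; cases j) auto

lemma enc_item_image: "enc_item i \<in> enc_item ` S \<longleftrightarrow> i \<in> S"
  by (simp add: image_iff)

lemma enc_items_simps [simp]:
  "enc_items [] = Tip"
  "enc_items (i # xs) = Node (enc_item i) (enc_items xs)"
  by (simp_all add: enc_items_def)

lemma els_enc_items [simp]: "els (enc_items xs) = map enc_item xs"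
  by (induction xs) auto

text \<open>A canonical numeral has no zero as its most significant bit; this is what
  \<open>right t \<noteq> Tip\<close> expresses. The recursive form lets validation consume one
  digit at a time.\<close>

lemma isnat_iff:
  "(\<exists>n. t = enc_nat n) \<longleftrightarrow> t = Tip \<or> t \<noteq> Tip \<and>
     (left t = Tip \<and> right t \<noteq> Tip \<or> left t = one_bit) \<and> (\<exists>n. right t = enc_nat n)"
proof (cases t)
  case (Node d r)
  show ?thesis
  proof
    assume "\<exists>n. t = enc_nat n"
    then obtain n where n: "t = enc_nat n" ..
    have "n \<noteq> 0" by (rule notI) (use n Node in simp)
    then have dr: "d = (if odd n then one_bit else Tip)" "r = enc_nat (n div 2)"
      using n Node by (simp_all add: enc_nat.simps[of n] split: if_splits)
    have "d = Tip \<longrightarrow> r \<noteq> Tip"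
    proof
      assume "d = Tip"
      then have "even n" using dr(1) by (auto split: if_splits)
      then have "n div 2 \<noteq> 0" using \<open>n \<noteq> 0\<close> by (auto elim!: evenE)
      then show "r \<noteq> Tip" using dr(2) enc_nat_inject[of "n div 2" 0] by simp
    qed
    then show "t = Tip \<or> t \<noteq> Tip \<and>
      (left t = Tip \<and> right t \<noteq> Tip \<or> left t = one_bit) \<and> (\<exists>n. right t = enc_nat n)"
      using dr Node by (auto split: if_splits)
  next
    assume "t = Tip \<or> t \<noteq> Tip \<and>
      (left t = Tip \<and> right t \<noteq> Tip \<or> left t = one_bit) \<and> (\<exists>n. right t = enc_nat n)"
    then obtain n where n: "r = enc_nat n" "d = Tip \<and> r \<noteq> Tip \<or> d = one_bit" using Node by auto
    from n(2) show "\<exists>n. t = enc_nat n"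
    proof
      assume "d = one_bit"
      then show ?thesis using n Node enc_nat_nxt[of n] by metis
    next
      assume d: "d = Tip \<and> r \<noteq> Tip"
      have "n \<noteq> 0" by (rule notI) (use d n in simp)
      then have "enc_nat (2 * n) = Node Tip (enc_nat n)" by (simp add: enc_nat.simps[of "2 * n"])
      then show ?thesis using d n Node by metis
    qed
  qed
qed (auto intro: exI[of _ 0])

lemma isform_iff:
  "(\<exists>f. t = enc_form f) \<longleftrightarrow> t \<noteq> Tip \<and>
     (left t = enc_nat 0 \<and> (\<exists>n. right t = enc_nat n) \<or>
      left t = enc_nat 1 \<and> (\<exists>f. right t = enc_form f) \<or>
      (left t = enc_nat 2 \<or> left t = enc_nat 3) \<and> (\<exists>f. left (right t) = enc_form f) \<and>
        (\<exists>f. right (right t) = enc_form f))" (is "?l \<longleftrightarrow> ?r")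
proof
  assume ?l
  then obtain f where "t = enc_form f" ..
  then show ?r by (cases f) auto
next
  assume r: ?r
  then obtain a b where t: "t = Node a b" by (cases t) auto
  \<comment> \<open>The convention \<open>left Tip = Tip\<close> cannot fake an argument, because no
    formula has the code \<open>Tip\<close>.\<close>
  have "b = Node (left b) (right b)" if "left b = enc_form f" for f
    using that by (cases b; cases f) auto
  then consider n where "t = enc_form (Atom n)" | f where "t = enc_form (Neg f)"
    | f g where "t = enc_form (Imp f g)" | f g where "t = enc_form (Ident f g)"
    using r t by (auto simp del: enc_nat_0 enc_nat_1 enc_nat_2 enc_nat_3 enc_form_inject)
  then show ?l by cases blast+
qed

subsection \<open>Queries about a branch\<close>

text \<open>Register 2 holds the items of the branch.\<close>

definition eqE :: "exp \<Rightarrow> exp \<Rightarrow> exp" where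
  "eqE a b = XN (cx (enc_nat 1)) (XN a b)"

definition neqE :: "exp \<Rightarrow> exp \<Rightarrow> exp" where
  "neqE a b = XN (cx (enc_nat 2)) (XN a b)"

definition fstE :: "nat \<Rightarrow> exp" where
  "fstE x = XL (XR (XV x))"

definition sndE :: "nat \<Rightarrow> exp" where
  "sndE x = XR (XR (XV x))"

definition tagQ :: "nat \<Rightarrow> nat \<Rightarrow> qry" where
  "tagQ x k = QEq (XL (XV x)) (cx (enc_nat k))"

definition memQ :: "nat \<Rightarrow> exp \<Rightarrow> qry" where
  "memQ i e = QEx i (XV 2) (QEq (XV i) e)"

definition orQ :: "qry \<Rightarrow> qry \<Rightarrow> qry" where
  "orQ p q = QNot (QAnd (QNot p) (QNot q))"

definition closureQ :: qry where
  "closureQ = QEx 20 (XV 2) (QAnd (tagQ 20 1)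
     (orQ (memQ 21 (neqE (fstE 20) (sndE 20)))
       (QAnd (QEq (XL (fstE 20)) XT) (QNot (QEq (XL (sndE 20)) XT)))))"

definition simQ :: "exp \<Rightarrow> exp \<Rightarrow> nat \<Rightarrow> qry" where
  "simQ a b i = QEx i (XV 2) (QEx (i+1) (XV 2) (QAnd (tagQ i 0) (QAnd (tagQ (i+1) 0)
     (QAnd (QEq (sndE i) a) (QAnd (QEq (sndE (i+1)) b) (memQ (i+2) (eqE (fstE i) (fstE (i+1)))))))))"

text \<open>Index 0 is the argument of a negation, 1 and 2 are those of a binary connective.\<close>

definition subE :: "exp \<Rightarrow> nat \<Rightarrow> exp" where
  "subE f j = (if j = 0 then XR f else if j = 1 then XL (XR f) else XR (XR f))"

definition ftagQ :: "nat \<Rightarrow> nat \<Rightarrow> qry" where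
  "ftagQ x k = QEq (XL (sndE x)) (cx (enc_nat k))"

text \<open>The disjuncts are \<open>F\<close>, \<open>sym\<close>, \<open>tran\<close> and
  \<open>eq_neg\<close>; the last one treats \<open>eq_imp\<close> and \<open>eq_ident\<close>
  together by comparing the connectives. Their bound registers are 21, 22 and 23, and three for each
  \<open>simQ\<close> from 24, 27 and 30.\<close>

definition ruleQ :: "nat \<Rightarrow> nat \<Rightarrow> qry" where
  "ruleQ x z =
     orQ (QEq (sndE x) (sndE z))
    (orQ (memQ 21 (eqE (fstE z) (fstE x)))
    (orQ (QEx 22 (XV 2) (QAnd (tagQ 22 1) (QAnd (QEq (fstE 22) (fstE x))
            (memQ 23 (eqE (sndE 22) (fstE z))))))
    (orQ (QAnd (ftagQ x 1) (QAnd (ftagQ z 1) (simQ (subE (sndE x) 0) (subE (sndE z) 0) 24)))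
         (QAnd (QEq (XL (sndE x)) (XL (sndE z))) (QAnd (orQ (ftagQ x 2) (ftagQ x 3))
           (QAnd (simQ (subE (sndE x) 1) (subE (sndE z) 1) 27)
             (simQ (subE (sndE x) 2) (subE (sndE z) 2) 30)))))))"

definition pairQ :: "nat \<Rightarrow> nat \<Rightarrow> qry" where
  "pairQ x z = QAnd (tagQ x 0) (QAnd (tagQ z 0)
     (QAnd (QNot (memQ 20 (eqE (fstE x) (fstE z)))) (ruleQ x z)))"

lemmas qry_defs = eqE_def neqE_def fstE_def sndE_def tagQ_def memQ_def orQ_def closureQ_def
  simQ_def subE_def ftagQ_def ruleQ_def pairQ_def

lemma sem_orQ [simp]: "sem (orQ p q) s \<longleftrightarrow> sem p s \<or> sem q s"
  by (simp add: orQ_def)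

lemma enc_item_tag:
  "left (enc_item i) = enc_nat 0 \<longleftrightarrow> (\<exists>w f. i = Fm w f)"
  "left (enc_item i) = enc_nat 1 \<longleftrightarrow> (\<exists>w v. i = Eq w v)"
  by (cases i; simp)+

lemma sem_memQ:
  assumes "els (s 2) = map enc_item xs" and "i \<notin> evars e"
  shows "sem (memQ i e) s \<longleftrightarrow> ev e s \<in> enc_item ` set xs"
proof -
  have "ev e (s(i := x)) = ev e s" for x by (rule ev_cong) (use assms(2) in auto)
  then show ?thesis using assms(1) by (auto simp: memQ_def)
qed

lemma sem_memQ_eqE:
  assumes "els (s 2) = map enc_item xs" and "i \<notin> evars a" "i \<notin> evars b"
    and "ev a s = enc_label w" "ev b s = enc_label v"
  shows "sem (memQ i (eqE a b)) s \<longleftrightarrow> Eq w v \<in> set xs"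
proof -
  have e: "ev (eqE a b) s = enc_item (Eq w v)" using assms(4,5) by (simp add: eqE_def)
  have m: "i \<notin> evars (eqE a b)" using assms(2,3) by (simp add: eqE_def)
  show ?thesis using sem_memQ[where s = s, OF assms(1) m] unfolding e enc_item_image .
qed

lemma sem_memQ_neqE:
  assumes "els (s 2) = map enc_item xs" and "i \<notin> evars a" "i \<notin> evars b"
    and "ev a s = enc_label w" "ev b s = enc_label v"
  shows "sem (memQ i (neqE a b)) s \<longleftrightarrow> Neq w v \<in> set xs"
proof -
  have e: "ev (neqE a b) s = enc_item (Neq w v)" using assms(4,5) by (simp add: neqE_def)
  have m: "i \<notin> evars (neqE a b)" using assms(2,3) by (simp add: neqE_def)
  show ?thesis using sem_memQ[where s = s, OF assms(1) m] unfolding e enc_item_image .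
qed

lemma sem_QEx_items:
  assumes "els (s 2) = map enc_item xs"
  shows "sem (QEx i (XV 2) q) s \<longleftrightarrow> (\<exists>it\<in>set xs. sem q (s(i := enc_item it)))"
  using assms by simp

lemma pol_tag: "left (enc_label w) = Tip \<longleftrightarrow> (\<exists>n. w = Plus n)"
  by (cases w) auto

lemma sem_closureQ:
  assumes xs: "els (s 2) = map enc_item xs"
  shows "sem closureQ s \<longleftrightarrow> closure_rule (set xs)"
proof -
  have 1: "sem (QAnd (tagQ 20 1) (orQ (memQ 21 (neqE (fstE 20) (sndE 20)))
       (QAnd (QEq (XL (fstE 20)) XT) (QNot (QEq (XL (sndE 20)) XT))))) (s(20 := enc_item it)) \<longleftrightarrow>
     (\<exists>w v. it = Eq w v \<and> (Neq w v \<in> set xs \<or> (\<exists>n m. w = Plus n \<and> v = Minus m)))" for it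
  proof (cases "\<exists>w v. it = Eq w v")
    case True
    then obtain w v where it: "it = Eq w v" by blast
    let ?s = "s(20 := enc_item it)"
    have "sem (memQ 21 (neqE (fstE 20) (sndE 20))) ?s \<longleftrightarrow> Neq w v \<in> set xs"
      by (rule sem_memQ_neqE) (simp_all add: fstE_def sndE_def it xs)
    moreover have "(\<exists>m. v = Minus m) \<longleftrightarrow> \<not> (\<exists>n. v = Plus n)" by (cases v) auto
    ultimately show ?thesis using it by (simp add: tagQ_def fstE_def sndE_def pol_tag)
  next
    case False
    then have "left (enc_item it) \<noteq> enc_nat 1" by (simp only: enc_item_tag) simp
    then show ?thesis using False by (auto simp: tagQ_def simp del: enc_nat_1)
  qed
  show ?thesis unfolding closureQ_def sem_QEx_items[where s = s, OF xs] 1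
    by (auto elim!: closure_rule.cases intro: closure_rule.intros)
qed

lemma sem_simQ:
  assumes xs: "els (s 2) = map enc_item xs" and i: "2 < i"
    and ab: "evars a \<inter> {i, i+1} = {}" "evars b \<inter> {i, i+1} = {}"
    and ev: "ev a s = enc_form f" "ev b s = enc_form g"
  shows "sem (simQ a b i) s \<longleftrightarrow> sim (set xs) f g"
proof -
  have 1: "sem (QAnd (tagQ i 0) (QAnd (tagQ (i+1) 0) (QAnd (QEq (sndE i) a)
     (QAnd (QEq (sndE (i+1)) b) (memQ (i+2) (eqE (fstE i) (fstE (i+1))))))))
       (s(i := enc_item p, i+1 := enc_item q)) \<longleftrightarrow>
     (\<exists>w v. p = Fm w f \<and> q = Fm v g \<and> Eq w v \<in> set xs)" for p q
  proof (cases "(\<exists>w f'. p = Fm w f') \<and> (\<exists>v g'. q = Fm v g')")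
    case True
    then obtain w f' v g' where pq: "p = Fm w f'" "q = Fm v g'" by blast
    let ?s = "s(i := enc_item p, i+1 := enc_item q)"
    have "ev a ?s = ev a s" by (rule ev_cong) (use ab in auto)
    moreover have "ev b ?s = ev b s" by (rule ev_cong) (use ab in auto)
    moreover have "sem (memQ (i+2) (eqE (fstE i) (fstE (i+1)))) ?s \<longleftrightarrow> Eq w v \<in> set xs"
      by (rule sem_memQ_eqE) (use i in \<open>simp_all add: fstE_def pq xs\<close>)
    ultimately show ?thesis using pq ev by (simp add: tagQ_def sndE_def)
  next
    case False
    then have "left (enc_item p) \<noteq> enc_nat 0 \<or> left (enc_item q) \<noteq> enc_nat 0"
      by (simp only: enc_item_tag) simp
    then show ?thesis using False by (auto simp: tagQ_def simp del: enc_nat_0)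
  qed
  have "els ((s(i := enc_item p)) 2) = map enc_item xs" for p using xs i by simp
  note 2 = sem_QEx_items[where s = "s(i := enc_item p)" for p, OF this]
  show ?thesis
    unfolding simQ_def sem_QEx_items[where s = s, OF xs] 2 1 sim_def by blast
qed

section \<open>Equality rules as conditions on pairs of labelled formulas\<close>

definition rule_cond :: "item set \<Rightarrow> label \<Rightarrow> form \<Rightarrow> label \<Rightarrow> form \<Rightarrow> bool" where
  "rule_cond B w f v g \<longleftrightarrow> f = g \<or> Eq v w \<in> B \<or> (\<exists>u. Eq w u \<in> B \<and> Eq u v \<in> B) \<or>
     (\<exists>f' g'. f = Neg f' \<and> g = Neg g' \<and> sim B f' g') \<or>
     (\<exists>f1 f2 g1 g2. (f = Imp f1 f2 \<and> g = Imp g1 g2 \<or> f = Ident f1 f2 \<and> g = Ident g1 g2) \<and>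
        sim B f1 g1 \<and> sim B f2 g2)"

text \<open>The ranges keep \<open>x\<close> and \<open>z\<close> clear of the bound registers 20 to
  32 and of the list in register 2.\<close>

lemma sem_pairQ:
  assumes xs: "els (s 2) = map enc_item xs" and x: "x < 20 \<or> 33 \<le> x" "x \<noteq> 2" and z: "z < 20 \<or> 33 \<le> z" "z \<noteq> 2"
    and sx: "s x = enc_item p" and sz: "s z = enc_item q"
  shows "sem (pairQ x z) s \<longleftrightarrow> (\<exists>w f v g. p = Fm w f \<and> q = Fm v g \<and> Eq w v \<notin> set xs \<and>
    rule_cond (set xs) w f v g)"
proof (cases "(\<exists>w f'. p = Fm w f') \<and> (\<exists>v g'. q = Fm v g')")
  case True
  then obtain w f v g where pq: "p = Fm w f" "q = Fm v g" by blast
  have xz: "x \<noteq> 20" "x \<noteq> 21" "x \<noteq> 22" "x \<noteq> 23" "z \<noteq> 20" "z \<noteq> 21" "z \<noteq> 22" "z \<noteq> 23"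
    using x z by auto
  have m1: "sem (memQ 20 (eqE (fstE x) (fstE z))) s \<longleftrightarrow> Eq w v \<in> set xs"
    by (rule sem_memQ_eqE) (use xz sx sz in \<open>simp_all add: fstE_def pq xs\<close>)
  have m2: "sem (memQ 21 (eqE (fstE z) (fstE x))) s \<longleftrightarrow> Eq v w \<in> set xs"
    by (rule sem_memQ_eqE) (use xz sx sz in \<open>simp_all add: fstE_def pq xs\<close>)
  have m3': "sem (QAnd (tagQ 22 1) (QAnd (QEq (fstE 22) (fstE x)) (memQ 23 (eqE (sndE 22) (fstE z)))))
      (s(22 := enc_item it)) \<longleftrightarrow> (\<exists>u. it = Eq w u \<and> Eq u v \<in> set xs)" for it
  proof (cases "\<exists>w v. it = Eq w v")
    case True
    then obtain w' u where it: "it = Eq w' u" by blast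
    have "sem (memQ 23 (eqE (sndE 22) (fstE z))) (s(22 := enc_item it)) \<longleftrightarrow> Eq u v \<in> set xs"
      by (rule sem_memQ_eqE) (use xz sx sz in \<open>simp_all add: fstE_def sndE_def pq xs it\<close>)
    then show ?thesis using it xz sx pq by (auto simp: tagQ_def fstE_def)
  next
    case False
    then have "left (enc_item it) \<noteq> enc_nat 1" by (simp only: enc_item_tag) simp
    then show ?thesis using False by (auto simp: tagQ_def simp del: enc_nat_1)
  qed
  have m3: "sem (QEx 22 (XV 2) (QAnd (tagQ 22 1) (QAnd (QEq (fstE 22) (fstE x))
      (memQ 23 (eqE (sndE 22) (fstE z)))))) s \<longleftrightarrow> (\<exists>u. Eq w u \<in> set xs \<and> Eq u v \<in> set xs)"
    unfolding sem_QEx_items[where s = s, OF xs] m3' by blast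
  have e: "ev (sndE x) s = enc_form f" "ev (sndE z) s = enc_form g"
    using sx sz by (simp_all add: sndE_def pq)
  have sm: "sem (simQ (subE (sndE x) j) (subE (sndE z) j) i) s \<longleftrightarrow> sim (set xs) f' g'"
    if "ev (subE (sndE x) j) s = enc_form f'" "ev (subE (sndE z) j) s = enc_form g'"
      "i = 24 \<or> i = 27 \<or> i = 30" for i j f' g'
    by (rule sem_simQ[where s = s, OF xs]) (use x z that in \<open>auto simp: subE_def sndE_def\<close>)
  have m4: "sem (QAnd (ftagQ x 1) (QAnd (ftagQ z 1) (simQ (subE (sndE x) 0) (subE (sndE z) 0) 24))) s
      \<longleftrightarrow> (\<exists>f' g'. f = Neg f' \<and> g = Neg g' \<and> sim (set xs) f' g')"
  proof (cases "(\<exists>f'. f = Neg f') \<and> (\<exists>g'. g = Neg g')")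
    case True
    then obtain f' g' where fg: "f = Neg f'" "g = Neg g'" by blast
    have "sem (simQ (subE (sndE x) 0) (subE (sndE z) 0) 24) s \<longleftrightarrow> sim (set xs) f' g'"
      by (rule sm) (use e fg in \<open>simp_all add: subE_def\<close>)
    then show ?thesis using e fg by (simp add: ftagQ_def)
  next
    case False
    then have "\<not> sem (QAnd (ftagQ x 1) (ftagQ z 1)) s"
      using e by (cases f; cases g) (simp_all add: ftagQ_def)
    then show ?thesis using False by auto
  qed
  have m5: "sem (QAnd (QEq (XL (sndE x)) (XL (sndE z))) (QAnd (orQ (ftagQ x 2) (ftagQ x 3))
           (QAnd (simQ (subE (sndE x) 1) (subE (sndE z) 1) 27)
             (simQ (subE (sndE x) 2) (subE (sndE z) 2) 30)))) s
      \<longleftrightarrow> (\<exists>f1 f2 g1 g2. (f = Imp f1 f2 \<and> g = Imp g1 g2 \<or> f = Ident f1 f2 \<and> g = Ident g1 g2) \<and>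
        sim (set xs) f1 g1 \<and> sim (set xs) f2 g2)"
  proof (cases "\<exists>f1 f2 g1 g2. f = Imp f1 f2 \<and> g = Imp g1 g2 \<or> f = Ident f1 f2 \<and> g = Ident g1 g2")
    case True
    then obtain f1 f2 g1 g2
      where fg: "f = Imp f1 f2 \<and> g = Imp g1 g2 \<or> f = Ident f1 f2 \<and> g = Ident g1 g2" by blast
    have "sem (simQ (subE (sndE x) 1) (subE (sndE z) 1) 27) s \<longleftrightarrow> sim (set xs) f1 g1"
      by (rule sm) (use e fg in \<open>auto simp: subE_def\<close>)
    moreover have "sem (simQ (subE (sndE x) 2) (subE (sndE z) 2) 30) s \<longleftrightarrow> sim (set xs) f2 g2"
      by (rule sm) (use e fg in \<open>auto simp: subE_def\<close>)
    ultimately show ?thesis using e fg by (auto simp: ftagQ_def)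
  next
    case False
    then have "\<not> sem (QAnd (QEq (XL (sndE x)) (XL (sndE z))) (orQ (ftagQ x 2) (ftagQ x 3))) s"
      using e by (cases f; cases g) (simp_all add: ftagQ_def)
    then show ?thesis using False by auto
  qed
  have m0: "sem (QEq (sndE x) (sndE z)) s \<longleftrightarrow> f = g" using e by simp
  have tags: "sem (tagQ x 0) s" "sem (tagQ z 0) s" using sx sz pq by (simp_all add: tagQ_def)
  have "sem (pairQ x z) s \<longleftrightarrow> Eq w v \<notin> set xs \<and> sem (ruleQ x z) s"
    unfolding pairQ_def using tags m1 by simp
  also have "sem (ruleQ x z) s \<longleftrightarrow> rule_cond (set xs) w f v g"
    unfolding ruleQ_def sem_orQ m0 m2 m3 m4 m5 rule_cond_def ..
  finally show ?thesis using pq by blast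
next
  case False
  then have "left (enc_item p) \<noteq> enc_nat 0 \<or> left (enc_item q) \<noteq> enc_nat 0"
    by (simp only: enc_item_tag) simp
  then have "\<not> sem (pairQ x z) s" using sx sz by (auto simp: pairQ_def tagQ_def simp del: enc_nat_0)
  then show ?thesis using False by blast
qed

text \<open>\<open>sym\<close> and \<open>tran\<close> have equalities as their only premises, but
  every label of the branch carries a formula, so ranging over labelled formulas misses no
  instance.\<close>

lemma pairQ_eq_rule:
  assumes lab: "labels B = {w. \<exists>f. Fm w f \<in> B}"
  shows "eq_rule B w v \<longleftrightarrow> (\<exists>f g. Fm w f \<in> B \<and> Fm v g \<in> B \<and>
    rule_cond B w f v g)" (is "?l \<longleftrightarrow> ?r")
proof
  have lb: "(\<exists>f. Fm w f \<in> B) \<and> (\<exists>g. Fm v g \<in> B)" if "Eq w v \<in> B" for w v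
  proof -
    have "{w, v} \<subseteq> labels B" using that by (force simp: labels_def)
    then show ?thesis using lab by auto
  qed
  assume ?l
  then show ?r
  proof cases
    case (eq_neg f g)
    then show ?thesis by (intro exI[of _ "Neg f"] exI[of _ "Neg g"]) (simp add: rule_cond_def)
  next
    case (eq_imp f g h k)
    then show ?thesis by (intro exI[of _ "Imp f h"] exI[of _ "Imp g k"]) (simp add: rule_cond_def)
  next
    case (eq_ident f g h k)
    then show ?thesis by (intro exI[of _ "Ident f h"] exI[of _ "Ident g k"]) (simp add: rule_cond_def)
  next
    case (F f)
    then show ?thesis unfolding rule_cond_def by blast
  next
    case sym
    then show ?thesis using lb unfolding rule_cond_def by blast
  next
    case (tran u)
    then show ?thesis using lb unfolding rule_cond_def by blast
  qed
next
  assume ?r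
  then show ?l by (auto simp: rule_cond_def intro: eq_rule.intros)
qed

subsection \<open>Executing a decomposition rule\<close>

text \<open>Registers: 2 the items of the branch in reverse order, 3 the stack of labelled formulas still
  to be decomposed, 4 the largest number used in a label, 5 nonempty while the main loop runs,
  6 the answer, 7--9 the items a rule is applied to. Scratch space for queries starts at 20, for
  commands at 40. Fresh labels are numbered \<open>nxt n\<close> because the code of \<open>nxt n\<close> is a
  single pair on top of the code of \<open>n\<close>.\<close>

definition "c1E = XN (cx one_bit) (XV 4)"
definition "c2E = XN (cx one_bit) c1E"
definition "plusE n = XN XT n"
definition "minusE n = XN (cx (enc_nat 1)) n"
definition "fmE w f = XN XT (XN w f)"

text \<open>The counter comes last, because \<open>c1E\<close> and \<open>c2E\<close> refer to its
  old value. It always advances by two, even for a negation, which introduces one label.\<close>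

definition altC :: "exp list \<Rightarrow> exp list \<Rightarrow> com" where
  "altC es fs = asgs 40 [(2, fold XN es (XV 2)), (3, fold XN fs (XV 3)), (4, c2E)]"

definition alt1 :: "exp \<Rightarrow> com" where
  "alt1 a = altC [fmE a (subE (sndE 7) 0)] [fmE a (subE (sndE 7) 0)]"

definition alt2 :: "exp \<Rightarrow> exp \<Rightarrow> exp list \<Rightarrow> com" where
  "alt2 a b x = altC ([fmE a (subE (sndE 7) 1), fmE b (subE (sndE 7) 2)] @ x)
     [fmE a (subE (sndE 7) 1), fmE b (subE (sndE 7) 2)]"

abbreviation "p1 \<equiv> plusE c1E"
abbreviation "p2 \<equiv> plusE c2E"
abbreviation "m1 \<equiv> minusE c1E"
abbreviation "m2 \<equiv> minusE c2E"

definition "polQ = QEq (XL (fstE 7)) XT"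

text \<open>The choices are nested in the order of the alternatives in \<open>decomp\<close>, so
  that the list of outcomes is a \<open>map\<close> over them. Atoms fall through to
  \<open>SKIP\<close>.\<close>

definition decC :: com where
  "decC =
    ifq 40 (ftagQ 7 1) (ifq 40 polQ (alt1 m1) (alt1 p1))
   (ifq 40 (ftagQ 7 2)
     (ifq 40 polQ (Choose (alt2 m1 m2 []) (Choose (alt2 m1 p2 []) (alt2 p1 p2 [])))
       (alt2 p1 m2 []))
   (ifq 40 (ftagQ 7 3)
     (ifq 40 polQ (Choose (alt2 p1 p2 [eqE p1 p2]) (alt2 m1 m2 [eqE m1 m2]))
       (Choose (alt2 p1 p2 [neqE p1 p2]) (Choose (alt2 p1 m2 [])
         (Choose (alt2 m1 p2 []) (alt2 m1 m2 [neqE m1 m2])))))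
     SKIP))"

definition dcost :: "nat \<Rightarrow> nat" where
  "dcost M = qcost (ftagQ 7 1) M + qcost (ftagQ 7 2) M + qcost (ftagQ 7 3) M + qcost polQ M + 1000"

fun is_Fm :: "item \<Rightarrow> bool" where
  "is_Fm (Fm w f) = True"
| "is_Fm _ = False"

definition altst :: "state \<Rightarrow> item list \<Rightarrow> item list \<Rightarrow> nat \<Rightarrow> item list \<Rightarrow> state" where
  "altst s xs ps n a = s(2 := enc_items (rev a @ xs), 3 := enc_items (rev (filter is_Fm a) @ ps),
     4 := enc_nat (nxt (nxt n)))"

lemmas alt_defs = altC_def c1E_def c2E_def plusE_def minusE_def fmE_def eqE_def neqE_def
  subE_def sndE_def fstE_def

lemma vexe_alt1:
  assumes s: "s 2 = enc_items xs" "s 3 = enc_items ps" "s 4 = enc_nat n" "s 7 = enc_item (Fm w (Neg f))"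
  shows "vexe 16 (alt1 p1) s [altst s xs ps n [Fm (Plus (nxt n)) f]] 300"
    and "vexe 16 (alt1 m1) s [altst s xs ps n [Fm (Minus (nxt n)) f]] 300"
proof -
  have "vexe 16 (alt1 p1) s [upds [(2, fold XN [fmE p1 (subE (sndE 7) 0)] (XV 2)),
      (3, fold XN [fmE p1 (subE (sndE 7) 0)] (XV 3)), (4, c2E)] s] 300"
    unfolding alt1_def altC_def
    by (rule vexe_weaken[OF vexe_asgs]) (simp_all add: alt_defs)
  then show "vexe 16 (alt1 p1) s [altst s xs ps n [Fm (Plus (nxt n)) f]] 300"
    using s by (simp add: alt_defs altst_def enc_nat_nxt)
  have "vexe 16 (alt1 m1) s [upds [(2, fold XN [fmE m1 (subE (sndE 7) 0)] (XV 2)),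
      (3, fold XN [fmE m1 (subE (sndE 7) 0)] (XV 3)), (4, c2E)] s] 300"
    unfolding alt1_def altC_def
    by (rule vexe_weaken[OF vexe_asgs]) (simp_all add: alt_defs)
  then show "vexe 16 (alt1 m1) s [altst s xs ps n [Fm (Minus (nxt n)) f]] 300"
    using s by (simp add: alt_defs altst_def enc_nat_nxt)
qed

lemma vexe_alt2:
  assumes s: "s 2 = enc_items xs" "s 3 = enc_items ps" "s 4 = enc_nat n" "s 7 = enc_item (Fm w F)"
    and F: "F = Imp f g \<or> F = Ident f g"
    and a: "(a, l) \<in> {(p1, Plus (nxt n)), (m1, Minus (nxt n))}"
    and b: "(b, k) \<in> {(p2, Plus (nxt (nxt n))), (m2, Minus (nxt (nxt n)))}"
    and x: "(x, j) \<in> {([], []), ([eqE a b], [Eq l k]), ([neqE a b], [Neq l k])}"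
  shows "vexe 16 (alt2 a b x) s [altst s xs ps n ([Fm l f, Fm k g] @ j)] 300"
proof -
  have "vexe 16 (alt2 a b x) s
     [upds [(2, fold XN ([fmE a (subE (sndE 7) 1), fmE b (subE (sndE 7) 2)] @ x) (XV 2)),
      (3, fold XN [fmE a (subE (sndE 7) 1), fmE b (subE (sndE 7) 2)] (XV 3)), (4, c2E)] s] 300"
    unfolding alt2_def altC_def
    by (rule vexe_weaken[OF vexe_asgs]) (use a b x in \<open>auto simp add: alt_defs\<close>)
  moreover have "upds [(2, fold XN ([fmE a (subE (sndE 7) 1), fmE b (subE (sndE 7) 2)] @ x) (XV 2)),
      (3, fold XN [fmE a (subE (sndE 7) 1), fmE b (subE (sndE 7) 2)] (XV 3)), (4, c2E)] s =
      altst s xs ps n ([Fm l f, Fm k g] @ j)"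
    using s F a b x by (auto simp add: alt_defs altst_def enc_nat_nxt)
  ultimately show ?thesis by simp
qed

lemma vexe_ifq_True:
  "qok K k q \<Longrightarrow> bounded K m s \<Longrightarrow> sem q s \<Longrightarrow> vexe K c1 s ts n \<Longrightarrow>
    vexe K (ifq k q c1 c2) s ts (qcost q m + n + 2)"
  by (rule vexe_ifq) simp_all

lemma vexe_ifq_False:
  "qok K k q \<Longrightarrow> bounded K m s \<Longrightarrow> \<not> sem q s \<Longrightarrow> vexe K c2 s ts n \<Longrightarrow>
    vexe K (ifq k q c1 c2) s ts (qcost q m + n + 2)"
  by (rule vexe_ifq) simp_all

lemma qok_simple: "qok 16 40 polQ" "qok 16 40 (ftagQ 7 j)"
  by (simp_all add: qok_def polQ_def qry_defs)

fun idx :: "label \<Rightarrow> nat" where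
  "idx (Plus n) = n"
| "idx (Minus n) = n"

text \<open>What the size bounds of the main loop need to know about a conclusion. The constant 6 is
  what the code of a negative label adds to that of its number; a positive one adds less.\<close>

definition alt_ok :: "nat \<Rightarrow> form \<Rightarrow> item list \<Rightarrow> bool" where
  "alt_ok n f a \<longleftrightarrow> length a \<le> 3 \<and> length (filter is_Fm a) \<le> 2 \<and> distinct (filter is_Fm a) \<and>
    (\<forall>w\<in>labels (set a). idx w \<le> nxt (nxt n) \<and> tsize (enc_label w) \<le> 6 + tsize (enc_nat (nxt (nxt n)))) \<and>
    (\<forall>w g. Fm w g \<in> set a \<longrightarrow> tsize (enc_form g) \<le> tsize (enc_form f))"

lemma nxt_greater: "n < nxt n"
  by (simp add: nxt_def)

lemma nxt_distinct: "n \<noteq> nxt n" "nxt n \<noteq> n"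
  by (simp_all add: nxt_def)

lemma nxt_le: "nxt n \<le> nxt (nxt n)"
  by (simp add: nxt_def)

text \<open>All indices in use are at most \<open>n\<close>, so \<open>nxt n\<close> and
  \<open>nxt (nxt n)\<close> are fresh in both signs: the first labels the left subformula, the
  second the right one.\<close>

lemma vexe_decC:
  assumes bnd: "bounded 16 M s"
    and s: "s 2 = enc_items xs" "s 3 = enc_items ps" "s 4 = enc_nat n" "s 7 = enc_item (Fm w f)"
    and lab: "\<forall>w\<in>labels B. idx w \<le> n"
  shows "(\<exists>p. f = Atom p) \<and> vexe 16 decC s [s] (dcost M) \<or>
    (\<exists>alts. decomp B w f alts \<and> vexe 16 decC s (map (altst s xs ps n) alts) (dcost M) \<and>
      (\<forall>a\<in>set alts. alt_ok n f a))"
proof -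
  let ?c = "nxt n" and ?d = "nxt (nxt n)"
  have new: "Plus ?c \<notin> labels B" "Minus ?c \<notin> labels B" "Plus ?d \<notin> labels B" "Minus ?d \<notin> labels B"
    using lab nxt_greater[of n] nxt_greater[of ?c] by fastforce+
  have fr: "fresh B [Plus ?c]" "fresh B [Minus ?c]" "fresh B [Plus ?c, Minus ?d]"
    "fresh B [Plus ?c, Minus ?c, Plus ?d, Minus ?d]"
    using new by (auto simp: fresh_def nxt_distinct)
  note ok = nxt_distinct nxt_le alt_ok_def enc_nat_nxt
  have tag: "sem (ftagQ 7 j) s \<longleftrightarrow> left (enc_form f) = enc_nat j" for j
    using s(4) by (simp add: ftagQ_def sndE_def)
  have pol: "sem polQ s \<longleftrightarrow> (\<exists>k. w = Plus k)"
    using s(4) by (simp add: polQ_def fstE_def pol_tag)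
  note T = vexe_ifq_True[OF qok_simple(2) bnd] and F = vexe_ifq_False[OF qok_simple(2) bnd]
    and PT = vexe_ifq_True[OF qok_simple(1) bnd] and PF = vexe_ifq_False[OF qok_simple(1) bnd]
  show ?thesis
  proof (cases f)
    case (Atom p)
    have "vexe 16 decC s [s] (dcost M)" unfolding decC_def
      by (rule vexe_weaken[OF F[OF _ F[OF _ F[OF _ vexe_skip]]]])
        (use tag Atom in \<open>(simp add: dcost_def; linarith)+\<close>)
    then show ?thesis using Atom by blast
  next
    case (Neg g)
    note a = vexe_alt1[OF s(1-3) s(4)[unfolded Neg]]
    show ?thesis
    proof (cases w)
      case (Plus k)
      have "vexe 16 decC s (map (altst s xs ps n) [[Fm (Minus ?c) g]]) (dcost M)" unfolding decC_def
        by (rule vexe_weaken[OF T[OF _ PT]]) (use tag pol Neg Plus a in \<open>(simp add: dcost_def; linarith)+\<close>)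
      moreover have "decomp B w f [[Fm (Minus ?c) g]]"
        unfolding Neg Plus by (rule neg_plus[OF fr(2)])
      ultimately show ?thesis using Neg by (intro disjI2 exI[of _ "[[Fm (Minus ?c) g]]"]) (simp add: ok)
    next
      case (Minus k)
      have "vexe 16 decC s (map (altst s xs ps n) [[Fm (Plus ?c) g]]) (dcost M)" unfolding decC_def
        by (rule vexe_weaken[OF T[OF _ PF]]) (use tag pol Neg Minus a in \<open>(simp add: dcost_def; linarith)+\<close>)
      moreover have "decomp B w f [[Fm (Plus ?c) g]]"
        unfolding Neg Minus by (rule neg_minus[OF fr(1)])
      ultimately show ?thesis using Neg by (intro disjI2 exI[of _ "[[Fm (Plus ?c) g]]"]) (simp add: ok)
    qed
  next
    case (Imp g h)
    note a = vexe_alt2[OF s disjI1[OF Imp]]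
    show ?thesis
    proof (cases w)
      case (Plus k)
      let ?alts = "[[Fm (Minus ?c) g, Fm (Minus ?d) h], [Fm (Minus ?c) g, Fm (Plus ?d) h],
        [Fm (Plus ?c) g, Fm (Plus ?d) h]]"
      have "vexe 16 (Choose (alt2 m1 m2 []) (Choose (alt2 m1 p2 []) (alt2 p1 p2 []))) s
        ([altst s xs ps n ([Fm (Minus ?c) g, Fm (Minus ?d) h] @ [])] @
         [altst s xs ps n ([Fm (Minus ?c) g, Fm (Plus ?d) h] @ [])] @
         [altst s xs ps n ([Fm (Plus ?c) g, Fm (Plus ?d) h] @ [])]) (300 + 2 + 2)"
        by (intro vexe_choose vexe_weaken[OF a, of _ _ _ _ _ _ "300 + 2"] a) simp_all
      then have c: "vexe 16 (Choose (alt2 m1 m2 []) (Choose (alt2 m1 p2 []) (alt2 p1 p2 []))) s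
        (map (altst s xs ps n) ?alts) 304" by simp
      have "vexe 16 decC s (map (altst s xs ps n) ?alts) (dcost M)" unfolding decC_def
        by (rule vexe_weaken[OF F[OF _ T[OF _ PT[OF _ c]]]])
          (use tag pol Imp Plus in \<open>(simp add: dcost_def; linarith)+\<close>)
      moreover have "decomp B w f ?alts" unfolding Imp Plus by (rule imp_plus[OF fr(4)])
      ultimately show ?thesis using Imp by (intro disjI2 exI[of _ ?alts]) (simp add: ok)
    next
      case (Minus k)
      let ?alts = "[[Fm (Plus ?c) g, Fm (Minus ?d) h]]"
      have c: "vexe 16 (alt2 p1 m2 []) s [altst s xs ps n ([Fm (Plus ?c) g, Fm (Minus ?d) h] @ [])] 300"
        by (rule a) simp_all
      have "vexe 16 decC s (map (altst s xs ps n) ?alts) (dcost M)" unfolding decC_def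
        by (rule vexe_weaken[OF F[OF _ T[OF _ PF]]])
          (use tag pol Imp Minus c in \<open>(simp add: dcost_def; linarith)+\<close>)
      moreover have "decomp B w f ?alts" unfolding Imp Minus by (rule imp_minus[OF fr(3)])
      ultimately show ?thesis using Imp by (intro disjI2 exI[of _ ?alts]) (simp add: ok)
    qed
  next
    case (Ident g h)
    note a = vexe_alt2[OF s disjI2[OF Ident]]
    show ?thesis
    proof (cases w)
      case (Plus k)
      let ?alts = "[[Fm (Plus ?c) g, Fm (Plus ?d) h, Eq (Plus ?c) (Plus ?d)],
        [Fm (Minus ?c) g, Fm (Minus ?d) h, Eq (Minus ?c) (Minus ?d)]]"
      have "vexe 16 (Choose (alt2 p1 p2 [eqE p1 p2]) (alt2 m1 m2 [eqE m1 m2])) s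
        ([altst s xs ps n ([Fm (Plus ?c) g, Fm (Plus ?d) h] @ [Eq (Plus ?c) (Plus ?d)])] @
         [altst s xs ps n ([Fm (Minus ?c) g, Fm (Minus ?d) h] @ [Eq (Minus ?c) (Minus ?d)])]) (300 + 2)"
        by (intro vexe_choose a) simp_all
      then have c: "vexe 16 (Choose (alt2 p1 p2 [eqE p1 p2]) (alt2 m1 m2 [eqE m1 m2])) s
        (map (altst s xs ps n) ?alts) 302" by simp
      have "vexe 16 decC s (map (altst s xs ps n) ?alts) (dcost M)" unfolding decC_def
        by (rule vexe_weaken[OF F[OF _ F[OF _ T[OF _ PT[OF _ c]]]]])
          (use tag pol Ident Plus in \<open>(simp add: dcost_def; linarith)+\<close>)
      moreover have "decomp B w f ?alts" unfolding Ident Plus by (rule ident_plus[OF fr(4)])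
      ultimately show ?thesis using Ident by (intro disjI2 exI[of _ ?alts]) (simp add: ok)
    next
      case (Minus k)
      let ?alts = "[[Fm (Plus ?c) g, Fm (Plus ?d) h, Neq (Plus ?c) (Plus ?d)],
        [Fm (Plus ?c) g, Fm (Minus ?d) h], [Fm (Minus ?c) g, Fm (Plus ?d) h],
        [Fm (Minus ?c) g, Fm (Minus ?d) h, Neq (Minus ?c) (Minus ?d)]]"
      let ?com = "Choose (alt2 p1 p2 [neqE p1 p2]) (Choose (alt2 p1 m2 [])
         (Choose (alt2 m1 p2 []) (alt2 m1 m2 [neqE m1 m2])))"
      have "vexe 16 ?com s
        ([altst s xs ps n ([Fm (Plus ?c) g, Fm (Plus ?d) h] @ [Neq (Plus ?c) (Plus ?d)])] @
         [altst s xs ps n ([Fm (Plus ?c) g, Fm (Minus ?d) h] @ [])] @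
         [altst s xs ps n ([Fm (Minus ?c) g, Fm (Plus ?d) h] @ [])] @
         [altst s xs ps n ([Fm (Minus ?c) g, Fm (Minus ?d) h] @ [Neq (Minus ?c) (Minus ?d)])])
        (300 + 2 + 2 + 2)"
        by (intro vexe_choose vexe_weaken[OF a, of _ _ _ _ _ _ "300 + 2"]
            vexe_weaken[OF a, of _ _ _ _ _ _ "300 + 2 + 2"] a) simp_all
      then have c: "vexe 16 ?com s (map (altst s xs ps n) ?alts) 306" by simp
      have "vexe 16 decC s (map (altst s xs ps n) ?alts) (dcost M)" unfolding decC_def
        by (rule vexe_weaken[OF F[OF _ F[OF _ T[OF _ PF[OF _ c]]]]])
          (use tag pol Ident Minus in \<open>(simp add: dcost_def; linarith)+\<close>)
      moreover have "decomp B w f ?alts" unfolding Ident Minus by (rule ident_minus[OF fr(4)])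
      ultimately show ?thesis using Ident by (intro disjI2 exI[of _ ?alts]) (simp add: ok)
    qed
  qed
qed

subsection \<open>The main loop\<close>

text \<open>Asks whether the item in register 8 has a partner. A search returns a single witness, so
  a pair is found in two stages, register 8 before register 9.\<close>

definition "findQ = QEx 38 (XV 2) (pairQ 8 38)"

text \<open>Closure is tested first, as the other rules require it to be inapplicable; that
  decompositions precede equalities is a strategy. A round applies at most one rule, and none when
  it pops an atom.\<close>

definition bodyC :: com where
  "bodyC = ifq 40 closureQ
     (asgs 40 [(2, XN (cx (enc_item Bot)) (XV 2)), (6, XT), (5, XT)])
     (If 3
       (fnd 40 8 (XV 2) findQ ;;
        If 8
          (asgs 40 [(6, cx one_bit), (5, XT)])
          (fnd 40 9 (XV 2) (pairQ 8 9) ;;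
           asgs 40 [(2, XN (eqE (fstE 8) (fstE 9)) (XV 2))]))
       (asgs 40 [(7, XL (XV 3)), (3, XR (XV 3))] ;; decC))"

definition bcost :: "nat \<Rightarrow> nat" where
  "bcost M = qcost closureQ M + qcost (QEx 8 (XV 2) findQ) M + qcost (QEx 9 (XV 2) (pairQ 8 9)) M +
     dcost M + 1000"

section \<open>Size bounds and the invariant of the main loop\<close>

text \<open>An item holds two labels, of code size at most \<open>7 + 8 * m0\<close> each, or one
  label and a formula of code size at most \<open>X\<close>.\<close>

definition itemB :: "nat \<Rightarrow> nat \<Rightarrow> nat" where
  "itemB X m0 = 16 * m0 + X + 40"

text \<open>A branch has at most \<open>3 * m0 + 3\<close> items while the loop runs; the factor
  leaves room for one more, such as the final \<open>Bot\<close>.\<close>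

definition regB :: "nat \<Rightarrow> nat \<Rightarrow> nat" where
  "regB X m0 = (3 * m0 + 4) * (itemB X m0 + 1) + 8 * m0 + X + 30"

text \<open>Popping an atom lowers only the second term. A decomposition pops one formula and pushes
  at most two, which the weight 3 on the decrease of \<open>mu\<close> outbalances.\<close>

definition mm :: "nat \<Rightarrow> branch \<Rightarrow> item list \<Rightarrow> nat" where
  "mm N b ps = 3 * mu N b + length ps"

definition pending_ok :: "branch \<Rightarrow> item list \<Rightarrow> bool" where
  "pending_ok b ps \<longleftrightarrow> distinct ps \<and> set ps \<subseteq> (\<lambda>(w, f). Fm w f) ` und b \<and>
     (\<forall>w f. (w, f) \<in> und b \<longrightarrow> Fm w f \<in> set ps \<or> (\<exists>p. f = Atom p))"

definition sizes_ok :: "nat \<Rightarrow> branch \<Rightarrow> nat \<Rightarrow> bool" where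
  "sizes_ok X b n \<longleftrightarrow>
     (\<forall>w\<in>labels (set (items b)). idx w \<le> n \<and> tsize (enc_label w) \<le> 6 + tsize (enc_nat n)) \<and>
     (\<forall>w f. Fm w f \<in> set (items b) \<longrightarrow> tsize (enc_form f) \<le> X)"

text \<open>The sizes are bounded in amortised form, with \<open>m0\<close> a bound on
  \<open>mm\<close> at the start: a decomposition lengthens the counter by 8 nodes, a rule adds at
  most three items, and the drop of \<open>mm\<close> pays for both.\<close>

definition rep :: "nat \<Rightarrow> nat \<Rightarrow> nat \<Rightarrow> branch \<Rightarrow> item list \<Rightarrow> nat \<Rightarrow> state \<Rightarrow> bool" where
  "rep N X m0 b ps n s \<longleftrightarrow> binv N b \<and> \<not> closed_branch b \<and>
     s 2 = enc_items (rev (items b)) \<and> s 3 = enc_items ps \<and> s 4 = enc_nat n \<and> s 5 \<noteq> Tip \<and>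
     pending_ok b ps \<and> sizes_ok X b n \<and>
     tsize (enc_nat n) + 8 * mm N b ps \<le> 1 + 8 * m0 \<and>
     length (items b) + 3 * mm N b ps \<le> 3 + 3 * m0 \<and>
     (\<forall>r<16. r \<noteq> 2 \<longrightarrow> r \<noteq> 3 \<longrightarrow> r \<noteq> 4 \<longrightarrow> tsize (s r) \<le> regB X m0)"

definition finish :: "nat \<Rightarrow> nat \<Rightarrow> branch \<Rightarrow> state \<Rightarrow> bool" where
  "finish X m0 b s \<longleftrightarrow> s 5 = Tip \<and> s 2 = enc_items (rev (items b)) \<and>
     (s 6 \<noteq> Tip \<longleftrightarrow> \<not> closed_branch b) \<and> bounded 16 (regB X m0) s"

lemma tsize_enc_items:
  "(\<And>i. i \<in> set xs \<Longrightarrow> tsize (enc_item i) \<le> E) \<Longrightarrow> tsize (enc_items xs) \<le> 1 + length xs * (E + 1)"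
proof (induction xs)
  case (Cons i xs)
  have "tsize (enc_item i) \<le> E" using Cons.prems by simp
  moreover have "tsize (enc_items xs) \<le> 1 + length xs * (E + 1)" using Cons by simp
  ultimately show ?case by simp
qed simp

lemma item_bound:
  assumes "sizes_ok X b n" and "tsize (enc_nat n) \<le> 1 + 8 * m0" and "i \<in> set (items b)"
  shows "tsize (enc_item i) \<le> itemB X m0"
proof -
  have l: "tsize (enc_label w) \<le> 7 + 8 * m0" if "w \<in> item_labels i" for w
    using assms item_labelsI[OF assms(3) that] unfolding sizes_ok_def by fastforce
  show ?thesis
  proof (cases i)
    case (Fm w f)
    then have "tsize (enc_form f) \<le> X" using assms unfolding sizes_ok_def by blast
    then show ?thesis using Fm l[of w] by (simp add: itemB_def)
  next
    case (Eq w v)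
    then show ?thesis using l[of w] l[of v] by (simp add: itemB_def)
  next
    case (Neq w v)
    then show ?thesis using l[of w] l[of v] by (simp add: itemB_def)
  next
    case Bot
    then show ?thesis by (simp add: itemB_def)
  qed
qed

lemma items_bound:
  assumes "sizes_ok X b n" and "tsize (enc_nat n) \<le> 1 + 8 * m0" and "set xs \<subseteq> set (items b)"
    and "length xs \<le> 3 + 3 * m0"
  shows "tsize (enc_items xs) + itemB X m0 + 1 \<le> regB X m0"
proof -
  have "tsize (enc_items xs) \<le> 1 + length xs * (itemB X m0 + 1)"
    by (rule tsize_enc_items) (use item_bound[OF assms(1,2)] assms(3) in blast)
  also have "length xs * (itemB X m0 + 1) \<le> (3 + 3 * m0) * (itemB X m0 + 1)"
    using assms(4) by (rule mult_le_mono1)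
  finally show ?thesis by (simp add: regB_def algebra_simps)
qed

lemma rep_pending_subset:
  assumes "pending_ok b ps"
  shows "set ps \<subseteq> set (items b)"
proof -
  have "(\<lambda>(w, f). Fm w f) ` und b \<subseteq> set (items b)" by (auto simp: und_def)
  then show ?thesis using assms unfolding pending_ok_def by blast
qed

lemma rep_bounded:
  assumes r: "rep N X m0 b ps n s"
  shows "bounded 16 (regB X m0) s"
proof -
  have n: "tsize (enc_nat n) \<le> 1 + 8 * m0" and l: "length (items b) \<le> 3 + 3 * m0"
    and sz: "sizes_ok X b n" and p: "pending_ok b ps" using r by (simp_all add: rep_def)
  \<comment> \<open>The stack has distinct entries, all on the branch, and so inherits the bound for
    the branch.\<close>
  have "length ps = card (set ps)" using p by (simp add: pending_ok_def distinct_card)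
  also have "\<dots> \<le> card (set (items b))" using rep_pending_subset[OF p] by (intro card_mono) auto
  also have "\<dots> \<le> length (items b)" by (rule card_length)
  finally have "length ps \<le> 3 + 3 * m0" using l by simp
  then have "tsize (s 3) \<le> regB X m0" "tsize (s 2) \<le> regB X m0"
    using items_bound[OF sz n rep_pending_subset[OF p]] items_bound[OF sz n, of "rev (items b)"] l r
    by (simp_all add: rep_def)
  moreover have "tsize (s 4) \<le> regB X m0" using n r by (simp add: rep_def regB_def)
  moreover have "1 \<le> regB X m0" by (simp add: regB_def)
  ultimately show ?thesis using r unfolding rep_def bounded_def by metis
qed

lemma bounded_upd: "bounded K m s \<Longrightarrow> tsize t \<le> m \<Longrightarrow> bounded K m (s(r := t))"
  by (simp add: bounded_def)

lemma qok_queries: "qok 16 40 closureQ" "qok 16 40 findQ" "qok 16 40 (pairQ 8 9)"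
  by (simp_all add: qok_def qry_defs findQ_def insert_Diff_if)

lemma filter_is_Fm: "set (filter is_Fm a) = (\<lambda>(w, f). Fm w f) ` fms (set a)"
proof -
  have "is_Fm i \<longleftrightarrow> (\<exists>w f. i = Fm w f)" for i by (cases i) auto
  then show ?thesis by (auto simp: image_iff)
qed

lemma rep_decomposition:
  assumes r: "rep N X m0 b (Fm w f # ps) n s" and d: "decomp (set (items b)) w f alts"
    and a: "a \<in> set alts" and ok: "alt_ok n f a" and ex: "expand b bs"
    and b': "b' = \<lparr>items = items b @ a, decomposed = insert (w, f) (decomposed b)\<rparr>" "b' \<in> set bs"
    and s': "s' = altst (s(7 := t, 3 := t')) (rev (items b)) ps n a" and t: "tsize t \<le> regB X m0"
  shows "rep N X m0 b' (rev (filter is_Fm a) @ ps) (nxt (nxt n)) s'"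
    and "mm N b' (rev (filter is_Fm a) @ ps) < mm N b (Fm w f # ps)"
proof -
  have inv: "binv N b" and po: "pending_ok b (Fm w f # ps)" and sz: "sizes_ok X b n"
    and nc: "\<not> closed_branch b" using r by (simp_all add: rep_def)
  have und: "(w, f) \<in> und b" using po by (auto simp: pending_ok_def)
  note u = und_decomposition[OF inv d a und]
  have step: "binv N b'" "mu N b' < mu N b" using expand_step[OF ex inv b'(2)] by auto
  have la: "length a \<le> 3" "length (filter is_Fm a) \<le> 2" and da: "distinct (filter is_Fm a)"
    using ok by (simp_all add: alt_ok_def)
  have m: "mm N b' (rev (filter is_Fm a) @ ps) + 2 \<le> mm N b (Fm w f # ps)"
    using step(2) la(2) by (simp add: mm_def)
  then show "mm N b' (rev (filter is_Fm a) @ ps) < mm N b (Fm w f # ps)" by simp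
  have "\<not> closed_branch b'" using nc decomp_alt(5)[OF d a] by (simp add: closed_branch_def b'(1))
  moreover have "pending_ok b' (rev (filter is_Fm a) @ ps)"
  proof -
    have sub: "set ps \<subseteq> (\<lambda>(w, f). Fm w f) ` und b" "Fm w f \<notin> set ps" "distinct ps"
      using po by (simp_all add: pending_ok_def)
    \<comment> \<open>New and pending formulas differ because their labels do.\<close>
    have "set (filter is_Fm a) \<inter> set ps = {}" using sub(1) u(2) unfolding filter_is_Fm by auto
    moreover have "set ps \<subseteq> (\<lambda>(w, f). Fm w f) ` und b'"
      using sub(1,2) unfolding b'(1) u(1) by auto
    moreover have "set (filter is_Fm a) \<subseteq> (\<lambda>(w, f). Fm w f) ` und b'"
      unfolding b'(1) u(1) filter_is_Fm by auto
    moreover have "Fm v g \<in> set (filter is_Fm a) \<or> Fm v g \<in> set ps \<or> (\<exists>p. g = Atom p)"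
      if "(v, g) \<in> und b'" for v g
    proof (cases "(v, g) \<in> fms (set a)")
      case True
      then show ?thesis unfolding filter_is_Fm by force
    next
      case False
      then have "(v, g) \<in> und b" "(v, g) \<noteq> (w, f)" using that unfolding b'(1) u(1) by auto
      then have "Fm v g \<in> set (Fm w f # ps) \<or> (\<exists>p. g = Atom p)"
        using po unfolding pending_ok_def by blast
      then show ?thesis using \<open>(v, g) \<noteq> (w, f)\<close> by auto
    qed
    ultimately show ?thesis using da sub(3)
      unfolding pending_ok_def set_append set_rev distinct_append distinct_rev Un_iff by blast
  qed
  moreover have "sizes_ok X b' (nxt (nxt n))"
  proof -
    have fX: "tsize (enc_form f) \<le> X" using und sz unfolding und_def sizes_ok_def by force
    have "idx v \<le> nxt (nxt n) \<and> tsize (enc_label v) \<le> 6 + tsize (enc_nat (nxt (nxt n)))"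
      if "v \<in> labels (set (items b))" for v
    proof -
      have "idx v \<le> n" "tsize (enc_label v) \<le> 6 + tsize (enc_nat n)"
        using that sz unfolding sizes_ok_def by blast+
      then show ?thesis using nxt_greater[of n] nxt_greater[of "nxt n"] by (simp add: enc_nat_nxt)
    qed
    moreover have "tsize (enc_form g) \<le> X" if "Fm v g \<in> set a" for v g
      using ok fX that unfolding alt_ok_def by (meson order_trans)
    ultimately show ?thesis using ok sz unfolding sizes_ok_def alt_ok_def b'(1) by auto
  qed
  moreover have "tsize (enc_nat (nxt (nxt n))) + 8 * mm N b' (rev (filter is_Fm a) @ ps) \<le> 1 + 8 * m0"
    using r m by (simp add: rep_def enc_nat_nxt)
  moreover have "length (items b') + 3 * mm N b' (rev (filter is_Fm a) @ ps) \<le> 3 + 3 * m0"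
    using r m la(1) by (simp add: rep_def b'(1))
  moreover have "s' 2 = enc_items (rev (items b'))" "s' 3 = enc_items (rev (filter is_Fm a) @ ps)"
    "s' 4 = enc_nat (nxt (nxt n))" "s' 5 \<noteq> Tip"
    using r by (simp_all add: s' altst_def b'(1) rep_def)
  moreover have "\<forall>r<16. r \<noteq> 2 \<longrightarrow> r \<noteq> 3 \<longrightarrow> r \<noteq> 4 \<longrightarrow> tsize (s' r) \<le> regB X m0"
    using r t by (simp add: s' altst_def rep_def)
  ultimately show "rep N X m0 b' (rev (filter is_Fm a) @ ps) (nxt (nxt n)) s'"
    using step(1) unfolding rep_def by blast
qed

text \<open>A branch that has just received \<open>Bot\<close> is finished at once, as the same
  round clears register 5; every other child remains under the loop invariant with a smaller
  measure.\<close>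

definition continues :: "nat \<Rightarrow> nat \<Rightarrow> nat \<Rightarrow> nat \<Rightarrow> branch \<Rightarrow> state \<Rightarrow> bool" where
  "continues N X m0 k b s \<longleftrightarrow> (\<exists>ps n. rep N X m0 b ps n s \<and> mm N b ps < k) \<or>
     closed_branch b \<and> finish X m0 b s"

text \<open>The disjuncts are the possible rounds: nothing is applicable and the loop ends, an atom
  is popped while the branch stays the same, or a rule is applied with one outcome per
  alternative.\<close>

lemma vexe_body:
  assumes r: "rep N X m0 b ps n s"
  shows "(\<exists>s'. vexe 16 bodyC s [s'] (bcost (regB X m0)) \<and> finish X m0 b s' \<and> fully_expanded b) \<or>
    (\<exists>s' ps'. vexe 16 bodyC s [s'] (bcost (regB X m0)) \<and> rep N X m0 b ps' n s' \<and>
       mm N b ps' < mm N b ps) \<or>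
    (\<exists>bs ss. expand b bs \<and> vexe 16 bodyC s ss (bcost (regB X m0)) \<and>
       list_all2 (continues N X m0 (mm N b ps)) bs ss)"
proof -
  let ?M = "regB X m0" and ?B = "set (items b)"
  note bnd = rep_bounded[OF r]
  have inv: "binv N b" and nc: "\<not> closed_branch b" and s2: "s 2 = enc_items (rev (items b))"
    and s3: "s 3 = enc_items ps" and s4: "s 4 = enc_nat n" and s5: "s 5 \<noteq> Tip"
    and po: "pending_ok b ps" and sz: "sizes_ok X b n"
    and n0: "tsize (enc_nat n) + 8 * mm N b ps \<le> 1 + 8 * m0"
    and l0: "length (items b) + 3 * mm N b ps \<le> 3 + 3 * m0"
    and regs: "\<forall>r<16. r \<noteq> 2 \<longrightarrow> r \<noteq> 3 \<longrightarrow> r \<noteq> 4 \<longrightarrow> tsize (s r) \<le> ?M"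
    using r by (simp_all add: rep_def)
  have els: "els (s 2) = map enc_item (rev (items b))" by (simp add: s2)
  have cl: "sem closureQ s \<longleftrightarrow> closure_rule ?B" using sem_closureQ[where s = s, OF els] by simp
  have M1: "11 \<le> ?M" by (simp add: regB_def)
  have ib: "tsize (enc_items (rev (items b))) + itemB X m0 + 1 \<le> ?M"
    by (rule items_bound[OF sz]) (use n0 l0 in auto)
  show ?thesis
  proof (cases "closure_rule ?B")
    case True
    define s' where "s' = s(2 := enc_items (Bot # rev (items b)), 6 := Tip, 5 := Tip)"
    let ?b = "b\<lparr>items := items b @ [Bot]\<rparr>"
    let ?as = "[(2, XN (cx (enc_item Bot)) (XV 2)), (6, XT), (5, XT)]"
    have u: "upds ?as s = s'" by (simp add: s'_def s2)
    have "vexe 16 (asgs 40 ?as) s [s'] (acost ?as)"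
      unfolding u[symmetric] by (rule vexe_asgs) simp_all
    then have "vexe 16 bodyC s [s'] (qcost closureQ ?M + acost ?as + 2)"
      unfolding bodyC_def using cl True by (intro vexe_ifq_True qok_queries bnd) simp_all
    then have v: "vexe 16 bodyC s [s'] (bcost ?M)" by (rule vexe_weaken) (simp add: bcost_def)
    have "bounded 16 ?M s'" unfolding s'_def
      by (intro bounded_upd bnd) (use ib M1 in \<open>simp_all add: itemB_def\<close>)
    then have "finish X m0 ?b s'" by (simp add: finish_def s'_def closed_branch_def)
    then have "continues N X m0 (mm N b ps) ?b s'" by (simp add: continues_def closed_branch_def)
    then show ?thesis using closure[OF nc True] v by (intro disjI2 exI[of _ "[?b]"] exI[of _ "[s']"]) simp
  next
    case False
    have body: "vexe 16 bodyC s ts (bcost ?M)"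
      if "vexe 16 (If 3 (fnd 40 8 (XV 2) findQ ;; If 8 (asgs 40 [(6, cx one_bit), (5, XT)])
          (fnd 40 9 (XV 2) (pairQ 8 9) ;; asgs 40 [(2, XN (eqE (fstE 8) (fstE 9)) (XV 2))]))
          (asgs 40 [(7, XL (XV 3)), (3, XR (XV 3))] ;; decC)) s ts k"
        "k \<le> qcost (QEx 8 (XV 2) findQ) ?M + qcost (QEx 9 (XV 2) (pairQ 8 9)) ?M + dcost ?M + 900" for ts k
    proof -
      have "vexe 16 bodyC s ts (qcost closureQ ?M + k + 2)"
        unfolding bodyC_def using cl False by (intro vexe_ifq_False qok_queries bnd that(1)) simp_all
      then show ?thesis by (rule vexe_weaken) (use that(2) in \<open>simp add: bcost_def\<close>)
    qed
    show ?thesis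
    proof (cases ps)
      case (Cons i ps')
      obtain w f where i: "i = Fm w f" and wf: "(w, f) \<in> und b"
        using po Cons by (auto simp: pending_ok_def)
      note Cons = Cons[unfolded i]
      define t where "t = enc_item (Fm w f)"
      define s1 where "s1 = s(7 := t, 3 := enc_items ps')"
      have mem: "Fm w f \<in> ?B" "(w, f) \<notin> decomposed b" using wf by (simp_all add: und_def)
      have tM: "tsize t \<le> ?M"
        using item_bound[OF sz _ mem(1), of m0] n0 ib by (simp add: t_def)
      have s3': "s 3 = Node t (enc_items ps')" using s3 Cons by (simp add: t_def)
      have s3M: "tsize (s 3) \<le> ?M" using bnd unfolding bounded_def by simp
      have b1: "bounded 16 ?M s1" unfolding s1_def
        by (intro bounded_upd bnd tM) (use s3M s3' in simp)
      let ?as = "[(7, XL (XV 3)), (3, XR (XV 3))]"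
      have u: "upds ?as s = s1" using s3' by (simp add: s1_def)
      have as: "vexe 16 (asgs 40 ?as) s [s1] (acost ?as)"
        unfolding u[symmetric] by (rule vexe_asgs) simp_all
      have lift: "vexe 16 bodyC s ts (bcost ?M)" if "vexe 16 decC s1 ts (dcost ?M)" for ts
        by (rule body[OF vexe_if_node[OF _ _ vexe_sq1[OF as that]]]) (use s3' in simp_all)
      have "(\<exists>p. f = Atom p) \<and> vexe 16 decC s1 [s1] (dcost ?M) \<or>
        (\<exists>alts. decomp ?B w f alts \<and>
          vexe 16 decC s1 (map (altst s1 (rev (items b)) ps' n) alts) (dcost ?M) \<and>
          (\<forall>a\<in>set alts. alt_ok n f a))"
        by (rule vexe_decC[OF b1]) (use s2 s4 sz in \<open>simp_all add: s1_def t_def sizes_ok_def\<close>)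
      then show ?thesis
      proof (elim disjE conjE exE)
        fix p assume f: "f = Atom p" and v: "vexe 16 decC s1 [s1] (dcost ?M)"
        have "pending_ok b ps'" using po f Cons by (auto simp: pending_ok_def)
        then have "rep N X m0 b ps' n s1"
          using r tM Cons by (auto simp: rep_def s1_def mm_def)
        moreover have "mm N b ps' < mm N b ps" by (simp add: mm_def Cons)
        ultimately show ?thesis using lift[OF v] by blast
      next
        fix alts assume d: "decomp ?B w f alts" and
          v: "vexe 16 decC s1 (map (altst s1 (rev (items b)) ps' n) alts) (dcost ?M)" and
          ok: "\<forall>a\<in>set alts. alt_ok n f a"
        define bs where
          "bs = map (\<lambda>a. \<lparr>items = items b @ a, decomposed = insert (w, f) (decomposed b)\<rparr>) alts"
        have ex: "expand b bs" unfolding bs_def by (rule decomposition[OF nc False mem d])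
        have "continues N X m0 (mm N b ps)
            \<lparr>items = items b @ a, decomposed = insert (w, f) (decomposed b)\<rparr>
            (altst s1 (rev (items b)) ps' n a)" if a: "a \<in> set alts" for a
        proof -
          have "\<lparr>items = items b @ a, decomposed = insert (w, f) (decomposed b)\<rparr> \<in> set bs"
            using a by (simp add: bs_def)
          from rep_decomposition[OF r[unfolded Cons] d a _ ex refl this _ tM, of _ "enc_items ps'"]
          show ?thesis using ok a unfolding continues_def s1_def Cons by blast
        qed
        then have "list_all2 (continues N X m0 (mm N b ps)) bs (map (altst s1 (rev (items b)) ps' n) alts)"
          by (auto simp: bs_def list_all2_conv_all_nth)
        then show ?thesis using ex lift[OF v] by blast
      qed
    next
      case Nil
      have s3n: "s 3 = Tip" using s3 Nil by simp
      have lab: "labels ?B = {w. \<exists>f. Fm w f \<in> ?B}"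
      proof -
        have "labels ?B = fst ` fms ?B" using inv unfolding binv_def by blast
        also have "\<dots> = {w. \<exists>f. Fm w f \<in> ?B}" unfolding fms_def by force
        finally show ?thesis .
      qed
      define s8 where "s8 = s(8 := fval 8 (XV 2) findQ s)"
      have f8: "vexe 16 (fnd 40 8 (XV 2) findQ) s [s8] (qcost (QEx 8 (XV 2) findQ) ?M + 3)"
        unfolding s8_def by (rule vexe_fnd[OF qok_queries(2) _ _ bnd]) simp_all
      have semP: "sem (pairQ x z) s' \<longleftrightarrow> (\<exists>w v. (\<exists>f. p = Fm w f) \<and> (\<exists>g. q = Fm v g) \<and>
          eq_rule ?B w v \<and> Eq w v \<notin> ?B)"
        if "els (s' 2) = map enc_item (rev (items b))" "x < 20 \<or> 33 \<le> x" "x \<noteq> 2" "z < 20 \<or> 33 \<le> z" "z \<noteq> 2"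
          "s' x = enc_item p" "s' z = enc_item q" "p \<in> ?B" "q \<in> ?B" for s' x z p q
      proof -
        \<comment> \<open>A label has a unique formula, so an instance found for the labels is an
          instance for the given items.\<close>
        have uniq: "f = f'" if "Fm w f \<in> ?B" "Fm w f' \<in> ?B" for w f f'
        proof -
          have "inj_on fst (fms ?B)" using inv unfolding binv_def by blast
          from inj_onD[OF this, of "(w, f)" "(w, f')"] that show ?thesis by simp
        qed
        have p: "sem (pairQ x z) s' \<longleftrightarrow> (\<exists>w f v g. p = Fm w f \<and> q = Fm v g \<and> Eq w v \<notin> ?B \<and>
    rule_cond ?B w f v g)"
          using sem_pairQ[where s = s', OF that(1-7)] by simp
        show ?thesis
        proof
          assume "sem (pairQ x z) s'"
          then show "\<exists>w v. (\<exists>f. p = Fm w f) \<and> (\<exists>g. q = Fm v g) \<and> eq_rule ?B w v \<and> Eq w v \<notin> ?B"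
            unfolding p pairQ_eq_rule[OF lab] using that(8,9) by blast
        next
          assume "\<exists>w v. (\<exists>f. p = Fm w f) \<and> (\<exists>g. q = Fm v g) \<and> eq_rule ?B w v \<and> Eq w v \<notin> ?B"
          then obtain w v f g where *: "p = Fm w f" "q = Fm v g" "eq_rule ?B w v" "Eq w v \<notin> ?B" by blast
          from *(3)[unfolded pairQ_eq_rule[OF lab]] obtain f' g' where
            fg: "Fm w f' \<in> ?B" "Fm v g' \<in> ?B" "rule_cond ?B w f' v g'" by blast
          have "f' = f" "g' = g" using uniq fg(1,2) that(8,9) * by blast+
          then show "sem (pairQ x z) s'" unfolding p using * fg(3) by blast
        qed
      qed
      have semF: "sem findQ (s(8 := enc_item p)) \<longleftrightarrow> (\<exists>q\<in>?B. \<exists>w v. (\<exists>f. p = Fm w f) \<and> (\<exists>g. q = Fm v g) \<and>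
          eq_rule ?B w v \<and> Eq w v \<notin> ?B)" if "p \<in> ?B" for p
      proof -
        have "els ((s(8 := enc_item p)) 2) = map enc_item (rev (items b))" using els by simp
        then have "sem findQ (s(8 := enc_item p)) \<longleftrightarrow>
          (\<exists>q\<in>?B. sem (pairQ 8 38) (s(8 := enc_item p, 38 := enc_item q)))"
          unfolding findQ_def by (simp add: els)
        also have "\<dots> \<longleftrightarrow> (\<exists>q\<in>?B. \<exists>w v. (\<exists>f. p = Fm w f) \<and> (\<exists>g. q = Fm v g) \<and>
          eq_rule ?B w v \<and> Eq w v \<notin> ?B)"
          by (rule bex_cong[OF refl], rule semP) (use els that in simp_all)
        finally show ?thesis .
      qed
      show ?thesis
      proof (cases "\<exists>w v. eq_rule ?B w v \<and> Eq w v \<notin> ?B")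
        case no: False
        have "\<not> (\<exists>x\<in>set (els (ev (XV 2) s)). sem findQ (s(8 := x)))"
        proof
          assume "\<exists>x\<in>set (els (ev (XV 2) s)). sem findQ (s(8 := x))"
          then obtain p where "p \<in> ?B" "sem findQ (s(8 := enc_item p))" by (auto simp: els)
          then show False using semF no by blast
        qed
        then have f0: "fval 8 (XV 2) findQ s = Tip" by (rule fval_not_found)
        let ?as = "[(6, cx one_bit), (5, XT)]"
        define s' where "s' = s8(6 := one_bit, 5 := Tip)"
        have u: "upds ?as s8 = s'" by (simp add: s'_def)
        have as: "vexe 16 (asgs 40 ?as) s8 [s'] (acost ?as)"
          unfolding u[symmetric] by (rule vexe_asgs) simp_all
        have "s8 8 = Tip" by (simp add: s8_def f0)
        have v: "vexe 16 bodyC s [s'] (bcost ?M)"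
          by (rule body[OF vexe_if_tip[OF _ _ vexe_sq1[OF f8 vexe_if_tip[OF _ _ as]]]])
            (use s3n \<open>s8 8 = Tip\<close> in simp_all)
        have "bounded 16 ?M s'" unfolding s'_def s8_def f0
          by (intro bounded_upd bnd) (use M1 in simp_all)
        then have dn: "finish X m0 b s'" using nc s2 by (simp add: finish_def s'_def s8_def)
        have "\<not> expand b bs" for bs
        proof
          assume "expand b bs"
          then show False
          proof cases
            case closure
            then show False using False by blast
          next
            case (decomposition w f alts)
            \<comment> \<open>An empty stack means that only atoms are left undecomposed.\<close>
            then have "\<exists>p. f = Atom p" using po Nil unfolding pending_ok_def und_def by auto
            then show False using decomposition(6) by (auto elim: decomp.cases)
          next
            case (equality w v)
            then show False using no by blast
          qed
        qed
        then have "fully_expanded b" by (simp add: fully_expanded_def)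
        with v dn show ?thesis by blast
      next
        case True
        then obtain w v where wv: "eq_rule ?B w v" "Eq w v \<notin> ?B" by blast
        then obtain f g where fg: "Fm w f \<in> ?B" "Fm v g \<in> ?B"
          using eq_rule_labels[OF wv(1)] lab by blast
        have "sem findQ (s(8 := enc_item (Fm w f)))" using semF[OF fg(1)] fg wv by blast
        then have ex8: "\<exists>x\<in>set (els (ev (XV 2) s)). sem findQ (s(8 := x))"
          unfolding ev.simps els set_map set_rev using fg(1) by blast
        note found8 = fval_found[where s = s, OF ex8, unfolded ev.simps els set_map set_rev]
        from found8(1) obtain p where p0: "fval 8 (XV 2) findQ s = enc_item p" "p \<in> ?B"
          by (rule imageE)
        have p: "p \<in> ?B" "s8 = s(8 := enc_item p)" "sem findQ (s(8 := enc_item p))"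
          using p0 found8(2) by (simp_all add: s8_def)
        have els8: "els (s8 2) = map enc_item (rev (items b))" using els p(2) by simp
        have pM: "tsize (enc_item p) \<le> ?M" using item_bound[OF sz _ p(1), of m0] n0 ib by simp
        have b8: "bounded 16 ?M s8" unfolding p(2) by (rule bounded_upd[OF bnd pM])
        from p(3)[unfolded semF[OF p(1)]] obtain q w v f g where
          q: "q \<in> ?B" "p = Fm w f" "q = Fm v g" "eq_rule ?B w v" "Eq w v \<notin> ?B" by blast
        have semP9: "sem (pairQ 8 9) (s8(9 := enc_item q)) \<longleftrightarrow>
            (\<exists>w v. (\<exists>f. p = Fm w f) \<and> (\<exists>g. q = Fm v g) \<and> eq_rule ?B w v \<and> Eq w v \<notin> ?B)"
          if "q \<in> ?B" for q
          by (rule semP) (use els8 p that in simp_all)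
        have "sem (pairQ 8 9) (s8(9 := enc_item q))" using semP9[OF q(1)] q by blast
        then have ex9: "\<exists>x\<in>set (els (ev (XV 2) s8)). sem (pairQ 8 9) (s8(9 := x))"
          unfolding ev.simps els8 set_map set_rev using q(1) by blast
        define s9 where "s9 = s8(9 := fval 9 (XV 2) (pairQ 8 9) s8)"
        note found9 = fval_found[where s = s8, OF ex9, unfolded ev.simps els8 set_map set_rev]
        from found9(1) obtain q' where q'0: "fval 9 (XV 2) (pairQ 8 9) s8 = enc_item q'" "q' \<in> ?B"
          by (rule imageE)
        have q': "q' \<in> ?B" "s9 = s8(9 := enc_item q')" "sem (pairQ 8 9) (s8(9 := enc_item q'))"
          using q'0 found9(2) by (simp_all add: s9_def)
        \<comment> \<open>The partner \<open>q'\<close> found now may differ from the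
          \<open>q\<close> that justified register 8; any partner yields a rule instance.\<close>
        from q'(3)[unfolded semP9[OF q'(1)]] obtain v' g' where
          v': "q' = Fm v' g'" "eq_rule ?B w v'" "Eq w v' \<notin> ?B" using q(2) by blast
        have f9: "vexe 16 (fnd 40 9 (XV 2) (pairQ 8 9)) s8 [s9] (qcost (QEx 9 (XV 2) (pairQ 8 9)) ?M + 3)"
          unfolding s9_def by (rule vexe_fnd[OF qok_queries(3) _ _ b8]) simp_all
        let ?as = "[(2, XN (eqE (fstE 8) (fstE 9)) (XV 2))]"
        define s' where "s' = s9(2 := enc_items (Eq w v' # rev (items b)))"
        have u: "upds ?as s9 = s'"
          using p(2) q(2) q'(2) v'(1) s2 by (simp add: s'_def eqE_def fstE_def)
        have as: "vexe 16 (asgs 40 ?as) s9 [s'] (acost ?as)"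
          unfolding u[symmetric] by (rule vexe_asgs) (simp_all add: eqE_def fstE_def)
        have "s8 8 \<noteq> Tip" using p(2) q(2) by simp
        have v: "vexe 16 bodyC s [s'] (bcost ?M)"
          by (rule body[OF vexe_if_tip[OF _ _ vexe_sq1[OF f8 vexe_if_node[OF _ _ vexe_sq1[OF f9 as]]]]])
            (use s3n \<open>s8 8 \<noteq> Tip\<close> in \<open>simp_all add: eqE_def fstE_def\<close>)
        let ?b = "b\<lparr>items := items b @ [Eq w v']\<rparr>"
        have ex: "expand b [?b]" by (rule equality[OF nc False v'(2,3)])
        have step: "binv N ?b" "mu N ?b < mu N b" using expand_step[OF ex inv] by auto
        have und: "und ?b = und b" by (auto simp: und_def)
        have labs: "labels (set (items ?b)) = labels ?B" using eq_rule_labels[OF v'(2)] by auto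
        have "sizes_ok X ?b n" using sz unfolding sizes_ok_def labs by simp
        moreover have "pending_ok ?b []" using po Nil unfolding pending_ok_def und by simp
        moreover have "tsize (enc_item q') \<le> ?M" using item_bound[OF sz _ q'(1), of m0] n0 ib by simp
        ultimately have "rep N X m0 ?b [] n s'"
          using step r pM nc Nil unfolding rep_def s'_def q'(2) p(2)
          by (simp add: closed_branch_def mm_def)
        moreover have "mm N ?b [] < mm N b ps" using step(2) Nil by (simp add: mm_def)
        ultimately have "continues N X m0 (mm N b ps) ?b s'" unfolding continues_def by blast
        then show ?thesis using ex v by (intro disjI2 exI[of _ "[?b]"] exI[of _ "[s']"]) simp
      qed
    qed
  qed
qed

section \<open>From runs of the loop to tableaux\<close>

lemma list_all2_ex:
  assumes "list_all2 (\<lambda>x y. \<exists>z. P x y z) xs ys"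
  shows "\<exists>zs. length zs = length xs \<and> (\<forall>i<length xs. P (xs ! i) (ys ! i) (zs ! i))"
proof -
  have "\<forall>i<length xs. \<exists>z. P (xs ! i) (ys ! i) z" using assms by (simp add: list_all2_conv_all_nth)
  then obtain f where "\<forall>i<length xs. P (xs ! i) (ys ! i) (f i)" by metis
  then show ?thesis by (intro exI[of _ "map f [0..<length xs]"]) simp
qed

definition represents :: "nat \<Rightarrow> nat \<Rightarrow> branch \<Rightarrow> tree_tab \<Rightarrow> state list \<Rightarrow> bool" where
  "represents X m0 b t ss \<longleftrightarrow> tableau t \<and> root t = b \<and> (\<forall>b'\<in>branches t. fully_expanded b') \<and>
     (\<forall>s'\<in>set ss. \<exists>b'\<in>branches t. finish X m0 b' s') \<and>
     (\<forall>b'\<in>branches t. \<exists>s'\<in>set ss. finish X m0 b' s')"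

lemma represents_leaf:
  "finish X m0 b s \<Longrightarrow> fully_expanded b \<Longrightarrow> represents X m0 b (Tab b []) [s]"
  by (simp add: represents_def tableau.leaf)

lemma represents_node:
  assumes ex: "expand b bs" and len: "length ts = length bs" "length uss = length bs"
    and sub: "\<And>i. i < length bs \<Longrightarrow> represents X m0 (bs ! i) (ts ! i) (uss ! i)"
  shows "represents X m0 b (Tab b ts) (concat uss)"
proof -
  have roots: "map root ts = bs"
    by (rule nth_equalityI) (use len sub in \<open>auto simp: represents_def\<close>)
  have "tableau t" if "t \<in> set ts" for t
    using that len sub unfolding represents_def by (metis in_set_conv_nth)
  then have tab: "tableau (Tab b ts)" using ex roots by (intro tableau.node) auto
  have "ts \<noteq> []" using expand_nonempty[OF ex] len by auto
  have "set ts = (\<lambda>i. ts ! i) ` {..<length bs}" using len by (auto simp: set_conv_nth)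
  then have br: "branches (Tab b ts) = (\<Union>i<length bs. branches (ts ! i))"
    using \<open>ts \<noteq> []\<close> by simp
  have "set uss = (\<lambda>i. uss ! i) ` {..<length bs}" using len by (auto simp: set_conv_nth)
  then have st: "set (concat uss) = (\<Union>i<length bs. set (uss ! i))" by simp
  show ?thesis unfolding represents_def br st
  proof (intro conjI ballI tab)
    fix b' assume "b' \<in> (\<Union>i<length bs. branches (ts ! i))"
    then obtain i where i: "i < length bs" "b' \<in> branches (ts ! i)" by blast
    then show "fully_expanded b'" using sub[OF i(1)] unfolding represents_def by blast
    show "\<exists>s'\<in>\<Union>i<length bs. set (uss ! i). finish X m0 b' s'"
      using sub[OF i(1)] i unfolding represents_def by blast
  next
    fix s' assume "s' \<in> (\<Union>i<length bs. set (uss ! i))"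
    then obtain i where i: "i < length bs" "s' \<in> set (uss ! i)" by blast
    then show "\<exists>b'\<in>\<Union>i<length bs. branches (ts ! i). finish X m0 b' s'"
      using sub[OF i(1)] unfolding represents_def by blast
  qed simp
qed

text \<open>The tableau grows with the run: a round that applies a rule becomes a node, whose
  subtrees come from the induction hypothesis for its outcomes. The \<open>Suc\<close> pays for the
  last round, which applies no rule.\<close>

lemma vexe_loop:
  "rep N X m0 b ps n s \<Longrightarrow> \<exists>ss t. vexe 16 (While 5 bodyC) s ss
     (Suc (mm N b ps) * (bcost (regB X m0) + 2) + 1) \<and> represents X m0 b t ss"
proof (induction "mm N b ps" arbitrary: b ps n s rule: less_induct)
  case less
  define C where "C = bcost (regB X m0)"
  have s5: "s 5 \<noteq> Tip" using less.prems by (simp add: rep_def)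
  have le: "C + (Suc k * (C + 2) + 1) + 2 \<le> Suc (mm N b ps) * (C + 2) + 1" if "k < mm N b ps" for k
  proof -
    have "C + (Suc k * (C + 2) + 1) + 2 = Suc (Suc k) * (C + 2) + 1" by simp
    also have "\<dots> \<le> Suc (mm N b ps) * (C + 2) + 1"
      using that by (intro add_mono mult_le_mono) auto
    finally show ?thesis .
  qed
  from vexe_body[OF less.prems, folded C_def] show ?case unfolding C_def[symmetric]
  proof (elim disjE exE conjE)
    fix s' assume v: "vexe 16 bodyC s [s'] C" and d: "finish X m0 b s'" and f: "fully_expanded b"
    have "vexe 16 (While 5 bodyC) s' [s'] 1"
      by (rule vexe_while_end) (use d in \<open>simp_all add: finish_def\<close>)
    then have "vexe 16 (While 5 bodyC) s (concat [[s']]) (C + 1 + 2)"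
      by (intro vexe_while_step[where s = s, OF _ s5 v]) simp_all
    then have "vexe 16 (While 5 bodyC) s [s'] (Suc (mm N b ps) * (C + 2) + 1)"
      using vexe_weaken by simp
    then show "\<exists>ss t. vexe 16 (While 5 bodyC) s ss (Suc (mm N b ps) * (C + 2) + 1) \<and>
        represents X m0 b t ss"
      using represents_leaf[OF d f] by blast
  next
    fix s' ps' assume v: "vexe 16 bodyC s [s'] C" and r: "rep N X m0 b ps' n s'"
      and m: "mm N b ps' < mm N b ps"
    from less.hyps[OF m r, folded C_def] obtain ss t
      where ss: "vexe 16 (While 5 bodyC) s' ss (Suc (mm N b ps') * (C + 2) + 1)"
        "represents X m0 b t ss" by blast
    have "vexe 16 (While 5 bodyC) s (concat [ss]) (C + (Suc (mm N b ps') * (C + 2) + 1) + 2)"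
      by (rule vexe_while_step[where s = s, OF _ s5 v]) (use ss in simp_all)
    from vexe_weaken[OF this le[OF m]] ss(2)
    show "\<exists>ss t. vexe 16 (While 5 bodyC) s ss (Suc (mm N b ps) * (C + 2) + 1) \<and>
        represents X m0 b t ss" by auto
  next
    fix bs ss assume ex: "expand b bs" and v: "vexe 16 bodyC s ss C"
      and cont: "list_all2 (continues N X m0 (mm N b ps)) bs ss"
    define k where "k = mm N b ps * (C + 2) + 1"
    have one: "\<exists>p. vexe 16 (While 5 bodyC) s' (fst p) k \<and> represents X m0 b' (snd p) (fst p)"
      if "continues N X m0 (mm N b ps) b' s'" for b' s'
      using that unfolding continues_def
    proof (elim disjE exE conjE)
      fix ps' n' assume r: "rep N X m0 b' ps' n' s'" and m: "mm N b' ps' < mm N b ps"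
      from less.hyps[OF m r, folded C_def] obtain us t
        where us: "vexe 16 (While 5 bodyC) s' us (Suc (mm N b' ps') * (C + 2) + 1)"
          "represents X m0 b' t us" by blast
      have "Suc (mm N b' ps') * (C + 2) + 1 \<le> k"
        unfolding k_def using m by (intro add_mono mult_le_mono) auto
      then show ?thesis using vexe_weaken[OF us(1)] us(2) by (intro exI[of _ "(us, t)"]) simp
    next
      assume c: "closed_branch b'" and d: "finish X m0 b' s'"
      have "vexe 16 (While 5 bodyC) s' [s'] 1"
        by (rule vexe_while_end) (use d in \<open>simp_all add: finish_def\<close>)
      then have "vexe 16 (While 5 bodyC) s' [s'] k" by (rule vexe_weaken) (simp add: k_def)
      moreover have "fully_expanded b'" using c by (simp add: fully_expanded_def)
      ultimately show ?thesis using represents_leaf[OF d] by (intro exI[of _ "([s'], Tab b' [])"]) simp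
    qed
    have "list_all2 (\<lambda>b' s'. \<exists>p. vexe 16 (While 5 bodyC) s' (fst p) k \<and>
        represents X m0 b' (snd p) (fst p)) bs ss"
      using cont by (rule list_all2_mono) (rule one)
    from list_all2_ex[OF this] obtain zs where zs: "length zs = length bs"
      "\<forall>i<length bs. vexe 16 (While 5 bodyC) (ss ! i) (fst (zs ! i)) k \<and>
         represents X m0 (bs ! i) (snd (zs ! i)) (fst (zs ! i))" by blast
    have ls: "length ss = length bs" using cont by (simp add: list_all2_lengthD)
    have "vexe 16 (While 5 bodyC) s (concat (map fst zs)) (C + k + 2)"
      by (rule vexe_while_step[where s = s, OF _ s5 v]) (use zs ls in \<open>auto simp: list_all2_conv_all_nth\<close>)
    moreover have "C + k + 2 = Suc (mm N b ps) * (C + 2) + 1" by (simp add: k_def)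
    moreover have "represents X m0 b (Tab b (map snd zs)) (concat (map fst zs))"
      by (rule represents_node[OF ex]) (use zs in auto)
    ultimately show "\<exists>ss t. vexe 16 (While 5 bodyC) s ss (Suc (mm N b ps) * (C + 2) + 1) \<and>
        represents X m0 b t ss" by metis
  qed
qed

subsection \<open>Validation of the input\<close>

text \<open>Register 12 holds a stack of pairs of a kind and a tree; a tree of kind \<open>Tip\<close> has to encode
  a formula, the others a number.\<close>

definition failC :: com where
  "failC = asgs 40 [(13, XT), (12, XT)]"

definition pushC :: "exp \<Rightarrow> exp \<Rightarrow> com" where
  "pushC a e = asgs 40 [(12, XN (XN a e) (XV 12))]"

definition headQ :: "tree \<Rightarrow> qry" where
  "headQ t = QEq (XL (XV 8)) (cx t)"

definition bitQ :: qry where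
  "bitQ = orQ (QAnd (headQ Tip) (QNot (QEq (XR (XV 8)) XT))) (headQ one_bit)"

definition binQ :: qry where
  "binQ = orQ (headQ (enc_nat 2)) (headQ (enc_nat 3))"

definition kindQ :: qry where
  "kindQ = QEq (XL (XV 7)) XT"

definition formC :: com where
  "formC = If 8 failC (ifq 40 (headQ (enc_nat 0)) (pushC (cx one_bit) (XR (XV 8)))
    (ifq 40 (headQ (enc_nat 1)) (pushC XT (XR (XV 8)))
    (ifq 40 binQ (asgs 40 [(12, XN (XN XT (XL (XR (XV 8)))) (XN (XN XT (XR (XR (XV 8)))) (XV 12)))])
      failC)))"

definition natC :: com where
  "natC = If 8 SKIP (ifq 40 bitQ (pushC (cx one_bit) (XR (XV 8))) failC)"

definition vstep :: com where
  "vstep = asgs 40 [(7, XL (XV 12)), (12, XR (XV 12)), (8, XR (XV 7))] ;; ifq 40 kindQ formC natC"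

definition vcost :: "nat \<Rightarrow> nat" where
  "vcost V = qcost (headQ (enc_nat 0)) V + qcost (headQ (enc_nat 1)) V + qcost binQ V +
     qcost bitQ V + qcost kindQ V + 200"

fun stk :: "(bool \<times> tree) list \<Rightarrow> tree" where
  "stk [] = Tip"
| "stk ((b, t) # es) = Node (Node (if b then one_bit else Tip) t) (stk es)"

fun entry_ok :: "bool \<times> tree \<Rightarrow> bool" where
  "entry_ok (b, t) \<longleftrightarrow> (if b then \<exists>n. t = enc_nat n else \<exists>f. t = enc_form f)"

definition ssum :: "(bool \<times> tree) list \<Rightarrow> nat" where
  "ssum es = sum_list (map (\<lambda>e. tsize (snd e)) es)"

text \<open>Besides its tree, an entry adds two pairs and a tag of at most three nodes.\<close>

lemma tsize_stk: "tsize (stk es) \<le> 1 + 6 * ssum es"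
proof (induction es)
  case (Cons e es)
  obtain b t where "e = (b, t)" by (cases e)
  moreover have "1 \<le> tsize t" by (simp add: Suc_le_eq)
  ultimately show ?case using Cons by (simp add: ssum_def)
qed simp

definition vinv :: "tree \<Rightarrow> (bool \<times> tree) list \<Rightarrow> state \<Rightarrow> bool" where
  "vinv x es s \<longleftrightarrow> s 12 = stk es \<and> s 0 = x \<and>
     (s 13 \<noteq> Tip \<and> (\<forall>e\<in>set es. entry_ok e) \<longleftrightarrow> (\<exists>f. x = enc_form f)) \<and>
     ssum es \<le> tsize x \<and> bounded 16 (6 * tsize x + 20) s"

lemma qok_val: "qok 16 40 (headQ t)" "qok 16 40 binQ" "qok 16 40 bitQ" "qok 16 40 kindQ"
  by (simp_all add: qok_def headQ_def binQ_def bitQ_def kindQ_def orQ_def)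

lemma vexe_asgs_upds:
  "list_all (\<lambda>(d, e). d < 16 \<and> evars e \<subseteq> {..<16}) ds \<Longrightarrow> upds ds s = t \<Longrightarrow> acost ds \<le> n \<Longrightarrow>
    vexe 16 (asgs 40 ds) s [t] n"
  using vexe_weaken[OF vexe_asgs[of 16 40 ds s]] by simp

text \<open>Deciding a set of trees includes rejecting those that code no formula. A round replaces
  an entry by proper subtrees, so the total size falls; the entries and the flag in register 13
  together remain equivalent to validity of the input.\<close>

lemma vexe_vstep:
  assumes I: "vinv x es s" and ne: "s 12 \<noteq> Tip"
  shows "\<exists>s' es'. vexe 16 vstep s [s'] (vcost (6 * tsize x + 20)) \<and> vinv x es' s' \<and> ssum es' < ssum es"
proof -
  let ?V = "6 * tsize x + 20"
  obtain k t es1 where es: "es = (k, t) # es1"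
    using I ne by (cases es rule: stk.cases) (auto simp: vinv_def)
  have s12: "s 12 = Node (Node (if k then one_bit else Tip) t) (stk es1)" using I es by (simp add: vinv_def)
  have b: "bounded 16 ?V s" and s0: "s 0 = x" and le: "ssum es \<le> tsize x"
    and ok: "s 13 \<noteq> Tip \<and> (\<forall>e\<in>set es. entry_ok e) \<longleftrightarrow> (\<exists>f. x = enc_form f)"
    using I by (simp_all add: vinv_def)
  define s1 where "s1 = s(7 := Node (if k then one_bit else Tip) t, 12 := stk es1, 8 := t)"
  have v1: "vexe 16 (asgs 40 [(7, XL (XV 12)), (12, XR (XV 12)), (8, XR (XV 7))]) s [s1] 20"
    by (rule vexe_asgs_upds) (simp_all add: s12 s1_def)
  have "tsize (s 12) \<le> ?V" using b unfolding bounded_def by simp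
  then have b1: "bounded 16 ?V s1" unfolding s1_def
    by (intro bounded_upd b) (use s12 in \<open>auto split: if_splits\<close>)
  \<comment> \<open>The shape of every successful round: the popped entry gives way to parts that
    lack at least its root.\<close>
  have upd12: "vinv x es2 (s1(12 := stk es2)) \<and> ssum es2 < ssum es"
    if "ssum es2 \<le> ssum es1 + (tsize t - 1)"
      "(\<forall>e\<in>set es2. entry_ok e) \<longleftrightarrow> entry_ok (k, t) \<and> (\<forall>e\<in>set es1. entry_ok e)" for es2
  proof -
    have lt: "ssum es2 < ssum es" using that(1) es tsize_pos[of t] by (simp add: ssum_def del: tsize_pos)
    then have "tsize (stk es2) \<le> ?V" using tsize_stk[of es2] le by simp
    then have "bounded 16 ?V (s1(12 := stk es2))" by (intro bounded_upd b1)
    then show ?thesis using lt le ok that(2) s0 es by (auto simp: vinv_def s1_def)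
  qed
  have fail: "vexe 16 failC s1 [s1(13 := Tip, 12 := Tip)] 5"
    unfolding failC_def by (rule vexe_asgs_upds) simp_all
  have failI: "vinv x [] (s1(13 := Tip, 12 := Tip)) \<and> ssum [] < ssum es" if "\<not> entry_ok (k, t)"
  proof -
    have "bounded 16 ?V (s1(13 := Tip, 12 := Tip))" by (intro bounded_upd b1) simp_all
    then show ?thesis using that ok es s0 tsize_pos[of t] by (auto simp: vinv_def s1_def ssum_def simp del: tsize_pos)
  qed
  have head: "sem (headQ u) s1 \<longleftrightarrow> left t = u" for u by (simp add: headQ_def s1_def)
  have kind: "sem kindQ s1 \<longleftrightarrow> \<not> k" by (simp add: kindQ_def s1_def)
  have s18: "s1 8 = t" by (simp add: s1_def)
  have bit: "sem bitQ s1 \<longleftrightarrow> left t = Tip \<and> right t \<noteq> Tip \<or> left t = one_bit"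
    by (simp add: bitQ_def head s18)
  have bin: "sem binQ s1 \<longleftrightarrow> left t = enc_nat 2 \<or> left t = enc_nat 3"
    by (simp only: binQ_def head sem_orQ)
  note QT = vexe_ifq_True[OF qok_val(1) b1] vexe_ifq_True[OF qok_val(2) b1]
    vexe_ifq_True[OF qok_val(3) b1] vexe_ifq_True[OF qok_val(4) b1]
  note QF = vexe_ifq_False[OF qok_val(1) b1] vexe_ifq_False[OF qok_val(2) b1]
    vexe_ifq_False[OF qok_val(3) b1] vexe_ifq_False[OF qok_val(4) b1]
  have push: "vexe 16 (pushC (cx one_bit) (XR (XV 8))) s1 [s1(12 := stk ((True, right t) # es1))] 20"
    "vexe 16 (pushC XT (XR (XV 8))) s1 [s1(12 := stk ((False, right t) # es1))] 20"
    unfolding pushC_def by (rule vexe_asgs_upds; simp add: s1_def)+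
  have push2: "vexe 16 (asgs 40 [(12, XN (XN XT (XL (XR (XV 8)))) (XN (XN XT (XR (XR (XV 8)))) (XV 12)))])
      s1 [s1(12 := stk ((False, left (right t)) # (False, right (right t)) # es1))] 20"
    by (rule vexe_asgs_upds) (simp_all add: s1_def)
  have sz: "tsize (right t) \<le> tsize t - 1" "tsize (left (right t)) + tsize (right (right t)) \<le> tsize t - 1"
    if tn: "t \<noteq> Tip"
  proof -
    obtain a c where t: "t = Node a c" using tn by (cases t) auto
    show "tsize (right t) \<le> tsize t - 1" by (simp add: t)
    have "tsize (left c) + tsize (right c) \<le> tsize c + 1" by (cases c) auto
    then show "tsize (left (right t)) + tsize (right (right t)) \<le> tsize t - 1"
      using tsize_pos[of a] by (simp add: t del: tsize_pos)
  qed
  have res: ?thesis if "vexe 16 (ifq 40 kindQ formC natC) s1 [s'] (vcost ?V - 20)"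
    "vinv x es' s' \<and> ssum es' < ssum es" for s' es'
  proof -
    have "vexe 16 vstep s [s'] (20 + (vcost ?V - 20))" unfolding vstep_def by (rule vexe_sq1[OF v1 that(1)])
    moreover have "20 + (vcost ?V - 20) = vcost ?V" by (simp add: vcost_def)
    ultimately have "vexe 16 vstep s [s'] (vcost ?V)" by (simp only:)
    then show ?thesis using that(2) by blast
  qed
  show ?thesis
  proof (cases k)
    case True
    then have kF: "\<not> sem kindQ s1" using kind by simp
    show ?thesis
    proof (cases "t = Tip")
      case Tip: True
      have "vexe 16 natC s1 [s1] (0 + 2)" unfolding natC_def
        by (rule vexe_if_tip[OF _ _ vexe_skip]) (simp_all add: s18 Tip)
      from QF(4)[OF kF this] have v: "vexe 16 (ifq 40 kindQ formC natC) s1 [s1] (vcost ?V - 20)"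
        by (rule vexe_weaken) (simp add: vcost_def)
      have "s1(12 := stk es1) = s1" by (simp add: s1_def fun_eq_iff)
      moreover have "entry_ok (k, t)" using True Tip isnat_iff[of t] by simp
      ultimately have "vinv x es1 s1 \<and> ssum es1 < ssum es"
        using upd12[of es1] by simp
      with v show ?thesis by (rule res)
    next
      case ne: False
      show ?thesis
      proof (cases "sem bitQ s1")
        case b: True
        have "vexe 16 natC s1 [s1(12 := stk ((True, right t) # es1))] (qcost bitQ ?V + 20 + 2 + 2)"
          unfolding natC_def
          by (rule vexe_if_node[OF _ _ QT(3)[OF b push(1)]]) (simp_all add: s18 ne)
        from QF(4)[OF kF this] have v: "vexe 16 (ifq 40 kindQ formC natC) s1
            [s1(12 := stk ((True, right t) # es1))] (vcost ?V - 20)"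
          by (rule vexe_weaken) (simp add: vcost_def)
        have "vinv x ((True, right t) # es1) (s1(12 := stk ((True, right t) # es1))) \<and>
            ssum ((True, right t) # es1) < ssum es"
        proof (rule upd12)
          have "entry_ok (k, t) \<longleftrightarrow> (\<exists>n. right t = enc_nat n)"
            using True ne b bit isnat_iff[of t] by simp
          then show "(\<forall>e\<in>set ((True, right t) # es1). entry_ok e) \<longleftrightarrow>
              entry_ok (k, t) \<and> (\<forall>e\<in>set es1. entry_ok e)" by simp
        qed (use sz[OF ne] in \<open>simp add: ssum_def\<close>)
        with v show ?thesis by (rule res)
      next
        case nb: False
        have "vexe 16 natC s1 [s1(13 := Tip, 12 := Tip)] (qcost bitQ ?V + 5 + 2 + 2)"
          unfolding natC_def
          by (rule vexe_if_node[OF _ _ QF(3)[OF nb fail]]) (simp_all add: s18 ne)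
        from QF(4)[OF kF this] have v: "vexe 16 (ifq 40 kindQ formC natC) s1
            [s1(13 := Tip, 12 := Tip)] (vcost ?V - 20)"
          by (rule vexe_weaken) (simp add: vcost_def)
        have "\<not> entry_ok (k, t)" using True ne nb bit isnat_iff[of t] by simp
        from v failI[OF this] show ?thesis by (rule res)
      qed
    qed
  next
    case False
    then have kT: "sem kindQ s1" using kind by simp
    show ?thesis
    proof (cases "t = Tip")
      case Tip: True
      have "vexe 16 formC s1 [s1(13 := Tip, 12 := Tip)] (5 + 2)" unfolding formC_def
        by (rule vexe_if_tip[OF _ _ fail]) (simp_all add: s18 Tip)
      from QT(4)[OF kT this] have v: "vexe 16 (ifq 40 kindQ formC natC) s1
          [s1(13 := Tip, 12 := Tip)] (vcost ?V - 20)"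
        by (rule vexe_weaken) (simp add: vcost_def)
      have "\<not> entry_ok (k, t)" using False Tip isform_iff[of t] by simp
      from v failI[OF this] show ?thesis by (rule res)
    next
      case ne: False
      have lift: "vexe 16 (ifq 40 kindQ formC natC) s1 [s'] (vcost ?V - 20)"
        if "vexe 16 (ifq 40 (headQ (enc_nat 0)) (pushC (cx one_bit) (XR (XV 8)))
    (ifq 40 (headQ (enc_nat 1)) (pushC XT (XR (XV 8)))
    (ifq 40 binQ (asgs 40 [(12, XN (XN XT (XL (XR (XV 8)))) (XN (XN XT (XR (XR (XV 8)))) (XV 12)))])
      failC))) s1 [s'] n" "n + 30 \<le> vcost ?V - qcost kindQ ?V" for s' n
      proof -
        have "vexe 16 formC s1 [s'] (n + 2)" unfolding formC_def
          by (rule vexe_if_node[OF _ _ that(1)]) (simp_all add: s18 ne)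
        from QT(4)[OF kT this] show ?thesis
          by (rule vexe_weaken) (use that(2) in \<open>simp add: vcost_def\<close>)
      qed
      consider "left t = enc_nat 0" | "left t = enc_nat 1" | "left t = enc_nat 2 \<or> left t = enc_nat 3"
        | "left t \<notin> {enc_nat 0, enc_nat 1, enc_nat 2, enc_nat 3}" by blast
      then show ?thesis
      proof cases
        case 1
        have v: "vexe 16 (ifq 40 kindQ formC natC) s1 [s1(12 := stk ((True, right t) # es1))] (vcost ?V - 20)"
          by (rule lift[OF QT(1)[OF _ push(1)]]) (use 1 head in \<open>simp_all add: vcost_def\<close>)
        have "vinv x ((True, right t) # es1) (s1(12 := stk ((True, right t) # es1))) \<and>
            ssum ((True, right t) # es1) < ssum es"
        proof (rule upd12)
          have "entry_ok (k, t) \<longleftrightarrow> (\<exists>n. right t = enc_nat n)"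
            using False ne 1 isform_iff[of t] by simp
          then show "(\<forall>e\<in>set ((True, right t) # es1). entry_ok e) \<longleftrightarrow>
              entry_ok (k, t) \<and> (\<forall>e\<in>set es1. entry_ok e)" by simp
        qed (use sz[OF ne] in \<open>simp add: ssum_def\<close>)
        with v show ?thesis by (rule res)
      next
        case 2
        have v: "vexe 16 (ifq 40 kindQ formC natC) s1 [s1(12 := stk ((False, right t) # es1))] (vcost ?V - 20)"
          by (rule lift[OF QF(1)[OF _ QT(1)[OF _ push(2)]]]) (use 2 head in \<open>simp_all add: vcost_def\<close>)
        have "vinv x ((False, right t) # es1) (s1(12 := stk ((False, right t) # es1))) \<and>
            ssum ((False, right t) # es1) < ssum es"
        proof (rule upd12)
          have "entry_ok (k, t) \<longleftrightarrow> (\<exists>f. right t = enc_form f)"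
            using False ne 2 isform_iff[of t] by simp
          then show "(\<forall>e\<in>set ((False, right t) # es1). entry_ok e) \<longleftrightarrow>
              entry_ok (k, t) \<and> (\<forall>e\<in>set es1. entry_ok e)" by simp
        qed (use sz[OF ne] in \<open>simp add: ssum_def\<close>)
        with v show ?thesis by (rule res)
      next
        case 3
        have ne3: "left t \<noteq> enc_nat 0" "left t \<noteq> enc_nat 1"
          using 3 by auto
        have v: "vexe 16 (ifq 40 kindQ formC natC) s1
            [s1(12 := stk ((False, left (right t)) # (False, right (right t)) # es1))] (vcost ?V - 20)"
          by (rule lift[OF QF(1)[OF _ QF(1)[OF _ QT(2)[OF _ push2]]]])
            (use 3 ne3 head bin in \<open>simp_all only: vcost_def, simp_all\<close>)
        have "vinv x ((False, left (right t)) # (False, right (right t)) # es1)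
            (s1(12 := stk ((False, left (right t)) # (False, right (right t)) # es1))) \<and>
            ssum ((False, left (right t)) # (False, right (right t)) # es1) < ssum es"
        proof (rule upd12)
          have "entry_ok (k, t) \<longleftrightarrow> (\<exists>f. left (right t) = enc_form f) \<and> (\<exists>f. right (right t) = enc_form f)"
            using False ne 3 ne3 isform_iff[of t] unfolding entry_ok.simps by (simp only:) simp
          then show "(\<forall>e\<in>set ((False, left (right t)) # (False, right (right t)) # es1). entry_ok e) \<longleftrightarrow>
              entry_ok (k, t) \<and> (\<forall>e\<in>set es1. entry_ok e)" by simp
        qed (use sz[OF ne] in \<open>simp add: ssum_def\<close>)
        with v show ?thesis by (rule res)
      next
        case 4
        have v: "vexe 16 (ifq 40 kindQ formC natC) s1 [s1(13 := Tip, 12 := Tip)] (vcost ?V - 20)"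
          by (rule lift[OF QF(1)[OF _ QF(1)[OF _ QF(2)[OF _ fail]]]])
            (use 4 head bin in \<open>simp_all only: vcost_def, simp_all\<close>)
        have "\<not> entry_ok (k, t)"
          using False 4 isform_iff[of t] unfolding entry_ok.simps insert_iff empty_iff by simp
        from v failI[OF this] show ?thesis by (rule res)
      qed
    qed
  qed
qed

subsection \<open>The complete program\<close>

definition revC :: com where
  "revC = asgs 40 [(1, XN (XL (XV 2)) (XV 1)), (2, XR (XV 2))]"

definition epilogue :: com where
  "epilogue = asgs 40 [(1, XT)] ;; While 2 revC ;; asgs 40 [(0, XV 6)]"

definition initC :: com where
  "initC = asgs 40 [(7, XN XT (XN (XN XT XT) (XV 0))), (2, XN (XV 7) XT), (3, XN (XV 7) XT), (4, XT),
     (5, cx one_bit)]"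

definition mainC :: com where
  "mainC = (asgs 40 [(12, XN (XN XT (XV 0)) XT), (13, cx one_bit)] ;; While 12 vstep) ;;
     If 13 (asgs 40 [(0, XT)]) (initC ;; While 5 bodyC ;; epilogue)"

text \<open>The initial value of \<open>mm\<close>: three times the bound on \<open>mu\<close> with
  the code size \<open>X\<close> in place of the formula size, plus the one pending formula.\<close>

definition mB :: "nat \<Rightarrow> nat" where
  "mB X = 3 * (X * X + X + 1) + 1"

definition mcost :: "nat \<Rightarrow> nat" where
  "mcost X = X * (vcost (6 * X + 20) + 2) + Suc (mB X) * (bcost (regB X (mB X)) + 2) +
     regB X (mB X) * 12 + 100"

text \<open>Items are pushed at the front during the run, so the branch has to be reversed before it
  is returned.\<close>

lemma vexe_revC:
  assumes "s 2 = enc_items xs" and "s 1 = Tip"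
  shows "\<exists>s'. vexe 16 (While 2 revC) s [s'] (length xs * 12 + 1) \<and> s' 1 = enc_items (rev xs) \<and> s' 6 = s 6"
proof -
  define I where "I ys t \<longleftrightarrow> t 2 = enc_items ys \<and> t 6 = s 6 \<and>
    (\<exists>zs. t 1 = enc_items zs \<and> rev ys @ zs = rev xs)" for ys and t :: state
  have "\<exists>t' ys'. vexe 16 revC t [t'] 10 \<and> I ys' t' \<and> length ys' < length ys"
    if I: "I ys t" and ne: "t 2 \<noteq> Tip" for ys t
  proof -
    obtain y ys' where ys: "ys = y # ys'" using I ne by (cases ys) (auto simp: I_def)
    obtain zs where zs: "t 1 = enc_items zs" "rev ys @ zs = rev xs" using I by (auto simp: I_def)
    let ?t = "t(1 := enc_items (y # zs), 2 := enc_items ys')"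
    have "vexe 16 revC t [?t] 10" unfolding revC_def
      by (rule vexe_asgs_upds) (use I ys zs in \<open>simp_all add: I_def\<close>)
    moreover have "I ys' ?t"
      unfolding I_def using zs ys I by (auto simp: I_def intro!: exI[of _ "y # zs"])
    ultimately show ?thesis using ys by (intro exI[of _ ?t] exI[of _ ys']) simp
  qed
  note loop = vexe_while_det[where I = I and m = length and r = 2 and K = 16, OF _ this]
  have "I xs s" using assms by (simp add: I_def)
  from loop[OF _ _ _ this] obtain s' ys where s': "vexe 16 (While 2 revC) s [s'] (length xs * (10 + 2) + 1)"
    "I ys s'" "s' 2 = Tip" by auto
  have "ys = []" using s'(2,3) by (cases ys) (auto simp: I_def)
  then show ?thesis using s' by (auto simp: I_def)
qed

lemma length_le_tsize_enc_items: "length xs \<le> tsize (enc_items xs)"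
  by (induction xs) auto

lemma vexe_epilogue:
  assumes "finish X m0 b s"
  shows "\<exists>s'. vexe 16 epilogue s [s'] (regB X m0 * 12 + 10) \<and>
    s' 1 = enc_items (items b) \<and> (s' 0 \<noteq> Tip \<longleftrightarrow> \<not> closed_branch b)"
proof -
  have s: "s 2 = enc_items (rev (items b))" "s 6 \<noteq> Tip \<longleftrightarrow> \<not> closed_branch b"
    and bd: "bounded 16 (regB X m0) s" using assms by (simp_all add: finish_def)
  have b: "tsize (s 2) \<le> regB X m0" using bd unfolding bounded_def by auto
  have l: "length (rev (items b)) \<le> regB X m0"
    using length_le_tsize_enc_items[of "rev (items b)"] b s(1) by simp
  let ?s = "s(1 := Tip)"
  have 1: "vexe 16 (asgs 40 [(1, XT)]) s [?s] 2" by (rule vexe_asgs_upds) simp_all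
  from vexe_revC[of ?s "rev (items b)"] s obtain t where
    t: "vexe 16 (While 2 revC) ?s [t] (length (rev (items b)) * 12 + 1)"
      "t 1 = enc_items (items b)" "t 6 = s 6" by auto
  let ?t = "t(0 := t 6)"
  have 2: "vexe 16 (asgs 40 [(0, XV 6)]) t [?t] 2" by (rule vexe_asgs_upds) simp_all
  have "vexe 16 epilogue s [?t] (2 + (length (rev (items b)) * 12 + 1 + 2))"
    unfolding epilogue_def by (intro vexe_sq1[OF 1] vexe_sq1[OF t(1)] 2)
  then have "vexe 16 epilogue s [?t] (regB X m0 * 12 + 10)" by (rule vexe_weaken) (use l in simp)
  then show ?thesis using t s by (intro exI[of _ ?t]) simp
qed

lemma vexe_valid:
  assumes s: "s = (\<lambda>_. Tip)(0 := x)"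
  shows "\<exists>s'. vexe 16 (asgs 40 [(12, XN (XN XT (XV 0)) XT), (13, cx one_bit)] ;; While 12 vstep) s [s']
      (tsize x * (vcost (6 * tsize x + 20) + 2) + 30) \<and> s' 0 = x \<and>
    (s' 13 \<noteq> Tip \<longleftrightarrow> (\<exists>f. x = enc_form f)) \<and> bounded 16 (6 * tsize x + 20) s'"
proof -
  let ?s = "s(12 := stk [(False, x)], 13 := one_bit)"
  have 1: "vexe 16 (asgs 40 [(12, XN (XN XT (XV 0)) XT), (13, cx one_bit)]) s [?s] 20"
    by (rule vexe_asgs_upds) (simp_all add: s)
  have "vinv x [(False, x)] ?s" by (simp add: vinv_def s ssum_def bounded_def)
  from vexe_while_det[where I = "vinv x" and m = ssum and r = 12 and K = 16, OF _ vexe_vstep this]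
  obtain s' es where s': "vexe 16 (While 12 vstep) ?s [s'] (ssum [(False, x)] * (vcost (6 * tsize x + 20) + 2) + 1)"
    "vinv x es s'" "s' 12 = Tip" by auto
  have "es = []" using s'(2,3) by (cases es rule: stk.cases) (auto simp: vinv_def)
  then have "s' 0 = x \<and> (s' 13 \<noteq> Tip \<longleftrightarrow> (\<exists>f. x = enc_form f)) \<and> bounded 16 (6 * tsize x + 20) s'"
    using s'(2) by (simp add: vinv_def)
  moreover have "vexe 16 (asgs 40 [(12, XN (XN XT (XV 0)) XT), (13, cx one_bit)] ;; While 12 vstep) s [s']
      (tsize x * (vcost (6 * tsize x + 20) + 2) + 30)"
    by (rule vexe_weaken[OF vexe_sq1[OF 1 s'(1)]]) (simp add: ssum_def)
  ultimately show ?thesis by blast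
qed

lemma regB_large: "6 * X + 20 \<le> regB X (mB X)"
proof -
  have "8 * mB X \<ge> 5 * X" by (simp add: mB_def)
  then show ?thesis by (simp add: regB_def)
qed

lemma rep_start:
  assumes s: "s 0 = enc_form f" and b: "bounded 16 (6 * X + 20) s" and X: "X = tsize (enc_form f)"
  defines "i \<equiv> Fm (Plus 0) f"
  shows "rep (fsize f) X (mB X) (start 0 f) [i] 0
    (s(7 := enc_item i, 2 := enc_items [i], 3 := enc_items [i], 4 := Tip, 5 := one_bit))"
    and "mm (fsize f) (start 0 f) [i] \<le> mB X"
proof -
  have fX: "fsize f \<le> X" unfolding X by (rule fsize_le_tsize_enc_form)
  have "mu (fsize f) (start 0 f) \<le> X * X + X + 1"
    using mu_start[of f 0] fX mult_le_mono[OF fX fX] by simp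
  then show m: "mm (fsize f) (start 0 f) [i] \<le> mB X" by (simp add: mm_def mB_def)
  have u: "und (start 0 f) = {(Plus 0, f)}" by (simp add: und_def start_def)
  have c: "\<not> closed_branch (start 0 f)" by (simp add: closed_branch_def start_def)
  have p: "pending_ok (start 0 f) [i]" unfolding pending_ok_def u by (simp add: i_def)
  have z: "sizes_ok X (start 0 f) 0" by (simp add: sizes_ok_def start_def X)
  have r: "tsize (s r) \<le> regB X (mB X)" if "r < 16" for r
    using b that regB_large[of X] unfolding bounded_def by (meson order_trans)
  have "tsize (enc_item i) \<le> regB X (mB X)"
    using regB_large[of X] fsize_pos[of f] fX by (simp add: i_def X)
  moreover have "3 \<le> regB X (mB X)" using regB_large[of X] by simp
  ultimately show "rep (fsize f) X (mB X) (start 0 f) [i] 0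
    (s(7 := enc_item i, 2 := enc_items [i], 3 := enc_items [i], 4 := Tip, 5 := one_bit))"
    using binv_start[of f 0] c p z m r unfolding rep_def by (simp add: start_def i_def)
qed

definition outcome_ok :: "tree \<Rightarrow> state list \<Rightarrow> bool" where
  "outcome_ok x ss \<longleftrightarrow>
     (if \<exists>f. x = enc_form f
      then \<exists>f t. x = enc_form f \<and> full_tableau_for f t \<and> {(s 0 \<noteq> Tip, s 1) | s. s \<in> set ss} =
          {(\<not> closed_branch b, enc_items (items b)) | b. b \<in> branches t}
      else \<forall>s\<in>set ss. s 0 = Tip)"

lemma exe_mainC: "\<exists>ss. exe mainC (snd (init x)) ss (mcost (tsize x)) \<and> outcome_ok x ss"
proof -
  let ?X = "tsize x" and ?M = "regB (tsize x) (mB (tsize x))"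
  define s where "s = (\<lambda>_ :: nat. Tip)(0 := x)"
  obtain s1 where s1: "vexe 16 (asgs 40 [(12, XN (XN XT (XV 0)) XT), (13, cx one_bit)] ;; While 12 vstep) s [s1]
      (?X * (vcost (6 * ?X + 20) + 2) + 30)" "s1 0 = x"
    "s1 13 \<noteq> Tip \<longleftrightarrow> (\<exists>f. x = enc_form f)" "bounded 16 (6 * ?X + 20) s1"
    using vexe_valid[OF s_def] by blast
  define tail where "tail = If 13 (asgs 40 [(0, XT)]) (initC ;; While 5 bodyC ;; epilogue)"
  define tc where "tc = Suc (mB ?X) * (bcost ?M + 2) + ?M * 12 + 70"
  have "\<exists>ss. vexe 16 tail s1 ss tc \<and> (\<forall>ss'. list_all2 (agree 16) ss' ss \<longrightarrow> outcome_ok x ss')"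
  proof (cases "\<exists>f. x = enc_form f")
    case False
    let ?t = "s1(0 := Tip)"
    have "vexe 16 (asgs 40 [(0, XT)]) s1 [?t] 2" by (rule vexe_asgs_upds) simp_all
    then have "vexe 16 tail s1 [?t] (2 + 2)" unfolding tail_def
      by (intro vexe_if_tip) (use s1 False in simp_all)
    then have "vexe 16 tail s1 [?t] tc" by (rule vexe_weaken) (simp add: tc_def)
    moreover have "outcome_ok x ss'" if "list_all2 (agree 16) ss' [?t]" for ss'
      using that False by (auto simp: list_all2_Cons2 outcome_ok_def)
    ultimately show ?thesis by blast
  next
    case True
    then obtain f where f: "x = enc_form f" by blast
    define i where "i = Fm (Plus 0) f"
    define s2 where "s2 = s1(7 := enc_item i, 2 := enc_items [i], 3 := enc_items [i], 4 := Tip, 5 := one_bit)"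
    have X: "?X = tsize (enc_form f)" using f by simp
    note st = rep_start[OF s1(2)[unfolded f] s1(4) X, folded i_def, folded s2_def]
    have i2: "vexe 16 initC s1 [s2] 40" unfolding initC_def
      by (rule vexe_asgs_upds) (simp_all add: s2_def i_def s1(2) f)
    from vexe_loop[OF st(1)] obtain ss t where
      ss: "vexe 16 (While 5 bodyC) s2 ss (Suc (mm (fsize f) (start 0 f) [i]) * (bcost ?M + 2) + 1)"
        "represents ?X (mB ?X) (start 0 f) t ss" by blast
    have ssc: "vexe 16 (While 5 bodyC) s2 ss (Suc (mB ?X) * (bcost ?M + 2) + 1)"
      by (rule vexe_weaken[OF ss(1)]) (use st(2) in \<open>intro add_mono mult_le_mono; simp\<close>)
    have "\<forall>s'\<in>set ss. \<exists>s''. vexe 16 epilogue s' [s''] (?M * 12 + 10) \<and>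
        (\<forall>b. finish ?X (mB ?X) b s' \<longrightarrow> s'' 1 = enc_items (items b) \<and> (s'' 0 \<noteq> Tip \<longleftrightarrow> \<not> closed_branch b))"
    proof
      fix s' assume "s' \<in> set ss"
      then obtain b where b: "finish ?X (mB ?X) b s'" using ss(2) unfolding represents_def by blast
      from vexe_epilogue[OF b] obtain s'' where s'': "vexe 16 epilogue s' [s''] (?M * 12 + 10)"
        "s'' 1 = enc_items (items b)" "s'' 0 \<noteq> Tip \<longleftrightarrow> \<not> closed_branch b" by blast
      \<comment> \<open>A final state may stand for several branches. As the encoding is injective
        they have the same items, so the outcome of the epilogue depends on the state alone and
        \<open>ep\<close> can be chosen.\<close>
      have "enc_items (items c) = enc_items (items b) \<and> (closed_branch c \<longleftrightarrow> closed_branch b)"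
        if "finish ?X (mB ?X) c s'" for c
      proof -
        have "map enc_item (rev (items c)) = map enc_item (rev (items b))"
          using that b els_enc_items unfolding finish_def by metis
        then have "items c = items b" by (auto simp: rev_map[symmetric] map_eq_conv inj_map_eq_map inj_def)
        then show ?thesis by (simp add: closed_branch_def)
      qed
      then show "\<exists>s''. vexe 16 epilogue s' [s''] (?M * 12 + 10) \<and>
        (\<forall>b. finish ?X (mB ?X) b s' \<longrightarrow> s'' 1 = enc_items (items b) \<and> (s'' 0 \<noteq> Tip \<longleftrightarrow> \<not> closed_branch b))"
        using s'' by (intro exI[of _ s'']) auto
    qed
    then obtain ep where ep: "\<forall>s'\<in>set ss. vexe 16 epilogue s' [ep s'] (?M * 12 + 10) \<and>
        (\<forall>b. finish ?X (mB ?X) b s' \<longrightarrow>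
          (ep s') 1 = enc_items (items b) \<and> ((ep s') 0 \<noteq> Tip \<longleftrightarrow> \<not> closed_branch b))" by metis
    have "vexe 16 (While 5 bodyC ;; epilogue) s2 (concat (map (\<lambda>s'. [ep s']) ss))
       (Suc (mB ?X) * (bcost ?M + 2) + 1 + (?M * 12 + 10))"
      by (rule vexe_sq[OF ssc]) (use ep in \<open>simp add: list_all2_conv_all_nth\<close>)
    moreover have "concat (map (\<lambda>s'. [ep s']) ss) = map ep ss" by (induction ss) auto
    ultimately have "vexe 16 (While 5 bodyC ;; epilogue) s2 (map ep ss)
       (Suc (mB ?X) * (bcost ?M + 2) + 1 + (?M * 12 + 10))" by simp
    from vexe_sq1[OF i2 this] have "vexe 16 tail s1 (map ep ss)
        (40 + (Suc (mB ?X) * (bcost ?M + 2) + 1 + (?M * 12 + 10)) + 2)"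
      unfolding tail_def by (intro vexe_if_node) (use s1(3) True in simp_all)
    then have v: "vexe 16 tail s1 (map ep ss) tc" by (rule vexe_weaken) (simp add: tc_def)
    \<comment> \<open>Only registers 0 and 1 matter for the outcome; both are visible, so the
      property passes to the actual machine states.\<close>
    have "outcome_ok x ss'" if a: "list_all2 (agree 16) ss' (map ep ss)" for ss'
    proof -
      have ft: "full_tableau_for f t" using ss(2) unfolding represents_def full_tableau_for_def by blast
      have len: "length ss' = length ss" using list_all2_lengthD[OF a] by simp
      have nth: "agree 16 (ss' ! k) (ep (ss ! k))" if "k < length ss" for k
        using list_all2_nthD[OF a, of k] that len by simp
      have 1: "\<exists>s'\<in>set ss. u 0 = ep s' 0 \<and> u 1 = ep s' 1" if mem: "u \<in> set ss'" for u
      proof -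
        obtain k where k: "k < length ss'" "u = ss' ! k" using mem by (metis in_set_conv_nth)
        then show ?thesis using nth[of k] len by (intro bexI[of _ "ss ! k"]) simp_all
      qed
      have 2: "\<exists>u\<in>set ss'. u 0 = ep s' 0 \<and> u 1 = ep s' 1" if mem: "s' \<in> set ss" for s'
      proof -
        obtain k where k: "k < length ss" "s' = ss ! k" using mem by (metis in_set_conv_nth)
        then show ?thesis using nth[of k] len by (intro bexI[of _ "ss' ! k"]) simp_all
      qed
      have eq: "{(u 0 \<noteq> Tip, u 1) | u. u \<in> set ss'} =
          {(\<not> closed_branch b, enc_items (items b)) | b. b \<in> branches t}" (is "?L = ?R")
      proof
        show "?L \<subseteq> ?R"
        proof clarify
          fix u assume "u \<in> set ss'"
          from 1[OF this] obtain s' where s': "s' \<in> set ss" "u 0 = ep s' 0" "u 1 = ep s' 1" by blast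
          then obtain b where b: "b \<in> branches t" "finish ?X (mB ?X) b s'"
            using ss(2) unfolding represents_def by blast
          have "u 1 = enc_items (items b)" "(u 0 \<noteq> Tip) = (\<not> closed_branch b)" using ep s' b(2) by auto
          then show "\<exists>b. (u 0 \<noteq> Tip, u 1) = (\<not> closed_branch b, enc_items (items b)) \<and> b \<in> branches t"
            using b(1) by blast
        qed
        show "?R \<subseteq> ?L"
        proof clarify
          fix b assume b: "b \<in> branches t"
          then obtain s' where s': "s' \<in> set ss" "finish ?X (mB ?X) b s'"
            using ss(2) unfolding represents_def by blast
          from 2[OF s'(1)] obtain u where u: "u \<in> set ss'" "u 0 = ep s' 0" "u 1 = ep s' 1" by blast
          have "u 1 = enc_items (items b)" "(u 0 \<noteq> Tip) = (\<not> closed_branch b)" using ep s' u by auto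
          then show "\<exists>u. (\<not> closed_branch b, enc_items (items b)) = (u 0 \<noteq> Tip, u 1) \<and> u \<in> set ss'"
            using u(1) by (intro exI[of _ u]) simp
        qed
      qed
      show ?thesis unfolding outcome_ok_def if_P[OF True]
        by (rule exI[of _ f], rule exI[of _ t], rule conjI[OF f conjI[OF ft eq]])
    qed
    with v show ?thesis by blast
  qed
  then obtain ss where ss: "vexe 16 tail s1 ss tc"
    "\<forall>ss'. list_all2 (agree 16) ss' ss \<longrightarrow> outcome_ok x ss'" by blast
  have m: "vexe 16 ((asgs 40 [(12, XN (XN XT (XV 0)) XT), (13, cx one_bit)] ;; While 12 vstep) ;; tail) s ss
      (?X * (vcost (6 * ?X + 20) + 2) + 30 + tc)" by (rule vexe_sq1[OF s1(1) ss(1)])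
  have "?X * (vcost (6 * ?X + 20) + 2) + 30 + tc = mcost ?X" by (simp add: mcost_def tc_def)
  with vexeD[OF m, of s] obtain ss' where
    "exe ((asgs 40 [(12, XN (XN XT (XV 0)) XT), (13, cx one_bit)] ;; While 12 vstep) ;; tail) s ss' (mcost ?X)"
    "list_all2 (agree 16) ss' ss" by auto
  then have "exe mainC s ss' (mcost ?X)" "outcome_ok x ss'"
    using ss(2) unfolding mainC_def tail_def[symmetric] by simp_all
  moreover have "snd (init x) = s" by (simp add: init_def s_def)
  ultimately show ?thesis by (intro exI[of _ ss']) simp
qed

lemma pb_mcost: "pb mcost"
proof -
  have v: "pb vcost" unfolding vcost_def by (intro pb_intros pb_qcost)
  have d: "pb dcost" unfolding dcost_def by (intro pb_intros pb_qcost)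
  have b: "pb bcost" unfolding bcost_def by (intro pb_intros pb_qcost d)
  have m: "pb mB" unfolding mB_def by (intro pb_intros)
  have r: "pb (\<lambda>X. regB X (mB X))" unfolding regB_def itemB_def by (intro pb_intros m)
  show ?thesis unfolding mcost_def
    by (intro pb_intros m r pb_compose[OF b r] pb_compose[OF v])
qed

section \<open>The tableau program as a decision procedure\<close>

definition tableau_prog :: prog where
  "tableau_prog = comp mainC 0"

lemma tableau_prog_results: "\<exists>ss. results tableau_prog x = set ss \<and> outcome_ok x ss"
  and tableau_prog_halts: "halts_within tableau_prog x (mcost (tsize x))"
proof -
  obtain ss where "exe mainC (snd (init x)) ss (mcost (tsize x))" "outcome_ok x ss"
    using exe_mainC by blast
  note r = exe_results[OF this(1), folded tableau_prog_def]
  show "\<exists>ss. results tableau_prog x = set ss \<and> outcome_ok x ss"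
    using r(1) \<open>outcome_ok x ss\<close> by blast
  show "halts_within tableau_prog x (mcost (tsize x))" by (rule r(2))
qed

lemma halts_within_mono: "halts_within P x n \<Longrightarrow> n \<le> m \<Longrightarrow> halts_within P x m"
  unfolding halts_within_def by (meson order_trans)

lemma runs_tableau_prog: "runs_tableau tableau_prog f"
proof -
  obtain ss where ss: "results tableau_prog (enc_form f) = set ss" "outcome_ok (enc_form f) ss"
    using tableau_prog_results by blast
  have "\<exists>f'. enc_form f = enc_form f'" by blast
  from ss(2)[unfolded outcome_ok_def if_P[OF this]] obtain f' t where
    t: "enc_form f = enc_form f'" "full_tableau_for f' t" "{(s 0 \<noteq> Tip, s 1) | s. s \<in> set ss} =
      {(\<not> closed_branch b, enc_items (items b)) | b. b \<in> branches t}" by (elim exE conjE)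
  from t(1) have "f' = f" by simp
  then show ?thesis unfolding runs_tableau_def ss(1) using t(2,3) by (intro exI[of _ t] conjI) simp_all
qed

lemma tableau_prog_decides:
  assumes "infinite (UNIV :: 'u set)"
  shows "decides tableau_prog (SCI_SAT TYPE('u))"
  unfolding decides_def
proof
  fix x
  obtain ss where ss: "results tableau_prog x = set ss" "outcome_ok x ss"
    using tableau_prog_results by blast
  show "accepts tableau_prog x \<longleftrightarrow> x \<in> SCI_SAT TYPE('u)"
  proof (cases "\<exists>f. x = enc_form f")
    case True
    then obtain f where f: "x = enc_form f" by blast
    obtain t where t: "full_tableau_for f t"
      "{(s 0 \<noteq> Tip, s 1) | s. s \<in> results tableau_prog x} =
        {(\<not> closed_branch b, enc_items (items b)) | b. b \<in> branches t}"
      using runs_tableau_prog[of f] unfolding runs_tableau_def f by (elim exE conjE)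
    have "accepts tableau_prog x \<longleftrightarrow> True \<in> fst ` {(s 0 \<noteq> Tip, s 1) | s. s \<in> results tableau_prog x}"
      unfolding accepts_def setcompr_eq_image image_image fst_conv by auto
    also have "\<dots> \<longleftrightarrow> open_tableau t"
      unfolding t(2) open_tableau_def setcompr_eq_image image_image fst_conv by auto
    also have "\<dots> \<longleftrightarrow> satisfiable TYPE('u) f" using tableau_decides(1)[OF assms t(1)] by blast
    also have "\<dots> \<longleftrightarrow> x \<in> SCI_SAT TYPE('u)" unfolding SCI_SAT_def f by auto
    finally show ?thesis .
  next
    case False
    then have "\<not> accepts tableau_prog x" using ss unfolding accepts_def outcome_ok_def by auto
    then show ?thesis using False unfolding SCI_SAT_def by auto
  qed
qed

lemma poly_time_tableau_prog: "poly_time tableau_prog"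
proof -
  obtain p where "\<forall>n. mcost n \<le> poly p n" using pb_mcost unfolding pb_def by blast
  then show ?thesis unfolding poly_time_def
    by (intro exI[of _ p] allI halts_within_mono[OF tableau_prog_halts]) simp
qed

text \<open>The size of a formula ignores how long the names of its atoms are; \<open>k\<close> is
  the number of bits they need, and \<open>tsize_enc_form\<close> supplies the quadratic bound on
  the code.\<close>

lemma tableau_prog_halts_form:
  "\<exists>q :: nat poly. \<forall>f k. atoms f \<subseteq> {..<2 ^ k} \<longrightarrow>
     halts_within tableau_prog (enc_form f) (poly q (fsize f + k))"
proof -
  have "pb (\<lambda>n. (4 * n + 11) * n)" by (intro pb_intros)
  then obtain q :: "nat poly" where q: "\<forall>n. (4 * n + 11) * n \<le> poly q n" unfolding pb_def by blast
  obtain p where p: "\<forall>n. mcost n \<le> poly p n" using pb_mcost unfolding pb_def by blast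
  have "halts_within tableau_prog (enc_form f) (poly (pcompose p q) (fsize f + k))"
    if a: "atoms f \<subseteq> {..<2 ^ k}" for f k
  proof (rule halts_within_mono[OF tableau_prog_halts])
    have "tsize (enc_form f) \<le> (4 * k + 11) * fsize f" by (rule tsize_enc_form[OF a])
    also have "\<dots> \<le> (4 * (fsize f + k) + 11) * (fsize f + k)" by (intro mult_le_mono) auto
    also have "\<dots> \<le> poly q (fsize f + k)" using q by blast
    finally have "poly p (tsize (enc_form f)) \<le> poly p (poly q (fsize f + k))" by (rule poly_nat_mono)
    with p[rule_format, of "tsize (enc_form f)"]
    show "mcost (tsize (enc_form f)) \<le> poly (pcompose p q) (fsize f + k)"
      unfolding poly_pcompose by (rule order_trans)
  qed
  then show ?thesis by blast
qed

subsection \<open>Computations as SCI formulas\<close>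

text \<open>Since \<open>\<equiv>\<close> is a congruence of every model, SCI formulas can be used as terms: the
  function symbols are of the form \<open>\<lambda>x. x \<rightarrow> c\<close> for fixed atoms \<open>c\<close>. Time \<open>t\<close> is the term
  \<open>tm t\<close>, and \<open>rg (tm t) r\<close> is the content of register \<open>r\<close> at that time. The universe of the
  intended model contains all trees, and two more symbols of this kind map a tree to its subtrees.
  Thus a computation needs only a fixed number of atoms. Atom \<open>0\<close> is kept for templates.\<close>

abbreviation "aS \<equiv> Atom (Suc 0)"
abbreviation "aPc \<equiv> Atom 2"
abbreviation "aL \<equiv> Atom 3"
abbreviation "aR \<equiv> Atom 4"
abbreviation "aTip \<equiv> Atom 5"

definition conj :: "form \<Rightarrow> form \<Rightarrow> form" where
  "conj f g = Neg (Imp f (Neg g))"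

fun conjs :: "form list \<Rightarrow> form" where
  "conjs [] = Ident aTip aTip"
| "conjs (f # fs) = conj f (conjs fs)"

fun tm :: "nat \<Rightarrow> form" where
  "tm 0 = Atom 6"
| "tm (Suc t) = Imp (tm t) aS"

definition pcf :: "form \<Rightarrow> form" where
  "pcf g = Imp g aPc"

definition rg :: "form \<Rightarrow> nat \<Rightarrow> form" where
  "rg g r = Imp g (Atom (2 * r + 8))"

text \<open>All addresses beyond the program become one halting location. Locations use the odd
  atoms from 7 on, registers the even ones from 8 on.\<close>

definition loc :: "prog \<Rightarrow> nat \<Rightarrow> form" where
  "loc P l = Atom (2 * min l (length P) + 7)"

definition frame :: "nat \<Rightarrow> form \<Rightarrow> nat list \<Rightarrow> form list" where
  "frame K g ds = map (\<lambda>r. Ident (rg (Imp g aS) r) (rg g r)) (filter (\<lambda>r. r \<notin> set ds) [0..<K])"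

text \<open>\<open>NODE\<close> is described through the selectors, as there is no symbol for
  pairing: its value differs from \<open>Tip\<close> and has the prescribed parts. For
  \<open>CHOOSE\<close> the implication is a disjunction of the two successor locations.\<close>

fun effect :: "prog \<Rightarrow> nat \<Rightarrow> form \<Rightarrow> nat \<Rightarrow> instr \<Rightarrow> form list" where
  "effect P K g l (CLEAR d) =
     [Ident (pcf (Imp g aS)) (loc P (Suc l)), Ident (rg (Imp g aS) d) aTip] @ frame K g [d]"
| "effect P K g l (MOVE d x) =
     [Ident (pcf (Imp g aS)) (loc P (Suc l)), Ident (rg (Imp g aS) d) (rg g x)] @ frame K g [d]"
| "effect P K g l (NODE d x y) =
     [Ident (pcf (Imp g aS)) (loc P (Suc l)), Neg (Ident (rg (Imp g aS) d) aTip),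
      Ident (Imp (rg (Imp g aS) d) aL) (rg g x), Ident (Imp (rg (Imp g aS) d) aR) (rg g y)] @
     frame K g [d]"
| "effect P K g l (LEFT d x) =
     [Ident (pcf (Imp g aS)) (loc P (Suc l)), Ident (rg (Imp g aS) d) (Imp (rg g x) aL)] @ frame K g [d]"
| "effect P K g l (RIGHT d x) =
     [Ident (pcf (Imp g aS)) (loc P (Suc l)), Ident (rg (Imp g aS) d) (Imp (rg g x) aR)] @ frame K g [d]"
| "effect P K g l (JUMP j) = Ident (pcf (Imp g aS)) (loc P j) # frame K g []"
| "effect P K g l (JTIP r j) =
     [Imp (Ident (rg g r) aTip) (Ident (pcf (Imp g aS)) (loc P j)),
      Imp (Neg (Ident (rg g r) aTip)) (Ident (pcf (Imp g aS)) (loc P (Suc l)))] @ frame K g []"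
| "effect P K g l (CHOOSE j) =
     Imp (Neg (Ident (pcf (Imp g aS)) (loc P j))) (Ident (pcf (Imp g aS)) (loc P (Suc l))) # frame K g []"

text \<open>The last line of \<open>stepf\<close> lets a halted configuration persist.\<close>

definition stepf :: "prog \<Rightarrow> nat \<Rightarrow> form \<Rightarrow> form" where
  "stepf P K g = conjs
     (map (\<lambda>l. Imp (Ident (pcf g) (loc P l)) (conjs (effect P K g l (P ! l)))) [0..<length P] @
      [Imp (Ident (pcf g) (loc P (length P)))
        (conjs (Ident (pcf (Imp g aS)) (loc P (length P)) # frame K g []))])"

text \<open>A subtree of the input is named by its path of selectors from \<open>g\<close>.\<close>

fun inp :: "tree \<Rightarrow> form \<Rightarrow> form list" where
  "inp Tip g = [Ident g aTip]"
| "inp (Node a b) g = Neg (Ident g aTip) # inp a (Imp g aL) @ inp b (Imp g aR)"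

text \<open>The first two identities reproduce the machine convention that both parts of
  \<open>Tip\<close> are \<open>Tip\<close>.\<close>

definition base :: "prog \<Rightarrow> nat \<Rightarrow> form list" where
  "base P K = [Ident (Imp aTip aL) aTip, Ident (Imp aTip aR) aTip, Ident (pcf (tm 0)) (loc P 0)] @
     map (\<lambda>r. Ident (rg (tm 0) r) aTip) [1..<K]"

definition constraints :: "prog \<Rightarrow> nat \<Rightarrow> nat \<Rightarrow> tree \<Rightarrow> form set" where
  "constraints P K T x = set (base P K) \<union> set (inp x (rg (tm 0) 0)) \<union>
     (\<lambda>t. stepf P K (tm t)) ` {..<T} \<union> {Neg (Ident (rg (tm T) 0) aTip)}"

fun iregs :: "instr \<Rightarrow> nat set" where
  "iregs (CLEAR d) = {d}"
| "iregs (MOVE d x) = {d, x}"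
| "iregs (NODE d x y) = {d, x, y}"
| "iregs (LEFT d x) = {d, x}"
| "iregs (RIGHT d x) = {d, x}"
| "iregs (JUMP l) = {}"
| "iregs (JTIP r l) = {r}"
| "iregs (CHOOSE l) = {}"

definition regs_below :: "prog \<Rightarrow> nat \<Rightarrow> bool" where
  "regs_below P K \<longleftrightarrow> 0 < K \<and> (\<forall>i\<in>set P. iregs i \<subseteq> {..<K})"

text \<open>A program mentions finitely many registers, which keeps the number of atoms independent
  of the input.\<close>

lemma regs_below_exists: "\<exists>K. regs_below P K"
proof -
  have "finite (iregs i)" for i by (cases i) auto
  then have "finite (\<Union> (iregs ` set P))" by blast
  then obtain k where "\<forall>r\<in>\<Union> (iregs ` set P). r \<le> k" using finite_nat_set_iff_bounded_le by blast
  then show ?thesis unfolding regs_below_def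
    by (intro exI[of _ "Suc k"]) (auto simp: less_Suc_eq_le)
qed

subsection \<open>From models to computations\<close>

locale valued_model =
  fixes M :: "'u sci_struct" and V :: "form \<Rightarrow> 'u"
  assumes model: "sci_model M" and val: "valuation M V"
begin

abbreviation holds :: "form \<Rightarrow> bool" where
  "holds f \<equiv> V f \<in> D M"

lemma V_U [simp]: "V f \<in> U M"
  using val by (simp add: valuation_def)

lemma holds_Neg [simp]: "holds (Neg f) \<longleftrightarrow> \<not> holds f"
  using model val V_U[of f] unfolding sci_model_def valuation_def by simp

lemma holds_Imp [simp]: "holds (Imp f g) \<longleftrightarrow> (holds f \<longrightarrow> holds g)"
  using model val V_U[of f] V_U[of g] unfolding sci_model_def valuation_def by simp

lemma holds_Ident [simp]: "holds (Ident f g) \<longleftrightarrow> V f = V g"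
  using model val V_U[of f] V_U[of g] unfolding sci_model_def valuation_def by simp

lemma holds_conj [simp]: "holds (conj f g) \<longleftrightarrow> holds f \<and> holds g"
  by (simp add: conj_def)

lemma holds_conjs [simp]: "holds (conjs fs) \<longleftrightarrow> (\<forall>f\<in>set fs. holds f)"
  by (induction fs) auto

lemma V_Imp: "V (Imp f g) = mimp M (V f) (V g)"
  using val by (simp add: valuation_def)

text \<open>A relation and not a function, because a model may contain many elements for one tree
  and others for none. It only asks that the selectors behave as in the finite tree along its
  paths.\<close>

fun repr :: "'u \<Rightarrow> tree \<Rightarrow> bool" where
  "repr u Tip \<longleftrightarrow> u = V aTip"
| "repr u (Node a b) \<longleftrightarrow> u \<noteq> V aTip \<and> repr (mimp M u (V aL)) a \<and> repr (mimp M u (V aR)) b"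

lemma repr_Tip: "repr u t \<Longrightarrow> u = V aTip \<longleftrightarrow> t = Tip"
  by (cases t) auto

lemma repr_inp: "(\<forall>f\<in>set (inp x g). holds f) \<Longrightarrow> repr (V g) x"
  by (induction x arbitrary: g) (auto simp: V_Imp[symmetric])

lemma repr_left:
  assumes "repr u t" and "V (Imp aTip aL) = V aTip"
  shows "repr (mimp M u (V aL)) (left t)"
  using assms by (cases t) (auto simp: V_Imp)

lemma repr_right:
  assumes "repr u t" and "V (Imp aTip aR) = V aTip"
  shows "repr (mimp M u (V aR)) (right t)"
  using assms by (cases t) (auto simp: V_Imp)

definition encodes :: "prog \<Rightarrow> nat \<Rightarrow> form \<Rightarrow> nat \<Rightarrow> (nat \<Rightarrow> tree) \<Rightarrow> bool" where
  "encodes P K g pc s \<longleftrightarrow> V (pcf g) = V (loc P pc) \<and> (\<forall>r<K. repr (V (rg g r)) (s r))"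

lemma holds_frame:
  "(\<forall>f\<in>set (frame K g ds). holds f) \<longleftrightarrow> (\<forall>r<K. r \<notin> set ds \<longrightarrow> V (rg (Imp g aS) r) = V (rg g r))"
  by (auto simp: frame_def)

lemma encodes_frame:
  assumes "encodes P K g pc s" and "\<forall>f\<in>set (frame K g ds). holds f"
    and "V (pcf (Imp g aS)) = V (loc P pc')"
    and "\<And>r. r \<in> set ds \<Longrightarrow> repr (V (rg (Imp g aS) r)) (s' r)" and "\<And>r. r \<notin> set ds \<Longrightarrow> s' r = s r"
  shows "encodes P K (Imp g aS) pc' s'"
  using assms unfolding encodes_def holds_frame by metis

text \<open>The model may give different locations the same value, in which case constraints for
  further addresses apply as well; those for \<open>pc\<close> hold in any case and determine a
  step.\<close>

lemma encodes_step:
  assumes P: "regs_below P K" and tip: "V (Imp aTip aL) = V aTip" "V (Imp aTip aR) = V aTip"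
    and pc: "pc < length P" and at: "encodes P K g pc s" and st: "holds (stepf P K g)"
  shows "\<exists>pc' s'. step P (pc, s) (pc', s') \<and> encodes P K (Imp g aS) pc' s'"
proof -
  have "holds (Imp (Ident (pcf g) (loc P pc)) (conjs (effect P K g pc (P ! pc))))"
    using st pc unfolding stepf_def holds_conjs by auto
  then have eff: "\<forall>f\<in>set (effect P K g pc (P ! pc)). holds f" using at by (simp add: encodes_def)
  have regs: "iregs (P ! pc) \<subseteq> {..<K}" using P pc by (simp add: regs_below_def)
  have rep: "repr (V (rg g r)) (s r)" if "r < K" for r using at that by (simp add: encodes_def)
  have st: "step P (pc, s) c \<longleftrightarrow> c \<in> exec (P ! pc) (pc, s)" for c using pc by (simp add: step_def)
  note fr = encodes_frame[OF at]
  show ?thesis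
  proof (cases "P ! pc")
    case (CLEAR d)
    have "encodes P K (Imp g aS) (Suc pc) (s(d := Tip))"
      by (rule fr[of "[d]"]) (use eff CLEAR in simp_all)
    then show ?thesis using CLEAR st by auto
  next
    case (MOVE d x)
    have "encodes P K (Imp g aS) (Suc pc) (s(d := s x))"
      by (rule fr[of "[d]"]) (use eff MOVE regs rep in simp_all)
    then show ?thesis using MOVE st by auto
  next
    case (NODE d x y)
    have "mimp M (V (rg (Imp g aS) d)) (V aL) = V (rg g x)"
      "mimp M (V (rg (Imp g aS) d)) (V aR) = V (rg g y)"
      using eff NODE by (simp_all add: V_Imp[symmetric])
    then have "encodes P K (Imp g aS) (Suc pc) (s(d := Node (s x) (s y)))"
      by (intro fr[of "[d]"]) (use eff NODE regs rep in simp_all)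
    then show ?thesis using NODE st by auto
  next
    case (LEFT d x)
    have "repr (mimp M (V (rg g x)) (V aL)) (left (s x))"
      by (rule repr_left[OF rep tip(1)]) (use regs LEFT in simp)
    then have "encodes P K (Imp g aS) (Suc pc) (s(d := left (s x)))"
      by (intro fr[of "[d]"]) (use eff LEFT in \<open>simp_all add: V_Imp[of "rg g x"]\<close>)
    then show ?thesis using LEFT st by auto
  next
    case (RIGHT d x)
    have "repr (mimp M (V (rg g x)) (V aR)) (right (s x))"
      by (rule repr_right[OF rep tip(2)]) (use regs RIGHT in simp)
    then have "encodes P K (Imp g aS) (Suc pc) (s(d := right (s x)))"
      by (intro fr[of "[d]"]) (use eff RIGHT in \<open>simp_all add: V_Imp[of "rg g x"]\<close>)
    then show ?thesis using RIGHT st by auto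
  next
    case (JUMP j)
    have "encodes P K (Imp g aS) j s" by (rule fr[of "[]"]) (use eff JUMP in simp_all)
    then show ?thesis using JUMP st by auto
  next
    case (JTIP r j)
    have "V (rg g r) = V aTip \<longleftrightarrow> s r = Tip" by (rule repr_Tip[OF rep]) (use regs JTIP in simp)
    then have "encodes P K (Imp g aS) (if s r = Tip then j else Suc pc) s"
      by (intro fr[of "[]"]) (use eff JTIP in \<open>simp_all split: if_splits\<close>)
    then show ?thesis using JTIP st by auto
  next
    case (CHOOSE j)
    then have "V (pcf (Imp g aS)) = V (loc P j) \<or> V (pcf (Imp g aS)) = V (loc P (Suc pc))"
      using eff by auto
    then show ?thesis
    proof
      assume "V (pcf (Imp g aS)) = V (loc P j)"
      then have "encodes P K (Imp g aS) j s" by (intro fr[of "[]"]) (use eff CHOOSE in simp_all)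
      then show ?thesis using CHOOSE st by auto
    next
      assume "V (pcf (Imp g aS)) = V (loc P (Suc pc))"
      then have "encodes P K (Imp g aS) (Suc pc) s" by (intro fr[of "[]"]) (use eff CHOOSE in simp_all)
      then show ?thesis using CHOOSE st by auto
    qed
  qed
qed

lemma encodes_halted:
  assumes pc: "length P \<le> pc" and at: "encodes P K g pc s" and st: "holds (stepf P K g)"
  shows "encodes P K (Imp g aS) pc s"
proof -
  have l: "loc P pc = loc P (length P)" using pc by (simp add: loc_def)
  have "holds (Imp (Ident (pcf g) (loc P (length P)))
        (conjs (Ident (pcf (Imp g aS)) (loc P (length P)) # frame K g [])))"
    using st unfolding stepf_def holds_conjs by auto
  then have "\<forall>f\<in>set (Ident (pcf (Imp g aS)) (loc P (length P)) # frame K g []). holds f"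
    using at l by (simp add: encodes_def)
  then show ?thesis by (intro encodes_frame[OF at, of "[]"]) (simp_all add: l)
qed

text \<open>A run is read off the model instant by instant. It may halt early, so its length
  \<open>n\<close> equals the time \<open>t\<close> only while the machine is active.\<close>

lemma model_run:
  assumes P: "regs_below P K" and halts: "halts_within P x T'" and T: "T' \<le> T"
    and con: "\<forall>f\<in>constraints P K T x. holds f"
  shows "accepts P x"
proof -
  have base: "\<forall>f\<in>set (base P K). holds f" and inp: "\<forall>f\<in>set (inp x (rg (tm 0) 0)). holds f"
    and st: "\<And>t. t < T \<Longrightarrow> holds (stepf P K (tm t))"
    and fin: "V (rg (tm T) 0) \<noteq> V aTip"
    using con by (auto simp: constraints_def)
  have tip: "V (Imp aTip aL) = V aTip" "V (Imp aTip aR) = V aTip" using base by (simp_all add: base_def)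
  have "t \<le> T \<Longrightarrow> \<exists>n pc s. (step P ^^ n) (init x) (pc, s) \<and> (n = t \<or> length P \<le> pc) \<and>
      encodes P K (tm t) pc s" for t
  proof (induction t)
    case 0
    have "repr (V (rg (tm 0) r)) (((\<lambda>_. Tip)(0 := x)) r)" if "r < K" for r
    proof (cases "r = 0")
      case True
      then show ?thesis using repr_inp[OF inp] by simp
    next
      case False
      then have "V (rg (tm 0) r) = V aTip" using base that by (simp add: base_def)
      then show ?thesis using False by simp
    qed
    then have "encodes P K (tm 0) 0 ((\<lambda>_. Tip)(0 := x))" using base by (simp add: encodes_def base_def)
    then show ?case by (intro exI[of _ 0]) (auto simp: init_def)
  next
    case (Suc t)
    then obtain n pc s where n: "(step P ^^ n) (init x) (pc, s)" "n = t \<or> length P \<le> pc"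
      "encodes P K (tm t) pc s" by auto
    have h: "holds (stepf P K (tm t))" using st Suc.prems by simp
    show ?case
    proof (cases "length P \<le> pc")
      case True
      then show ?thesis using n encodes_halted[OF True n(3) h] by auto
    next
      case False
      then have "pc < length P" by simp
      from encodes_step[OF P tip this n(3) h] obtain pc' s' where
        "step P (pc, s) (pc', s')" "encodes P K (tm (Suc t)) pc' s'" by auto
      moreover have "n = t" using n(2) False by simp
      ultimately show ?thesis using n(1) by (intro exI[of _ "Suc n"] exI[of _ pc'] exI[of _ s']) auto
    qed
  qed
  from this[of T] obtain n pc s where n: "(step P ^^ n) (init x) (pc, s)" "n = T \<or> length P \<le> pc"
    "encodes P K (tm T) pc s" by auto
  \<comment> \<open>A machine still active at time \<open>T\<close> could make one more step,
    against the time bound.\<close>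
  have "length P \<le> pc"
  proof (rule ccontr)
    assume "\<not> length P \<le> pc"
    then have pc: "pc < length P" and nT: "n = T" using n(2) by auto
    have "exec (P ! pc) (pc, s) \<noteq> {}" by (cases "P ! pc") auto
    then obtain c where "step P (pc, s) c" using pc by (auto simp: step_def)
    then have "(step P ^^ Suc n) (init x) c" using n(1) by auto
    then show False using halts T nT unfolding halts_within_def by fastforce
  qed
  then have "s \<in> results P x" using n(1) unfolding results_def by blast
  moreover have "repr (V (rg (tm T) 0)) (s 0)" using n(3) P by (simp add: encodes_def regs_below_def)
  then have "s 0 \<noteq> Tip" using repr_Tip fin by blast
  ultimately show ?thesis unfolding accepts_def by blast
qed

end

subsection \<open>From computations to models\<close>

datatype val = VF | VT | VTree tree | VTime nat | VLoc nat | VReg nat | VPc | VS | VL | VR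

text \<open>The right arguments of the special equations are designated, so the implication has to
  be designated but may take any such value. This freedom stores the passage of time, the
  configurations and the selectors.\<close>

fun vimp :: "(nat \<Rightarrow> nat \<times> (nat \<Rightarrow> tree)) \<Rightarrow> val \<Rightarrow> val \<Rightarrow> val" where
  "vimp c (VTime t) VS = VTime (Suc t)"
| "vimp c (VTime t) VPc = VLoc (fst (c t))"
| "vimp c (VTime t) (VReg r) = VTree (snd (c t) r)"
| "vimp c (VTree a) VL = VTree (left a)"
| "vimp c (VTree a) VR = VTree (right a)"
| "vimp c a b = (if a \<noteq> VF \<and> b = VF then VF else VT)"

definition vmodel :: "(nat \<Rightarrow> nat \<times> (nat \<Rightarrow> tree)) \<Rightarrow> val sci_struct" where
  "vmodel c = \<lparr>U = UNIV, D = - {VF}, mneg = (\<lambda>a. if a = VF then VT else VF), mimp = vimp c,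
     mident = (\<lambda>a b. if a = b then VT else VF)\<rparr>"

definition vatom :: "nat \<Rightarrow> val" where
  "vatom p = (if p = 1 then VS else if p = 2 then VPc else if p = 3 then VL else if p = 4 then VR
     else if p = 5 then VTree Tip else if p = 6 then VTime 0
     else if odd p then VLoc ((p - 7) div 2) else VReg ((p - 8) div 2))"

primrec cval :: "(nat \<Rightarrow> nat \<times> (nat \<Rightarrow> tree)) \<Rightarrow> form \<Rightarrow> val" where
  "cval c (Atom p) = vatom p"
| "cval c (Neg f) = mneg (vmodel c) (cval c f)"
| "cval c (Imp f g) = vimp c (cval c f) (cval c g)"
| "cval c (Ident f g) = mident (vmodel c) (cval c f) (cval c g)"

lemma vimp_VF: "vimp c a b = VF \<longleftrightarrow> a \<noteq> VF \<and> b = VF"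
  by (cases "(c, a, b)" rule: vimp.cases) auto

lemma valued_model_vmodel: "valued_model (vmodel c) (cval c)"
proof
  show "sci_model (vmodel c)" by (auto simp: sci_model_def vmodel_def vimp_VF)
  show "valuation (vmodel c) (cval c)" by (simp add: valuation_def vmodel_def)
qed

lemma cval_tm [simp]: "cval c (tm t) = VTime t"
  by (induction t) (simp_all add: vatom_def)

lemma cval_reg_atom: "vatom (2 * r + 8) = VReg r" and cval_loc_atom: "vatom (2 * l + 7) = VLoc l"
  by (simp_all add: vatom_def)

lemma cval_rg [simp]: "cval c (rg (tm t) r) = VTree (snd (c t) r)"
  "cval c (rg (Imp (tm t) aS) r) = VTree (snd (c (Suc t)) r)"
  by (simp_all only: rg_def cval.simps cval_tm cval_reg_atom) (simp_all add: vatom_def)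

lemma cval_pcf [simp]: "cval c (pcf (tm t)) = VLoc (fst (c t))"
  "cval c (pcf (Imp (tm t) aS)) = VLoc (fst (c (Suc t)))"
  by (simp_all add: pcf_def vatom_def)

lemma cval_loc [simp]: "cval c (loc P l) = VLoc (min l (length P))"
  by (simp only: loc_def cval.simps cval_loc_atom)

lemma cval_aTip [simp]: "cval c aTip = VTree Tip"
  by (simp add: vatom_def)

lemma cval_sub [simp]:
  "cval c (Imp f aL) = vimp c (cval c f) VL" "cval c (Imp f aR) = vimp c (cval c f) VR"
  by (simp_all add: vatom_def)

declare cval.simps [simp del] tm.simps(1) [simp del]

text \<open>Identifies all halted addresses, in accordance with \<open>loc\<close>.\<close>

definition norm :: "prog \<Rightarrow> config \<Rightarrow> config" where
  "norm P c = (min (fst c) (length P), snd c)"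

definition next_config :: "prog \<Rightarrow> config \<Rightarrow> config \<Rightarrow> bool" where
  "next_config P c c' \<longleftrightarrow> (if fst c < length P then \<exists>d. step P c d \<and> c' = norm P d else c' = c)"

lemma run_constraints:
  assumes c0: "c 0 = norm P (init x)" and nx: "\<And>t. t < T \<Longrightarrow> next_config P (c t) (c (Suc t))"
    and pc: "\<And>t. t \<le> T \<Longrightarrow> fst (c t) \<le> length P" and fin: "snd (c T) 0 \<noteq> Tip"
    and f: "f \<in> constraints P K T x"
  shows "cval c f \<in> D (vmodel c)"
proof -
  interpret valued_model "vmodel c" "cval c" by (rule valued_model_vmodel)
  have stp: "holds (stepf P K (tm t))" if t: "t < T" for t
  proof -
    have n: "next_config P (c t) (c (Suc t))" by (rule nx[OF t])
    have "holds (Imp (Ident (pcf (tm t)) (loc P l)) (conjs (effect P K (tm t) l (P ! l))))"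
      if l: "l < length P" for l
    \<comment> \<open>Here different locations have different values, so only the implication for
      the current address has a true premise.\<close>
    proof (cases "fst (c t) = l")
      case False
      then show ?thesis using l by simp
    next
      case True
      then obtain d where d: "d \<in> exec (P ! l) (l, snd (c t))" "c (Suc t) = norm P d"
        using n l unfolding next_config_def step_def by (metis prod.collapse)
      have fr: "(\<forall>f\<in>set (frame K (tm t) ds). holds f) \<longleftrightarrow>
          (\<forall>r<K. r \<notin> set ds \<longrightarrow> snd (c (Suc t)) r = snd (c t) r)" for ds
        by (simp add: holds_frame)
      have "\<forall>f\<in>set (effect P K (tm t) l (P ! l)). holds f"
        by (cases "P ! l") (use d True in \<open>auto simp: norm_def fr split: if_splits\<close>)
      then show ?thesis by simp
    qed
    moreover have "holds (Imp (Ident (pcf (tm t)) (loc P (length P)))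
        (conjs (Ident (pcf (Imp (tm t) aS)) (loc P (length P)) # frame K (tm t) [])))"
      using n by (auto simp: next_config_def holds_frame)
    ultimately show ?thesis unfolding stepf_def holds_conjs by auto
  qed
  have inp: "\<forall>f\<in>set (inp y g). holds f" if "cval c g = VTree y" for y g
    using that
  proof (induction y arbitrary: g)
    case Tip
    then show ?case by simp
  next
    case (Node a b)
    have "\<forall>f\<in>set (inp a (Imp g aL)). holds f" by (rule Node.IH) (simp add: Node.prems)
    moreover have "\<forall>f\<in>set (inp b (Imp g aR)). holds f" by (rule Node.IH) (simp add: Node.prems)
    ultimately show ?case using Node.prems by (simp add: ball_Un)
  qed
  have "\<forall>f\<in>set (base P K). holds f" using c0 by (auto simp: base_def norm_def init_def)
  moreover have "\<forall>f\<in>set (inp x (rg (tm 0) 0)). holds f" by (rule inp) (use c0 in \<open>simp add: norm_def init_def\<close>)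
  moreover have "holds (Neg (Ident (rg (tm T) 0) aTip))" using fin by simp
  ultimately show ?thesis using f stp unfolding constraints_def by blast
qed

lemma accepts_satisfiable:
  assumes halts: "halts_within P x T'" and T: "T' \<le> T" and acc: "accepts P x"
    and cs: "set cs = constraints P K T x"
  shows "satisfiable TYPE(val) (conjs cs)"
proof -
  obtain n pc s where n: "(step P ^^ n) (init x) (pc, s)" "length P \<le> pc" "s 0 \<noteq> Tip"
    using acc unfolding accepts_def results_def by blast
  from n(1) obtain g where g: "g 0 = init x" "g n = (pc, s)" "\<And>i. i < n \<Longrightarrow> step P (g i) (g (Suc i))"
    unfolding relpowp_fun_conv by blast
  have nT: "n \<le> T" using halts T n(1) unfolding halts_within_def by fastforce
  \<comment> \<open>The run is continued up to \<open>T\<close> by repeating its last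
    configuration.\<close>
  define c where "c t = norm P (g (min t n))" for t
  interpret valued_model "vmodel c" "cval c" by (rule valued_model_vmodel)
  have "next_config P (c t) (c (Suc t))" for t
  proof (cases "t < n")
    case True
    then have st: "step P (g t) (g (Suc t))" using g(3) by blast
    then have "fst (g t) < length P" by (simp add: step_def)
    then have "norm P (g t) = g t" by (simp add: norm_def)
    then show ?thesis using True st \<open>fst (g t) < length P\<close>
      by (auto simp: c_def next_config_def min_def simp del: split_paired_Ex)
  next
    case False
    then show ?thesis using n(2) g(2) by (simp add: c_def next_config_def norm_def min_def)
  qed
  moreover have "fst (c t) \<le> length P" for t by (simp add: c_def norm_def)
  moreover have "snd (c T) 0 \<noteq> Tip" using nT n(3) g(2) by (simp add: c_def norm_def min_def)
  moreover have "c 0 = norm P (init x)" using g(1) by (simp add: c_def)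
  ultimately have "\<forall>f\<in>constraints P K T x. cval c f \<in> D (vmodel c)"
    using run_constraints[of c P x T] by blast
  then have "\<forall>f\<in>set cs. cval c f \<in> D (vmodel c)" using cs by simp
  then have "holds (conjs cs)" by simp
  then show ?thesis using model val unfolding satisfiable_def by blast
qed

lemma constraints_correct:
  assumes inf: "infinite (UNIV :: 'u set)" and P: "regs_below P K"
    and halts: "halts_within P x T'" and T: "T' \<le> T" and cs: "set cs = constraints P K T x"
  shows "satisfiable TYPE('u) (conjs cs) \<longleftrightarrow> accepts P x"
proof
  assume "satisfiable TYPE('u) (conjs cs)"
  then obtain M :: "'u sci_struct" and V where m: "sci_model M" "valuation M V" "V (conjs cs) \<in> D M"
    unfolding satisfiable_def by blast
  interpret valued_model M V by (unfold_locales) (rule m)+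
  have "\<forall>f\<in>constraints P K T x. holds f" using m(3) cs by simp
  then show "accepts P x" by (rule model_run[OF P halts T])
next
  assume "accepts P x"
  then have s: "satisfiable TYPE(val) (conjs cs)" by (rule accepts_satisfiable[OF halts T _ cs])
  \<comment> \<open>A tableau moves satisfiability from \<open>val\<close> to \<open>'u\<close>:
    soundness for the one universe opens it, completeness for the other yields a model.\<close>
  obtain t where t: "full_tableau_for (conjs cs) t" using full_tableau_exists by blast
  then show "satisfiable TYPE('u) (conjs cs)" using complete[OF inf t sound[OF s t]] by blast
qed

subsection \<open>The reduction program\<close>

text \<open>Registers: 0 the input, 1 the formula built so far, 2 the stack of the traversal of the input,
  3 a list whose length bounds the input size, 4 the time, 5 and 6 the current subtree and the term
  for it, 7 and above the loop counters.\<close>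

definition negE :: "exp \<Rightarrow> exp" where
  "negE a = XN (cx (enc_nat 1)) a"

definition impE :: "exp \<Rightarrow> exp \<Rightarrow> exp" where
  "impE a b = XN (cx (enc_nat 2)) (XN a b)"

definition identE :: "exp \<Rightarrow> exp \<Rightarrow> exp" where
  "identE a b = XN (cx (enc_nat 3)) (XN a b)"

definition conjE :: "exp \<Rightarrow> exp \<Rightarrow> exp" where
  "conjE a b = negE (impE a (negE b))"

definition atomE :: "nat \<Rightarrow> exp" where
  "atomE p = cx (enc_form (Atom p))"

lemma atomE_simps [simp]:
  "ev (atomE p) s = enc_form (Atom p)" "evars (atomE p) = {}" "esz (atomE p) = tsize (enc_form (Atom p))"
  by (simp_all only: atomE_def ev_cx evars_cx esz_cx)

text \<open>A template for the machine: \<open>Atom 0\<close> stands for the time term in register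
  4. The step formula of a fixed program is thus emitted by one fixed expression, whatever the
  time.\<close>

fun fexp :: "form \<Rightarrow> exp" where
  "fexp (Atom p) = (if p = 0 then XV 4 else atomE p)"
| "fexp (Neg f) = negE (fexp f)"
| "fexp (Imp f g) = impE (fexp f) (fexp g)"
| "fexp (Ident f g) = identE (fexp f) (fexp g)"

fun hole :: "form \<Rightarrow> form \<Rightarrow> form" where
  "hole g (Atom p) = (if p = 0 then g else Atom p)"
| "hole g (Neg f) = Neg (hole g f)"
| "hole g (Imp f h) = Imp (hole g f) (hole g h)"
| "hole g (Ident f h) = Ident (hole g f) (hole g h)"

lemma ev_negE: "ev a s = enc_form f \<Longrightarrow> ev (negE a) s = enc_form (Neg f)"
  by (simp add: negE_def)

lemma ev_impE: "ev a s = enc_form f \<Longrightarrow> ev b s = enc_form g \<Longrightarrow> ev (impE a b) s = enc_form (Imp f g)"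
  by (simp add: impE_def)

lemma ev_identE: "ev a s = enc_form f \<Longrightarrow> ev b s = enc_form g \<Longrightarrow> ev (identE a b) s = enc_form (Ident f g)"
  by (simp add: identE_def)

lemma ev_conjE: "ev a s = enc_form f \<Longrightarrow> ev b s = enc_form g \<Longrightarrow> ev (conjE a b) s = enc_form (conj f g)"
  unfolding conjE_def conj_def by (intro ev_negE ev_impE)

lemma ev_fexp: "s 4 = enc_form g \<Longrightarrow> ev (fexp f) s = enc_form (hole g f)"
  by (induction f) (simp_all add: ev_negE ev_impE ev_identE)

lemma evars_fexp: "evars (fexp f) \<subseteq> {4}"
  by (induction f) (auto simp: negE_def impE_def identE_def)

lemma evars_E [simp]:
  "evars (negE a) = evars a" "evars (impE a b) = evars a \<union> evars b"
  "evars (identE a b) = evars a \<union> evars b" "evars (conjE a b) = evars a \<union> evars b"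
  by (simp_all add: negE_def impE_def identE_def conjE_def)

lemma hole_conj [simp]: "hole g (conj f h) = conj (hole g f) (hole g h)"
  by (simp add: conj_def)

lemma hole_conjs: "hole g (conjs fs) = conjs (map (hole g) fs)"
  by (induction fs) simp_all

lemma hole_frame: "map (hole g) (frame K (Atom 0) ds) = frame K g ds"
  by (simp add: frame_def rg_def)

lemma hole_effect: "map (hole g) (effect P K (Atom 0) l i) = effect P K g l i"
  by (cases i) (simp_all add: hole_frame pcf_def rg_def loc_def)

lemma hole_stepf: "hole g (stepf P K (Atom 0)) = stepf P K g"
  unfolding stepf_def hole_conjs
  by (simp add: hole_conjs hole_effect hole_frame pcf_def loc_def comp_def)

text \<open>\<open>h\<close> registers are visible.\<close>

definition inC :: "nat \<Rightarrow> com" where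
  "inC h = asgs h [(5, XL (XL (XV 2))), (6, XR (XL (XV 2))), (2, XR (XV 2)), (3, XN XT (XV 3))] ;;
     If 5 (asgs h [(1, conjE (identE (XV 6) (atomE 5)) (XV 1))])
       (asgs h [(1, conjE (negE (identE (XV 6) (atomE 5))) (XV 1)),
          (2, XN (XN (XL (XV 5)) (impE (XV 6) (atomE 3)))
             (XN (XN (XR (XV 5)) (impE (XV 6) (atomE 4))) (XV 2)))])"

definition stepC :: "prog \<Rightarrow> nat \<Rightarrow> nat \<Rightarrow> com" where
  "stepC P K h = asgs h [(1, conjE (fexp (stepf P K (Atom 0))) (XV 1)), (4, impE (XV 4) (atomE 1))]"

text \<open>Counting in unary: with a list of length m in register 3, \<open>j\<close> nested loops
  emit the step formula m to the power \<open>j\<close> times.\<close>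

fun nest :: "prog \<Rightarrow> nat \<Rightarrow> nat \<Rightarrow> nat \<Rightarrow> com" where
  "nest P K h 0 = stepC P K h"
| "nest P K h (Suc j) = asgs h [(7 + j, XV 3)] ;;
     While (7 + j) (asgs h [(7 + j, XR (XV (7 + j)))] ;; nest P K h j)"

fun padE :: "nat \<Rightarrow> exp" where
  "padE 0 = XV 3"
| "padE (Suc c) = XN XT (padE c)"

definition redC :: "prog \<Rightarrow> nat \<Rightarrow> nat \<Rightarrow> nat \<Rightarrow> com" where
  "redC P K c k =
    asgs (7 + k) [(1, cx (enc_form (conjs (base P K)))),
       (2, XN (XN (XV 0) (cx (enc_form (rg (tm 0) 0)))) XT), (3, XT), (4, cx (enc_form (tm 0)))] ;;
    While 2 (inC (7 + k)) ;;
    asgs (7 + k) [(3, padE c)] ;;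
    nest P K (7 + k) k ;;
    asgs (7 + k) [(1, conjE (negE (identE (fexp (rg (Atom 0) 0)) (atomE 5))) (XV 1)), (0, XV 1)]"

lemma vexe_asgs_to:
  "list_all (\<lambda>(d, e). d < h \<and> evars e \<subseteq> {..<h}) ds \<Longrightarrow> upds ds s = t \<Longrightarrow>
    vexe h (asgs h ds) s [t] (acost ds)"
  using vexe_asgs[of h h ds s] by simp

fun fstk :: "(tree \<times> form) list \<Rightarrow> tree" where
  "fstk [] = Tip"
| "fstk ((t, g) # es) = Node (Node t (enc_form g)) (fstk es)"

definition fsum :: "(tree \<times> form) list \<Rightarrow> nat" where
  "fsum es = sum_list (map (\<lambda>e. tsize (fst e)) es)"

text \<open>Passing to a subtree removes at least one node from the tree and adds at most 24 nodes to the
  code of the term.\<close>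

definition rinv :: "prog \<Rightarrow> nat \<Rightarrow> tree \<Rightarrow> nat \<Rightarrow> (tree \<times> form) list \<Rightarrow> state \<Rightarrow> bool" where
  "rinv P K x b es s \<longleftrightarrow> s 0 = x \<and> s 2 = fstk es \<and> s 4 = enc_form (tm 0) \<and>
     length (els (s 3)) + fsum es = tsize x \<and>
     (\<exists>cs. s 1 = enc_form (conjs cs) \<and>
        set cs \<union> (\<Union>(t, g)\<in>set es. set (inp t g)) = set (base P K) \<union> set (inp x (rg (tm 0) 0))) \<and>
     (\<forall>(t, g)\<in>set es. tsize (enc_form g) + 24 * tsize t \<le> b) \<and>
     tsize (s 1) + fsum es * (b + 100) \<le> tsize (enc_form (conjs (base P K))) + tsize x * (b + 100)"

definition incost :: nat where
  "incost = 300"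

lemma enc_small:
  "enc_nat (Suc (Suc 0)) = Node Tip (Node one_bit Tip)"
  "tsize (enc_form aTip) \<le> 15" "tsize (enc_form aL) \<le> 15" "tsize (enc_form aR) \<le> 15" "tsize (enc_form aS) \<le> 15"
proof -
  have "tsize (enc_nat 5) \<le> 13" "tsize (enc_nat 4) \<le> 13"
    using tsize_enc_nat[of 5 3] tsize_enc_nat[of 4 3] by simp_all
  then show "tsize (enc_form aTip) \<le> 15" "tsize (enc_form aL) \<le> 15" "tsize (enc_form aR) \<le> 15"
    "tsize (enc_form aS) \<le> 15" by simp_all
  show "enc_nat (Suc (Suc 0)) = Node Tip (Node one_bit Tip)" using enc_nat_2 by (simp add: numeral_2_eq_2)
qed

text \<open>A round emits the conjunct for one node of the input and adds an element to register 3,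
  which ends with as many elements as the input has nodes. This list drives the nested
  loops.\<close>

lemma vexe_inC:
  assumes h: "7 \<le> h" and I: "rinv P K x b es s" and ne: "s 2 \<noteq> Tip"
  shows "\<exists>s' es'. vexe h (inC h) s [s'] incost \<and> rinv P K x b es' s' \<and> fsum es' < fsum es"
proof -
  obtain t g es1 where es: "es = (t, g) # es1"
    using I ne by (cases es rule: fstk.cases) (auto simp: rinv_def)
  have s: "s 0 = x" "s 2 = Node (Node t (enc_form g)) (fstk es1)" "s 4 = enc_form (tm 0)"
    and len: "length (els (s 3)) + fsum es = tsize x"
    and bs: "\<forall>(t, g)\<in>set es1. tsize (enc_form g) + 24 * tsize t \<le> b"
    and bt: "tsize (enc_form g) + 24 * tsize t \<le> b"
    and sz: "tsize (s 1) + fsum es * (b + 100) \<le> tsize (enc_form (conjs (base P K))) + tsize x * (b + 100)"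
    using I es by (simp_all add: rinv_def)
  obtain cs where cs: "s 1 = enc_form (conjs cs)" "set cs \<union> (\<Union>(t, g)\<in>set es. set (inp t g)) =
      set (base P K) \<union> set (inp x (rg (tm 0) 0))" using I unfolding rinv_def by blast
  have cs1: "s (Suc 0) = enc_form (conjs cs)" using cs(1) by simp
  have fs: "fsum es = tsize t + fsum es1" by (simp add: fsum_def es)
  define s1 where "s1 = s(5 := t, 6 := enc_form g, 2 := fstk es1, 3 := Node Tip (s 3))"
  have v1: "vexe h (asgs h [(5, XL (XL (XV 2))), (6, XR (XL (XV 2))), (2, XR (XV 2)), (3, XN XT (XV 3))]) s [s1]
      (acost [(5, XL (XL (XV 2))), (6, XR (XL (XV 2))), (2, XR (XV 2)), (3, XN XT (XV 3))])"
    by (rule vexe_asgs_to) (use h s in \<open>simp_all add: s1_def\<close>)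
  show ?thesis
  proof (cases t)
    case Tip
    define c where "c = Ident g aTip"
    let ?as = "[(1, conjE (identE (XV 6) (atomE 5)) (XV 1))]"
    define s2 where "s2 = s1(1 := enc_form (conjs (c # cs)))"
    have e: "ev (conjE (identE (XV 6) (atomE 5)) (XV 1)) s1 = enc_form (conjs (c # cs))"
      unfolding conjs.simps c_def by (intro ev_conjE ev_identE) (simp_all add: s1_def cs1)
    have v2: "vexe h (asgs h ?as) s1 [s2] (acost ?as)"
    proof (rule vexe_asgs_to)
      show "upds ?as s1 = s2" by (simp only: upds.simps e s2_def)
    qed (use h in simp)
    have v3: "vexe h (inC h) s [s2] (acost [(5, XL (XL (XV 2))), (6, XR (XL (XV 2))), (2, XR (XV 2)), (3, XN XT (XV 3))]
        + (acost ?as + 2))"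
      unfolding inC_def by (rule vexe_sq1[OF v1 vexe_if_tip[OF _ _ v2]]) (use h Tip in \<open>simp_all add: s1_def\<close>)
    have v: "vexe h (inC h) s [s2] incost"
      by (rule vexe_weaken[OF v3])
        (use enc_small in \<open>simp add: incost_def conjE_def negE_def impE_def identE_def\<close>)
    \<comment> \<open>The bound \<open>b\<close> covers the term of the new conjunct, 100 its
      connectives and constants.\<close>
    have "tsize (s2 1) \<le> tsize (s 1) + b + 100"
      using bt enc_small by (simp add: s2_def c_def conj_def cs1)
    moreover have "fsum es1 * (b + 100) + (b + 100) \<le> fsum es * (b + 100)" by (simp add: fs Tip)
    ultimately have "tsize (s2 1) + fsum es1 * (b + 100) \<le>
        tsize (enc_form (conjs (base P K))) + tsize x * (b + 100)" using sz by linarith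
    moreover have "set (c # cs) \<union> (\<Union>(t, g)\<in>set es1. set (inp t g)) =
        set (base P K) \<union> set (inp x (rg (tm 0) 0))"
      using cs(2) by (simp add: es Tip c_def insert_commute)
    moreover have "length (els (s2 3)) + fsum es1 = tsize x" using len fs Tip by (simp add: s2_def s1_def)
    moreover have "s2 0 = x" "s2 2 = fstk es1" "s2 4 = enc_form (tm 0)"
      "s2 1 = enc_form (conjs (c # cs))" using s by (simp_all add: s2_def s1_def)
    ultimately have "rinv P K x b es1 s2" using bs unfolding rinv_def by blast
    moreover have "fsum es1 < fsum es" by (simp add: fs Tip)
    ultimately show ?thesis using v by blast
  next
    case (Node u w)
    define c where "c = Neg (Ident g aTip)"
    define es2 where "es2 = (u, Imp g aL) # (w, Imp g aR) # es1"
    let ?as = "[(1, conjE (negE (identE (XV 6) (atomE 5))) (XV 1)),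
          (2, XN (XN (XL (XV 5)) (impE (XV 6) (atomE 3)))
             (XN (XN (XR (XV 5)) (impE (XV 6) (atomE 4))) (XV 2)))]"
    define s2 where "s2 = s1(1 := enc_form (conjs (c # cs)), 2 := fstk es2)"
    have e: "ev (conjE (negE (identE (XV 6) (atomE 5))) (XV 1)) s1 = enc_form (conjs (c # cs))"
      unfolding conjs.simps c_def by (intro ev_conjE ev_negE ev_identE) (simp_all add: s1_def cs1)
    have i: "ev (impE (XV 6) (atomE p)) s' = enc_form (Imp g (Atom p))" if "s' 6 = enc_form g" for s' p
      by (rule ev_impE) (simp_all add: that)
    have v2: "vexe h (asgs h ?as) s1 [s2] (acost ?as)"
    proof (rule vexe_asgs_to)
      let ?s = "s1(1 := enc_form (conjs (c # cs)))"
      have "?s 5 = t" "?s 6 = enc_form g" "?s 2 = fstk es1" by (simp_all add: s1_def)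
      then have "ev (XN (XN (XL (XV 5)) (impE (XV 6) (atomE 3)))
             (XN (XN (XR (XV 5)) (impE (XV 6) (atomE 4))) (XV 2))) ?s = fstk es2"
        unfolding es2_def fstk.simps ev.simps by (simp only: i Node left.simps right.simps)
      then show "upds ?as s1 = s2" by (simp only: upds.simps e s2_def)
    qed (use h in simp)
    have v3: "vexe h (inC h) s [s2] (acost [(5, XL (XL (XV 2))), (6, XR (XL (XV 2))), (2, XR (XV 2)), (3, XN XT (XV 3))]
        + (acost ?as + 2))"
      unfolding inC_def by (rule vexe_sq1[OF v1 vexe_if_node[OF _ _ v2]]) (use h Node in \<open>simp_all add: s1_def\<close>)
    have v: "vexe h (inC h) s [s2] incost"
      by (rule vexe_weaken[OF v3])
        (use enc_small in \<open>simp add: incost_def conjE_def negE_def impE_def identE_def\<close>)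
    have f2: "Suc (fsum es2) = fsum es" by (simp add: es es2_def Node fsum_def)
    have "tsize (s2 1) \<le> tsize (s 1) + b + 100"
      using bt enc_small by (simp add: s2_def c_def conj_def cs1)
    moreover have "fsum es2 * (b + 100) + (b + 100) = fsum es * (b + 100)" by (simp add: f2[symmetric])
    ultimately have "tsize (s2 1) + fsum es2 * (b + 100) \<le>
        tsize (enc_form (conjs (base P K))) + tsize x * (b + 100)" using sz by linarith
    moreover have "set (c # cs) \<union> (\<Union>(t, g)\<in>set es2. set (inp t g)) =
        set (base P K) \<union> set (inp x (rg (tm 0) 0))"
      unfolding cs(2)[symmetric] by (auto simp: es es2_def Node c_def)
    moreover have "length (els (s2 3)) + fsum es2 = tsize x" using len f2 by (simp add: s2_def s1_def)
    moreover have "s2 0 = x" "s2 2 = fstk es2" "s2 4 = enc_form (tm 0)"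
      "s2 1 = enc_form (conjs (c # cs))" using s by (simp_all add: s2_def s1_def)
    moreover have "\<forall>(t, g)\<in>set es2. tsize (enc_form g) + 24 * tsize t \<le> b"
      using bs bt enc_small Node by (simp add: es2_def)
    ultimately have "rinv P K x b es2 s2" unfolding rinv_def by blast
    moreover have "fsum es2 < fsum es" using f2 by simp
    ultimately show ?thesis using v by blast
  qed
qed

lemma tsize_tm: "tsize (enc_form (tm t)) \<le> 20 + 30 * t"
proof (induction t)
  case 0
  have "tsize (enc_nat 6) \<le> 13" using tsize_enc_nat[of 6 3] by simp
  then show ?case by (simp add: tm.simps(1))
next
  case (Suc t)
  then show ?case using enc_small by simp
qed

definition ninv :: "prog \<Rightarrow> nat \<Rightarrow> form set \<Rightarrow> tree \<Rightarrow> nat \<Rightarrow> nat \<Rightarrow> state \<Rightarrow> bool" where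
  "ninv P K C y b t s \<longleftrightarrow> s 4 = enc_form (tm t) \<and> s 3 = y \<and>
     (\<exists>cs. s 1 = enc_form (conjs cs) \<and> set cs = C \<union> (\<lambda>t. stepf P K (tm t)) ` {..<t}) \<and>
     tsize (s 1) \<le> b + t * (esz (fexp (stepf P K (Atom 0))) * (20 + 30 * t) + 100)"

definition stcost :: "prog \<Rightarrow> nat \<Rightarrow> nat" where
  "stcost P K = acost [(1, conjE (fexp (stepf P K (Atom 0))) (XV 1)), (4, impE (XV 4) (atomE 1))]"

lemma vexe_stepC:
  assumes h: "7 \<le> h" and I: "ninv P K C y b t s"
  shows "\<exists>s'. vexe h (stepC P K h) s [s'] (stcost P K) \<and> ninv P K C y b (Suc t) s' \<and> (\<forall>r\<ge>7. s' r = s r)"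
proof -
  let ?f = "stepf P K (tm t)" and ?S = "esz (fexp (stepf P K (Atom 0)))"
  obtain cs where cs: "s 1 = enc_form (conjs cs)" "set cs = C \<union> (\<lambda>t. stepf P K (tm t)) ` {..<t}"
    and s: "s 4 = enc_form (tm t)" "s 3 = y" and sz: "tsize (s 1) \<le> b + t * (?S * (20 + 30 * t) + 100)"
    using I unfolding ninv_def by blast
  have f: "ev (fexp (stepf P K (Atom 0))) s = enc_form ?f"
    using ev_fexp[where s = s, OF s(1), of "stepf P K (Atom 0)"] unfolding hole_stepf .
  define s' where "s' = s(1 := enc_form (conjs (?f # cs)), 4 := enc_form (tm (Suc t)))"
  have e1: "ev (conjE (fexp (stepf P K (Atom 0))) (XV 1)) s = enc_form (conjs (?f # cs))"
    unfolding conjs.simps by (rule ev_conjE[OF f]) (simp only: ev.simps cs)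
  have e2: "ev (impE (XV 4) (atomE 1)) (s(1 := enc_form (conjs (?f # cs)))) = enc_form (tm (Suc t))"
    unfolding tm.simps by (rule ev_impE) (simp_all add: s)
  have v: "vexe h (stepC P K h) s [s'] (stcost P K)" unfolding stepC_def stcost_def
  proof (rule vexe_asgs_to)
    show "upds [(1, conjE (fexp (stepf P K (Atom 0))) (XV 1)), (4, impE (XV 4) (atomE 1))] s = s'"
      by (simp only: upds.simps e1 e2 s'_def)
    show "list_all (\<lambda>(d, e). d < h \<and> evars e \<subseteq> {..<h})
        [(1, conjE (fexp (stepf P K (Atom 0))) (XV 1)), (4, impE (XV 4) (atomE 1))]"
      using h evars_fexp[of "stepf P K (Atom 0)"] by auto
  qed
  \<comment> \<open>The template is fixed and register 4 is the only one it reads, so its instance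
    is linear in the size of the time term.\<close>
  have "tsize (ev (fexp (stepf P K (Atom 0))) s) \<le> ?S * (20 + 30 * t)"
    by (rule tsize_ev) (use evars_fexp[of "stepf P K (Atom 0)"] s tsize_tm[of t] in auto)
  then have "tsize (enc_form ?f) \<le> ?S * (20 + 30 * t)" unfolding f .
  then have "tsize (s' 1) \<le> ?S * (20 + 30 * t) + tsize (s 1) + 100"
    using enc_small cs(1) by (simp add: s'_def conj_def)
  also have "\<dots> \<le> b + Suc t * (?S * (20 + 30 * t) + 100)" using sz by simp
  also have "\<dots> \<le> b + Suc t * (?S * (20 + 30 * Suc t) + 100)"
    by (intro add_mono mult_le_mono order_refl) simp
  finally have sz': "tsize (s' 1) \<le> b + Suc t * (?S * (20 + 30 * Suc t) + 100)" .
  have "set (?f # cs) = C \<union> (\<lambda>t. stepf P K (tm t)) ` {..<Suc t}"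
    using cs(2) by (simp add: lessThan_Suc)
  moreover have "s' 1 = enc_form (conjs (?f # cs))" "s' 4 = enc_form (tm (Suc t))" "s' 3 = y"
    using s by (simp_all add: s'_def)
  ultimately have "ninv P K C y b (Suc t) s'" using sz' unfolding ninv_def by blast
  moreover have "\<forall>r\<ge>7. s' r = s r" by (simp add: s'_def)
  ultimately show ?thesis using v by blast
qed

fun ncost :: "nat \<Rightarrow> nat \<Rightarrow> nat \<Rightarrow> nat" where
  "ncost B m 0 = B"
| "ncost B m (Suc j) = 3 + m * (ncost B m j + 5) "

lemma ninv_upd: "ninv P K C y b t s \<Longrightarrow> 7 \<le> r \<Longrightarrow> ninv P K C y b t (s(r := u))"
  by (simp add: ninv_def)

lemma length_els_right: "t \<noteq> Tip \<Longrightarrow> length (els t) = Suc (length (els (right t)))"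
  by (cases t) auto

lemma vexe_nest:
  "7 + j \<le> h \<Longrightarrow> ninv P K C y b t s \<Longrightarrow>
    \<exists>s'. vexe h (nest P K h j) s [s'] (ncost (stcost P K) (length (els y)) j) \<and>
      ninv P K C y b (t + length (els y) ^ j) s' \<and> (\<forall>r\<ge>7+j. s' r = s r)"
proof (induction j arbitrary: t s)
  case 0
  then show ?case using vexe_stepC[of h P K C y b t s] by auto
next
  case (Suc j)
  let ?m = "length (els y)" and ?B = "stcost P K" and ?r = "7 + j"
  have rh: "?r < h" using Suc.prems by simp
  define s1 where "s1 = s(?r := y)"
  have y: "s 3 = y" using Suc.prems(2) by (simp add: ninv_def)
  have v1: "vexe h (asgs h [(?r, XV 3)]) s [s1] (acost [(?r, XV 3)])"
    by (rule vexe_asgs_to) (use rh y in \<open>simp_all add: s1_def\<close>)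
  \<comment> \<open>There are \<open>i\<close> rounds left, each advancing the time by
    \<open>?m ^ j\<close>; stating this as a sum avoids subtraction.\<close>
  define I where "I i u \<longleftrightarrow> (\<exists>t'. ninv P K C y b t' u \<and> t' + i * ?m ^ j = t + ?m ^ Suc j) \<and>
    length (els (u ?r)) = i \<and> (\<forall>r\<ge>7 + Suc j. u r = s r)" for i and u :: state
  have step: "\<exists>u' i'. vexe h (asgs h [(?r, XR (XV ?r))] ;; nest P K h j) u [u'] (3 + ncost ?B ?m j) \<and>
      I i' u' \<and> i' < i" if I: "I i u" and ne: "u ?r \<noteq> Tip" for i u
  proof -
    obtain t' where t': "ninv P K C y b t' u" "t' + i * ?m ^ j = t + ?m ^ Suc j"
      using I unfolding I_def by blast
    have len: "length (els (u ?r)) = i" and fr: "\<forall>r\<ge>7 + Suc j. u r = s r"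
      using I unfolding I_def by blast+
    have i: "i = Suc (length (els (right (u ?r))))" using length_els_right[OF ne] len by simp
    let ?u = "u(?r := right (u ?r))"
    have v: "vexe h (asgs h [(?r, XR (XV ?r))]) u [?u] (acost [(?r, XR (XV ?r))])"
      by (rule vexe_asgs_to) (use rh in simp_all)
    have "ninv P K C y b t' ?u" by (rule ninv_upd[OF t'(1)]) simp
    from Suc.IH[OF less_imp_le[OF rh] this] obtain u' where u': "vexe h (nest P K h j) ?u [u'] (ncost ?B ?m j)"
      "ninv P K C y b (t' + ?m ^ j) u'" "\<forall>r\<ge>7+j. u' r = ?u r" by blast
    have "t' + ?m ^ j + (i - 1) * ?m ^ j = t + ?m ^ Suc j" using t'(2) i by simp
    moreover have "length (els (u' ?r)) = i - 1" using u'(3) i by simp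
    moreover have "\<forall>r\<ge>7 + Suc j. u' r = s r" using u'(3) fr by simp
    ultimately have "I (i - 1) u'" using u'(2) unfolding I_def by blast
    moreover have "vexe h (asgs h [(?r, XR (XV ?r))] ;; nest P K h j) u [u'] (3 + ncost ?B ?m j)"
      by (rule vexe_weaken[OF vexe_sq1[OF v u'(1)]]) simp
    moreover have "i - 1 < i" using i by simp
    ultimately show ?thesis by blast
  qed
  have "I ?m s1" unfolding I_def
    by (intro conjI exI[of _ t]) (simp_all add: s1_def ninv_upd[OF Suc.prems(2)])
  from vexe_while_det[where I = I and m = "\<lambda>i. i" and r = ?r and K = h, OF rh step this]
  obtain u i where u: "vexe h (While ?r (asgs h [(?r, XR (XV ?r))] ;; nest P K h j)) s1 [u]
      (?m * (3 + ncost ?B ?m j + 2) + 1)" "I i u" "u ?r = Tip" by auto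
  have "i = 0" using u(2,3) unfolding I_def by simp
  then have "ninv P K C y b (t + ?m ^ Suc j) u" "\<forall>r\<ge>7 + Suc j. u r = s r"
    using u(2) unfolding I_def by auto
  moreover have "vexe h (nest P K h (Suc j)) s [u] (ncost ?B ?m (Suc j))"
    unfolding nest.simps by (rule vexe_weaken[OF vexe_sq1[OF v1 u(1)]]) (simp add: algebra_simps)
  ultimately show ?case by blast
qed

lemma padE_simps: "length (els (ev (padE c) s)) = length (els (s 3)) + c" "evars (padE c) = {3}"
  by (induction c) auto

lemma nest_no_choice [simp]: "no_choice (nest P K h j)"
  by (induction j) (simp_all add: stepC_def)

lemma redC_no_choice: "no_choice (redC P K c k)"
  by (simp add: redC_def inC_def)

text \<open>The summands are the base formulas, the description of the input, the step formulas with
  their unary time terms, and the acceptance condition.\<close>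

definition rsize :: "prog \<Rightarrow> nat \<Rightarrow> nat \<Rightarrow> nat \<Rightarrow> nat \<Rightarrow> nat" where
  "rsize P K c k n = tsize (enc_form (conjs (base P K))) +
     n * (tsize (enc_form (rg (tm 0) 0)) + 24 * n + 100) +
     (n + c) ^ k * (esz (fexp (stepf P K (Atom 0))) * (20 + 30 * (n + c) ^ k) + 100) +
     (20 + 30 * (n + c) ^ k) + 200"

text \<open>\<open>A\<close> collects the cost of the fixed assignments and is chosen before
  \<open>x\<close>, as a polynomial bound requires; 302 is one round of \<open>inC\<close> with its
  loop control.\<close>

lemma vexe_redC:
  "\<exists>A. \<forall>x. \<exists>s'. vexe (7 + k) (redC P K c k) ((\<lambda>_. Tip)(0 := x)) [s']
      (A + 302 * tsize x + ncost (stcost P K) (tsize x + c) k) \<and>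
    (\<exists>cs. s' 0 = enc_form (conjs cs) \<and> set cs = constraints P K ((tsize x + c) ^ k) x) \<and>
    tsize (s' 0) \<le> rsize P K c k (tsize x)"
proof -
  let ?h = "7 + k"
  let ?a1 = "[(1, cx (enc_form (conjs (base P K)))),
       (2, XN (XN (XV 0) (cx (enc_form (rg (tm 0) 0)))) XT), (3, XT), (4, cx (enc_form (tm 0)))]"
  let ?a2 = "[(3, padE c)]"
  let ?a3 = "[(1, conjE (negE (identE (fexp (rg (Atom 0) 0)) (atomE 5))) (XV 1)), (0, XV 1)]"
  define A where "A = acost ?a1 + acost ?a2 + acost ?a3 + 1"
  have "\<exists>s'. vexe ?h (redC P K c k) ((\<lambda>_. Tip)(0 := x)) [s']
      (A + 302 * tsize x + ncost (stcost P K) (tsize x + c) k) \<and>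
    (\<exists>cs. s' 0 = enc_form (conjs cs) \<and> set cs = constraints P K ((tsize x + c) ^ k) x) \<and>
    tsize (s' 0) \<le> rsize P K c k (tsize x)" for x
  proof -
    let ?s = "(\<lambda>_. Tip)(0 := x) :: state" and ?b = "tsize (enc_form (rg (tm 0) 0)) + 24 * tsize x"
    let ?T = "(tsize x + c) ^ k" and ?g = "rg (tm 0) 0"
    define s1 where "s1 = ?s(1 := enc_form (conjs (base P K)), 2 := fstk [(x, ?g)], 3 := Tip, 4 := enc_form (tm 0))"
    have v1: "vexe ?h (asgs ?h ?a1) ?s [s1] (acost ?a1)"
    proof (rule vexe_asgs_to)
      show "upds ?a1 ?s = s1" unfolding s1_def upds.simps ev.simps ev_cx fstk.simps by simp
    qed simp
    have "rinv P K x ?b [(x, ?g)] s1"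
      unfolding rinv_def by (intro conjI exI[of _ "base P K"]) (simp_all add: s1_def fsum_def)
    from vexe_while_det[where I = "rinv P K x ?b" and m = fsum and r = 2 and K = ?h, OF _ vexe_inC this]
    obtain s2 es where s2: "vexe ?h (While 2 (inC ?h)) s1 [s2] (fsum [(x, ?g)] * (incost + 2) + 1)"
      "rinv P K x ?b es s2" "s2 2 = Tip" by auto
    have "es = []" using s2(2,3) by (cases es rule: fstk.cases) (auto simp: rinv_def)
    then obtain cs where cs: "s2 1 = enc_form (conjs cs)" "set cs = set (base P K) \<union> set (inp x ?g)"
      and s2': "s2 4 = enc_form (tm 0)" "length (els (s2 3)) = tsize x"
        "tsize (s2 1) \<le> tsize (enc_form (conjs (base P K))) + tsize x * (?b + 100)"
      using s2(2) by (auto simp: rinv_def fsum_def)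
    let ?y = "ev (padE c) s2"
    define s3 where "s3 = s2(3 := ?y)"
    have v3: "vexe ?h (asgs ?h ?a2) s2 [s3] (acost ?a2)"
      by (rule vexe_asgs_to) (simp_all add: s3_def padE_simps)
    have ly: "length (els ?y) = tsize x + c" using padE_simps s2' by simp
    have "s3 1 = s2 1" "s3 3 = ?y" "s3 4 = s2 4" by (simp_all add: s3_def)
    then have "ninv P K (set cs) ?y (tsize (s2 1)) 0 s3"
      unfolding ninv_def using cs(1) s2'(1) by auto
    from vexe_nest[OF _ this, of k ?h] obtain s4 where
      s4: "vexe ?h (nest P K ?h k) s3 [s4] (ncost (stcost P K) (tsize x + c) k)"
      "ninv P K (set cs) ?y (tsize (s2 1)) ?T s4" unfolding ly by auto
    obtain ds where ds: "s4 1 = enc_form (conjs ds)"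
      "set ds = set cs \<union> (\<lambda>t. stepf P K (tm t)) ` {..<?T}" and s44: "s4 4 = enc_form (tm ?T)"
      and sz4: "tsize (s4 1) \<le> tsize (s2 1) + ?T * (esz (fexp (stepf P K (Atom 0))) * (20 + 30 * ?T) + 100)"
      using s4(2) unfolding ninv_def by blast
    let ?c = "Neg (Ident (rg (tm ?T) 0) aTip)"
    have hr: "hole (tm ?T) (rg (Atom 0) 0) = rg (tm ?T) 0" by (simp add: rg_def)
    have e: "ev (conjE (negE (identE (fexp (rg (Atom 0) 0)) (atomE 5))) (XV 1)) s4 = enc_form (conjs (?c # ds))"
      unfolding conjs.simps
      by (intro ev_conjE ev_negE ev_identE) (simp_all only: ev.simps atomE_simps ds ev_fexp[where s = s4, OF s44] hr)
    define s5 where "s5 = s4(1 := enc_form (conjs (?c # ds)), 0 := enc_form (conjs (?c # ds)))"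
    have v5: "vexe ?h (asgs ?h ?a3) s4 [s5] (acost ?a3)"
    proof (rule vexe_asgs_to)
      show "upds ?a3 s4 = s5" by (simp only: upds.simps e s5_def ev.simps fun_upd_same)
      show "list_all (\<lambda>(d, e). d < ?h \<and> evars e \<subseteq> {..<?h}) ?a3"
        using evars_fexp[of "rg (Atom 0) 0"] by auto
    qed
    have "vexe ?h (redC P K c k) ?s [s5] (acost ?a1 + (fsum [(x, ?g)] * (incost + 2) + 1 +
        (acost ?a2 + (ncost (stcost P K) (tsize x + c) k + acost ?a3))))"
      unfolding redC_def by (intro vexe_sq1[OF v1] vexe_sq1[OF s2(1)] vexe_sq1[OF v3] vexe_sq1[OF s4(1)] v5)
    then have v: "vexe ?h (redC P K c k) ?s [s5] (A + 302 * tsize x + ncost (stcost P K) (tsize x + c) k)"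
      by (rule vexe_weaken) (simp add: A_def fsum_def incost_def)
    have "set (?c # ds) = constraints P K ?T x"
      unfolding constraints_def using ds(2) cs(2) by auto
    moreover have s50: "s5 0 = enc_form (conjs (?c # ds))" by (simp add: s5_def)
    moreover have "tsize (s5 0) \<le> rsize P K c k (tsize x)"
    proof -
      have "tsize (enc_form (conjs ds)) \<le> tsize (s2 1) + ?T * (esz (fexp (stepf P K (Atom 0))) * (20 + 30 * ?T) + 100)"
        using sz4 ds(1) by simp
      moreover have "tsize (enc_nat 8) \<le> 17" using tsize_enc_nat[of 8 4] by simp
      then have "tsize (s5 0) \<le> tsize (enc_form (tm ?T)) + tsize (enc_form (conjs ds)) + 150"
        unfolding s50 using enc_small by (simp add: conj_def rg_def)
      ultimately show ?thesis using s2'(3) tsize_tm[of ?T] unfolding rsize_def by linarith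
    qed
    ultimately show ?thesis using v by blast
  qed
  then show ?thesis by blast
qed

section \<open>Polynomial time bounds and NP-hardness\<close>

text \<open>Brings a time bound into the form that nested loops over a padded list can
  count.\<close>

lemma poly_le_power: "\<exists>c k. \<forall>n. poly p n \<le> (n + c :: nat) ^ k"
proof (induction p)
  case 0
  show ?case by simp
next
  case (pCons a p)
  then obtain c k where ck: "\<forall>n. poly p n \<le> (n + c) ^ k" by blast
  \<comment> \<open>Adding \<open>a + 1\<close> to the constant lets the base absorb the coefficient
    \<open>a\<close> and keeps its powers at least 1.\<close>
  have "poly (pCons a p) n \<le> (n + (c + a + 1)) ^ Suc k" for n
  proof -
    have "n * poly p n \<le> n * (n + (c + a + 1)) ^ k"
      using ck order_trans[OF spec[OF ck, of n] power_mono[of "n + c" "n + (c + a + 1)" k]] by simp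
    moreover have "1 \<le> (n + (c + a + 1)) ^ k" by simp
    then have "a * 1 \<le> a * (n + (c + a + 1)) ^ k" by (rule mult_le_mono2)
    ultimately have "a + n * poly p n \<le> (a + n) * (n + (c + a + 1)) ^ k"
      unfolding add_mult_distrib by linarith
    also have "\<dots> \<le> (n + (c + a + 1)) * (n + (c + a + 1)) ^ k" by (rule mult_le_mono1) simp
    finally show ?thesis by simp
  qed
  then show ?case by blast
qed

lemma pb_ncost: "pb (\<lambda>n. ncost B (n + c) k)"
  by (induction k) (simp_all only: ncost.simps, (intro pb_intros | assumption)+)

lemma NP_hard_SCI_SAT:
  assumes inf: "infinite (UNIV :: 'u set)"
  shows "NP_hard (SCI_SAT TYPE('u))"
  unfolding NP_hard_def
proof
  fix L assume "L \<in> NP"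
  then obtain P p where P: "decides P L" and p: "\<forall>x. halts_within P x (poly p (tsize x))"
    unfolding NP_def poly_time_def by blast
  obtain K where K: "regs_below P K" using regs_below_exists by blast
  obtain c k where ck: "\<forall>n. poly p n \<le> (n + c) ^ k" using poly_le_power by blast
  obtain A where A: "\<forall>x. \<exists>s'. vexe (7 + k) (redC P K c k) ((\<lambda>_. Tip)(0 := x)) [s']
      (A + 302 * tsize x + ncost (stcost P K) (tsize x + c) k) \<and>
    (\<exists>cs. s' 0 = enc_form (conjs cs) \<and> set cs = constraints P K ((tsize x + c) ^ k) x) \<and>
    tsize (s' 0) \<le> rsize P K c k (tsize x)" using vexe_redC by blast
  define Q where "Q = comp (redC P K c k) 0"
  define N where "N n = A + 302 * n + ncost (stcost P K) (n + c) k" for n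
  have Q: "\<exists>y. results Q x \<noteq> {} \<and> (\<forall>s\<in>results Q x. s 0 = y) \<and> halts_within Q x (N (tsize x)) \<and>
      (\<exists>cs. y = enc_form (conjs cs) \<and> set cs = constraints P K ((tsize x + c) ^ k) x) \<and>
      tsize y \<le> rsize P K c k (tsize x)" for x
  proof -
    obtain s' where s': "vexe (7 + k) (redC P K c k) ((\<lambda>_. Tip)(0 := x)) [s'] (N (tsize x))"
      "\<exists>cs. s' 0 = enc_form (conjs cs) \<and> set cs = constraints P K ((tsize x + c) ^ k) x"
      "tsize (s' 0) \<le> rsize P K c k (tsize x)" using A unfolding N_def by blast
    from vexeD[OF s'(1), of "snd (init x)"] obtain t where
      t: "exe (redC P K c k) (snd (init x)) [t] (N (tsize x))" "agree (7 + k) t s'"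
      by (auto simp: init_def list_all2_Cons2)
    from exe_results[OF t(1)] have "results Q x = {t}" "halts_within Q x (N (tsize x))"
      by (simp_all add: Q_def)
    moreover have "t 0 = s' 0" using t(2) by simp
    ultimately show ?thesis using s'(2,3) by (intro exI[of _ "s' 0"]) simp
  qed
  then obtain h where h: "\<And>x. \<forall>s\<in>results Q x. s 0 = h x" "\<And>x. halts_within Q x (N (tsize x))"
    "\<And>x. \<exists>cs. h x = enc_form (conjs cs) \<and> set cs = constraints P K ((tsize x + c) ^ k) x"
    "\<And>x. tsize (h x) \<le> rsize P K c k (tsize x)" by metis
  have "pb N" unfolding N_def by (intro pb_intros pb_ncost)
  then obtain q where q: "\<forall>n. N n \<le> poly q n" unfolding pb_def by blast
  have "pb (rsize P K c k)" unfolding rsize_def by (intro pb_intros)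
  then obtain q' where q': "\<forall>n. rsize P K c k n \<le> poly q' n" unfolding pb_def by blast
  have "poly_time Q" unfolding poly_time_def
    using halts_within_mono[OF h(2)] q by blast
  moreover have "deterministic Q" unfolding Q_def by (rule deterministic_comp[OF redC_no_choice])
  moreover have "\<forall>x. tsize (h x) \<le> poly q' (tsize x)" using h(4) q' order_trans by blast
  ultimately have "poly_time_computable h" unfolding poly_time_computable_def using h(1) by blast
  moreover have "x \<in> L \<longleftrightarrow> h x \<in> SCI_SAT TYPE('u)" for x
  proof -
    obtain cs where cs: "h x = enc_form (conjs cs)" "set cs = constraints P K ((tsize x + c) ^ k) x"
      using h(3) by blast
    \<comment> \<open>The formula may follow the machine beyond its time bound; halted
      configurations persist, so the answer stays the same.\<close>
    have "poly p (tsize x) \<le> (tsize x + c) ^ k" using ck by blast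
    from constraints_correct[OF inf K spec[OF p] this cs(2)]
    have "satisfiable TYPE('u) (conjs cs) \<longleftrightarrow> x \<in> L" using P unfolding decides_def by blast
    then show ?thesis unfolding SCI_SAT_def cs(1) by auto
  qed
  ultimately show "poly_reducible L (SCI_SAT TYPE('u))" unfolding poly_reducible_def by blast
qed

theorem theorem4:
  assumes "infinite (UNIV :: 'u set)"
  shows
    "(\<forall>f. satisfiable TYPE('u) f \<longleftrightarrow> tableau_satisfiable f) \<and>
     (\<forall>f t. full_tableau_for f t \<longrightarrow> (satisfiable TYPE('u) f \<longleftrightarrow> open_tableau t)) \<and>
     (\<exists>p :: nat poly. \<forall>f w n b. (extends ^^ n) (start w f) b \<longrightarrow> n \<le> poly p (fsize f)) \<and>
     (\<exists>P. decides P (SCI_SAT TYPE('u)) \<and>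
          (\<forall>f. runs_tableau P f) \<and>
          poly_time P \<and>
          (\<exists>q :: nat poly. \<forall>f k. atoms f \<subseteq> {..<2 ^ k} \<longrightarrow>
             halts_within P (enc_form f) (poly q (fsize f + k)))) \<and>
     NP_complete (SCI_SAT TYPE('u))"
proof (intro conjI)
  show "\<forall>f. satisfiable TYPE('u) f \<longleftrightarrow> tableau_satisfiable f"
    using tableau_decides(2)[OF assms] by blast
  show "\<forall>f t. full_tableau_for f t \<longrightarrow> (satisfiable TYPE('u) f \<longleftrightarrow> open_tableau t)"
    using tableau_decides(1)[OF assms] by blast
  show "\<exists>p :: nat poly. \<forall>f w n b. (extends ^^ n) (start w f) b \<longrightarrow> n \<le> poly p (fsize f)"
    using extends_bound by blast
  show "\<exists>P. decides P (SCI_SAT TYPE('u)) \<and> (\<forall>f. runs_tableau P f) \<and> poly_time P \<and>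
      (\<exists>q :: nat poly. \<forall>f k. atoms f \<subseteq> {..<2 ^ k} \<longrightarrow>
        halts_within P (enc_form f) (poly q (fsize f + k)))"
    by (intro exI[of _ tableau_prog] conjI allI tableau_prog_decides[OF assms] runs_tableau_prog
        poly_time_tableau_prog tableau_prog_halts_form)
  have "SCI_SAT TYPE('u) \<in> NP"
    unfolding NP_def using poly_time_tableau_prog tableau_prog_decides[OF assms] by blast
  then show "NP_complete (SCI_SAT TYPE('u))"
    unfolding NP_complete_def using NP_hard_SCI_SAT[OF assms] by blast
qed

end
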